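(* Let $\mathcal V$ be a closed monoidal category and let $\mathcal C$ be a tensored $\mathcal V$-category. The following are equivalent: (1) Every $\mathcal V$-representable functor $\mathcal R^a=\mathcal C(a\to-):\mathcal C\to\widehat{\mathcal V}$ is tensored. (2) The $\mathcal V$-functor $\mathcal I:\mathcal C\to\overline{\mathcal C}$, $a\mapsto a\blacktriangleleft1_{\mathcal V}$, is tensored. (3) The $1_{\mathcal V}$-graded $\mathcal V$-natural transformation $\tau:\mathrm{id}^{\overline{\mathcal C}}\Rightarrow\overline{\mathrm{id}^{\mathcal C}}\circ\mathcal I$ defined by $\tau_{a\blacktriangleleft u}:=\mu^{\mathcal I}_{a,u}$ is a natural isomorphism. (4) The $\mathcal V$-functors $\mathcal I:\mathcal C\to\overline{\mathcal C}$, $a\mapsto a\blacktriangleleft1_{\mathcal V}$, and $\overline{\mathrm{id}^{\mathcal C}}:\overline{\mathcal C}\to\mathcal C$, $a\blacktriangleleft u\mapsto a\vartriangleleft u$, witness a $\mathcal V$-equivalence.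
   Context: Conventions: composition (also of functors) is written left to right; tensor products in $\mathcal V$ are juxtaposition; associators and unitors are suppressed; "mate" means the morphism corresponding under the indicated adjunction. A $\mathcal V$-category $\mathcal C$ has hom objects $\mathcal C(a\to b)\in\mathcal V$, identities $j_a:1_{\mathcal V}\to\mathcal C(a\to a)$ and composition $-\circ_{\mathcal C}-:\mathcal C(a\to b)\mathcal C(b\to c)\to\mathcal C(a\to c)$, associative and unital. A $\mathcal V$-functor $F$ has morphisms $F_{a\to b}:\mathcal C(a\to b)\to\mathcal D(F(a)\to F(b))$ compatible with composition and identities. A $1_{\mathcal V}$-graded $\mathcal V$-natural transformation $\sigma:F\Rightarrow G$ is a family $\sigma_a\in\mathcal V(1_{\mathcal V}\to\mathcal D(F(a)\to G(a)))$ with $(\sigma_aG_{a\to b})\circ(-\circ_{\mathcal D}-)=(F_{a\to b}\sigma_b)\circ(-\circ_{\mathcal D}-)$. The underlying category $\mathcal C^{\mathcal V}$ has $\mathcal C^{\mathcal V}(a\to b)=\mathcal V(1_{\mathcal V}\to\mathcal C(a\to b))$. Two $\mathcal V$-functors witness a $\mathcal V$-equivalence if both composites are $\mathcal V$-naturally isomorphic to identities. $\mathcal V$ closed: internal homs satisfy $\mathcal V(uw\to v)\cong\mathcal V(w\to\widehat{\mathcal V}(u\to v))$, with $\varepsilon^{\widehat{\mathcal V}}_{u\to v}:u\widehat{\mathcal V}(u\to v)\to v$ the mate of the identity. $\widehat{\mathcal V}$ is the self-enriched $\mathcal V$-category; its underlying category is identified with $\mathcal V$. $\mathcal R^a:\mathcal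 C\to\widehat{\mathcal V}$ is $b\mapsto\mathcal C(a\to b)$, with action the mate of $-\circ_{\mathcal C}-$. $\mathcal C$ is tensored if each $\mathcal R^a$ has a left $\mathcal V$-adjoint $v\mapsto a\vartriangleleft v$, i.e. a $\mathcal V$-functor $\widehat{\mathcal V}\to\mathcal C$ with $\mathcal V$-natural isomorphisms $\mathcal C(a\vartriangleleft v\to b)\cong\widehat{\mathcal V}(v\to\mathcal C(a\to b))$ in $\mathcal V$. Then $\mathcal C^{\mathcal V}(a\vartriangleleft v\to b)\cong\mathcal V(v\to\mathcal C(a\to b))$ ( * ), with unit $\eta^{\mathcal C}_{a,v}:v\to\mathcal C(a\to a\vartriangleleft v)$ and counit $\varepsilon^{\mathcal C}_{a\to b}:a\vartriangleleft\mathcal C(a\to b)\to b$. $\vartriangleleft$ is a bifunctor $\mathcal C^{\mathcal V}\times\mathcal V\to\mathcal C^{\mathcal V}$ ($f\vartriangleleft\mathrm{id}_v$ is the mate of $\eta^{\mathcal C}_{b,v}$ followed by precomposition with $f:a\to b$), and $\alpha_{a,u,v}:a\vartriangleleft uv\to a\vartriangleleft u\vartriangleleft v$ is the mate of $(\eta^{\mathcal C}_{a,u}\eta^{\mathcal C}_{a\vartriangleleft u,v})\circ(-\circ_{\mathcal C}-)$; it is invertible when $\mathcal C$ is tensored. For $\widehat{\mathcal V}$, $u\vartriangleleft v=uv$. A $\mathcal V$-functor $F:\mathcal C\to\mathcal D$ of tensored $\mathcal V$-categories is tensored if for all $c,v$ the morphism $\mu^F_{c,v}\in\mathcal D^{\mathcal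 V}(F(c)\vartriangleleft v\to F(c\vartriangleleft v))$, the mate of $\eta^{\mathcal C}_{c,v}\circ F_{c\to c\vartriangleleft v}\in\mathcal V(v\to\mathcal D(F(c)\to F(c\vartriangleleft v)))$, is an isomorphism. Completion: $\overline{\mathcal C}$ has objects formal symbols $a\blacktriangleleft u$ ($a\in\mathcal C$, $u\in\mathcal V$), hom objects $\overline{\mathcal C}(a\blacktriangleleft u\to b\blacktriangleleft v)=\widehat{\mathcal V}(u\to\mathcal C(a\to b)v)$, identity $j_{a\blacktriangleleft u}$ the mate of $j_a\mathrm{id}_u$, and composition the mate of $(\varepsilon^{\widehat{\mathcal V}}_{u\to\mathcal C(a\to b)v}\mathrm{id})\circ(\mathrm{id}_{\mathcal C(a\to b)}\varepsilon^{\widehat{\mathcal V}}_{v\to\mathcal C(b\to c)w})\circ((-\circ_{\mathcal C}-)\mathrm{id}_w)$. It is tensored with $(a\blacktriangleleft u)\vartriangleleft v=a\blacktriangleleft uv$. $\mathcal I_{a\to b}:\mathcal C(a\to b)\to\widehat{\mathcal V}(1_{\mathcal V}\to\mathcal C(a\to b))$ is the mate of $\mathrm{id}_{\mathcal C(a\to b)}$. Thus $\mu^{\mathcal I}_{a,u}\in\overline{\mathcal C}^{\mathcal V}(a\blacktriangleleft u\to(a\vartriangleleft u)\blacktriangleleft1_{\mathcal V})$, and these morphisms form a $\mathcal V$-natural transformation $\tau$. The $\mathcal V$-functor $\overline{\mathrm{id}^{\mathcal C}}$ acts on hom objects by the mate (under ( * )) of $\alpha^{-1}_{a,u,\widehat{\mathcal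 V}(u\to\mathcal C(a\to b)v)}\circ(\mathrm{id}_a\vartriangleleft\varepsilon^{\widehat{\mathcal V}}_{u\to\mathcal C(a\to b)v})\circ\alpha_{a,\mathcal C(a\to b),v}\circ(\varepsilon^{\mathcal C}_{a\to b}\vartriangleleft\mathrm{id}_v)$, a morphism $a\vartriangleleft u\vartriangleleft\widehat{\mathcal V}(u\to\mathcal C(a\to b)v)\to b\vartriangleleft v$ in $\mathcal C^{\mathcal V}$. *)

theory Defs
  imports Main
begin

text \<open>Composition is written in diagrammatic order throughout.  The monoidal category is not assumed to
  be strict or braided: associators and unitors are explicit.  Every enriched structure is a record
  of raw data; its laws are collected in a separate predicate.\<close>

section \<open>Closed monoidal categories\<close>

record ('o, 'm) cat =
  Obj :: "'o set"
  Arr :: "'m set"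
  Dom :: "'m \<Rightarrow> 'o"
  Cod :: "'m \<Rightarrow> 'o"
  Id :: "'o \<Rightarrow> 'm"
  Comp :: "'m \<Rightarrow> 'm \<Rightarrow> 'm" (infixl "\<cdot>\<index>" 55)

record ('o, 'm) moncat = "('o, 'm) cat" +
  TensObj :: "'o \<Rightarrow> 'o \<Rightarrow> 'o" (infixr "\<odot>\<index>" 70)
  TensArr :: "'m \<Rightarrow> 'm \<Rightarrow> 'm" (infixr "\<otimes>\<index>" 70)
  Unit :: "'o" ("\<one>\<index>")
  Assoc :: "'o \<Rightarrow> 'o \<Rightarrow> 'o \<Rightarrow> 'm"
  LUnit :: "'o \<Rightarrow> 'm"
  RUnit :: "'o \<Rightarrow> 'm"

text \<open>\<open>Curry V u w v\<close> is the bijection $\mathcal V(uw \to v) \cong \mathcal V(w \to \widehat{\mathcal V}(u \to v))$,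
  and \<open>IHom V u v\<close> is $\widehat{\mathcal V}(u \to v)$.\<close>

record ('o, 'm) closed_moncat = "('o, 'm) moncat" +
  IHom :: "'o \<Rightarrow> 'o \<Rightarrow> 'o"
  Curry :: "'o \<Rightarrow> 'o \<Rightarrow> 'o \<Rightarrow> 'm \<Rightarrow> 'm"

definition hom :: "('o, 'm, 'z) cat_scheme \<Rightarrow> 'o \<Rightarrow> 'o \<Rightarrow> 'm set" where
  "hom V u v = {f \<in> Arr V. Dom V f = u \<and> Cod V f = v}"

locale category =
  fixes V :: "('o, 'm, 'z) cat_scheme" (structure)
  assumes dom_in: "f \<in> Arr V \<Longrightarrow> Dom V f \<in> Obj V"
    and cod_in: "f \<in> Arr V \<Longrightarrow> Cod V f \<in> Obj V"
    and id_in: "u \<in> Obj V \<Longrightarrow> Id V u \<in> hom V u u"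
    and comp_in: "\<lbrakk>f \<in> hom V u v; g \<in> hom V v w\<rbrakk> \<Longrightarrow> f \<cdot> g \<in> hom V u w"
    and id_comp: "f \<in> hom V u v \<Longrightarrow> Id V u \<cdot> f = f"
    and comp_id: "f \<in> hom V u v \<Longrightarrow> f \<cdot> Id V v = f"
    and comp_assoc: "\<lbrakk>f \<in> hom V u v; g \<in> hom V v w; h \<in> hom V w x\<rbrakk>
      \<Longrightarrow> (f \<cdot> g) \<cdot> h = f \<cdot> (g \<cdot> h)"
begin

definition inverse_arrows :: "'m \<Rightarrow> 'm \<Rightarrow> bool" where
  "inverse_arrows f g \<longleftrightarrow> f \<in> Arr V \<and> g \<in> hom V (Cod V f) (Dom V f)
     \<and> f \<cdot> g = Id V (Dom V f) \<and> g \<cdot> f = Id V (Cod V f)"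

definition iso :: "'m \<Rightarrow> bool" where
  "iso f \<longleftrightarrow> (\<exists>g. inverse_arrows f g)"

definition inverse :: "'m \<Rightarrow> 'm" where
  "inverse f = (THE g. inverse_arrows f g)"

end

locale monoidal_category = category V
  for V :: "('o, 'm, 'z) moncat_scheme" (structure) +
  assumes tens_obj_in: "\<lbrakk>u \<in> Obj V; v \<in> Obj V\<rbrakk> \<Longrightarrow> u \<odot> v \<in> Obj V"
    and unit_in: "\<one> \<in> Obj V"
    and tens_arr_in: "\<lbrakk>f \<in> hom V u v; g \<in> hom V w x\<rbrakk> \<Longrightarrow> f \<otimes> g \<in> hom V (u \<odot> w) (v \<odot> x)"
    and tens_id: "\<lbrakk>u \<in> Obj V; v \<in> Obj V\<rbrakk> \<Longrightarrow> Id V u \<otimes> Id V v = Id V (u \<odot> v)"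
    and interchange: "\<lbrakk>f \<in> hom V u v; f' \<in> hom V v w; g \<in> hom V x y; g' \<in> hom V y z\<rbrakk>
      \<Longrightarrow> (f \<cdot> f') \<otimes> (g \<cdot> g') = (f \<otimes> g) \<cdot> (f' \<otimes> g')"
    and assoc_in: "\<lbrakk>u \<in> Obj V; v \<in> Obj V; w \<in> Obj V\<rbrakk>
      \<Longrightarrow> Assoc V u v w \<in> hom V ((u \<odot> v) \<odot> w) (u \<odot> (v \<odot> w))"
    and assoc_iso: "\<lbrakk>u \<in> Obj V; v \<in> Obj V; w \<in> Obj V\<rbrakk> \<Longrightarrow> iso (Assoc V u v w)"
    and assoc_natural: "\<lbrakk>f \<in> hom V u u'; g \<in> hom V v v'; h \<in> hom V w w'\<rbrakk>
      \<Longrightarrow> ((f \<otimes> g) \<otimes> h) \<cdot> Assoc V u' v' w' = Assoc V u v w \<cdot> (f \<otimes> (g \<otimes> h))"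
    and lunit_in: "u \<in> Obj V \<Longrightarrow> LUnit V u \<in> hom V (\<one> \<odot> u) u"
    and lunit_iso: "u \<in> Obj V \<Longrightarrow> iso (LUnit V u)"
    and lunit_natural: "f \<in> hom V u v \<Longrightarrow> (Id V \<one> \<otimes> f) \<cdot> LUnit V v = LUnit V u \<cdot> f"
    and runit_in: "u \<in> Obj V \<Longrightarrow> RUnit V u \<in> hom V (u \<odot> \<one>) u"
    and runit_iso: "u \<in> Obj V \<Longrightarrow> iso (RUnit V u)"
    and runit_natural: "f \<in> hom V u v \<Longrightarrow> (f \<otimes> Id V \<one>) \<cdot> RUnit V v = RUnit V u \<cdot> f"
    and triangle: "\<lbrakk>u \<in> Obj V; v \<in> Obj V\<rbrakk>
      \<Longrightarrow> Assoc V u \<one> v \<cdot> (Id V u \<otimes> LUnit V v) = RUnit V u \<otimes> Id V v"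
    and pentagon: "\<lbrakk>u \<in> Obj V; v \<in> Obj V; w \<in> Obj V; x \<in> Obj V\<rbrakk>
      \<Longrightarrow> (Assoc V u v w \<otimes> Id V x) \<cdot> Assoc V u (v \<odot> w) x \<cdot> (Id V u \<otimes> Assoc V v w x)
          = Assoc V (u \<odot> v) w x \<cdot> Assoc V u v (w \<odot> x)"

locale closed_monoidal_category = monoidal_category V
  for V :: "('o, 'm, 'z) closed_moncat_scheme" (structure) +
  assumes ihom_in: "\<lbrakk>u \<in> Obj V; v \<in> Obj V\<rbrakk> \<Longrightarrow> IHom V u v \<in> Obj V"
    and curry_bij: "\<lbrakk>u \<in> Obj V; w \<in> Obj V; v \<in> Obj V\<rbrakk>
      \<Longrightarrow> bij_betw (Curry V u w v) (hom V (u \<odot> w) v) (hom V w (IHom V u v))"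
    and curry_natural: "\<lbrakk>u \<in> Obj V; v \<in> Obj V; h \<in> hom V w' w; f \<in> hom V (u \<odot> w) v\<rbrakk>
      \<Longrightarrow> Curry V u w' v ((Id V u \<otimes> h) \<cdot> f) = h \<cdot> Curry V u w v f"


section \<open>Enriched categories\<close>

record ('c, 'o, 'm) vcat =
  vObj :: "'c set"
  vHom :: "'c \<Rightarrow> 'c \<Rightarrow> 'o"
  vId :: "'c \<Rightarrow> 'm"
  vComp :: "'c \<Rightarrow> 'c \<Rightarrow> 'c \<Rightarrow> 'm"

record ('c, 'd, 'm) vfun =
  fObj :: "'c \<Rightarrow> 'd"
  fHom :: "'c \<Rightarrow> 'c \<Rightarrow> 'm"

context monoidal_category
begin

definition v_category :: "('c, 'o, 'm) vcat \<Rightarrow> bool" where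
  "v_category C \<longleftrightarrow>
     (\<forall>a\<in>vObj C. \<forall>b\<in>vObj C. vHom C a b \<in> Obj V)
   \<and> (\<forall>a\<in>vObj C. vId C a \<in> hom V \<one> (vHom C a a))
   \<and> (\<forall>a\<in>vObj C. \<forall>b\<in>vObj C. \<forall>c\<in>vObj C.
        vComp C a b c \<in> hom V (vHom C a b \<odot> vHom C b c) (vHom C a c))
   \<and> (\<forall>a\<in>vObj C. \<forall>b\<in>vObj C.
        (vId C a \<otimes> Id V (vHom C a b)) \<cdot> vComp C a a b = LUnit V (vHom C a b)
      \<and> (Id V (vHom C a b) \<otimes> vId C b) \<cdot> vComp C a b b = RUnit V (vHom C a b))
   \<and> (\<forall>a\<in>vObj C. \<forall>b\<in>vObj C. \<forall>c\<in>vObj C. \<forall>d\<in>vObj C.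
        (vComp C a b c \<otimes> Id V (vHom C c d)) \<cdot> vComp C a c d
      = Assoc V (vHom C a b) (vHom C b c) (vHom C c d)
          \<cdot> (Id V (vHom C a b) \<otimes> vComp C b c d) \<cdot> vComp C a b d)"

definition v_functor :: "('c, 'o, 'm) vcat \<Rightarrow> ('d, 'o, 'm) vcat \<Rightarrow> ('c, 'd, 'm) vfun \<Rightarrow> bool" where
  "v_functor C D F \<longleftrightarrow>
     (\<forall>a\<in>vObj C. fObj F a \<in> vObj D)
   \<and> (\<forall>a\<in>vObj C. \<forall>b\<in>vObj C. fHom F a b \<in> hom V (vHom C a b) (vHom D (fObj F a) (fObj F b)))
   \<and> (\<forall>a\<in>vObj C. vId C a \<cdot> fHom F a a = vId D (fObj F a))
   \<and> (\<forall>a\<in>vObj C. \<forall>b\<in>vObj C. \<forall>c\<in>vObj C.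
        vComp C a b c \<cdot> fHom F a c
      = (fHom F a b \<otimes> fHom F b c) \<cdot> vComp D (fObj F a) (fObj F b) (fObj F c))"

definition v_id_functor :: "('c, 'o, 'm) vcat \<Rightarrow> ('c, 'c, 'm) vfun" where
  "v_id_functor C = \<lparr>fObj = (\<lambda>a. a), fHom = (\<lambda>a b. Id V (vHom C a b))\<rparr>"

definition v_comp_functor :: "('c, 'd, 'm) vfun \<Rightarrow> ('d, 'e, 'm) vfun \<Rightarrow> ('c, 'e, 'm) vfun" where
  "v_comp_functor F G =
     \<lparr>fObj = (\<lambda>a. fObj G (fObj F a)),
      fHom = (\<lambda>a b. fHom F a b \<cdot> fHom G (fObj F a) (fObj F b))\<rparr>"

text \<open>The underlying category of \<open>C\<close>; its identities are \<open>vId C\<close>.\<close>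

definition uhom :: "('c, 'o, 'm) vcat \<Rightarrow> 'c \<Rightarrow> 'c \<Rightarrow> 'm set" where
  "uhom C a b = hom V \<one> (vHom C a b)"

definition ucomp :: "('c, 'o, 'm) vcat \<Rightarrow> 'c \<Rightarrow> 'c \<Rightarrow> 'c \<Rightarrow> 'm \<Rightarrow> 'm \<Rightarrow> 'm" where
  "ucomp C a b c f g = inverse (LUnit V \<one>) \<cdot> (f \<otimes> g) \<cdot> vComp C a b c"

definition u_inverse_arrows :: "('c, 'o, 'm) vcat \<Rightarrow> 'c \<Rightarrow> 'c \<Rightarrow> 'm \<Rightarrow> 'm \<Rightarrow> bool" where
  "u_inverse_arrows C a b f g \<longleftrightarrow> f \<in> uhom C a b \<and> g \<in> uhom C b a
     \<and> ucomp C a b a f g = vId C a \<and> ucomp C b a b g f = vId C b"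

definition u_iso :: "('c, 'o, 'm) vcat \<Rightarrow> 'c \<Rightarrow> 'c \<Rightarrow> 'm \<Rightarrow> bool" where
  "u_iso C a b f \<longleftrightarrow> (\<exists>g. u_inverse_arrows C a b f g)"

definition u_inverse :: "('c, 'o, 'm) vcat \<Rightarrow> 'c \<Rightarrow> 'c \<Rightarrow> 'm \<Rightarrow> 'm" where
  "u_inverse C a b f = (THE g. u_inverse_arrows C a b f g)"

text \<open>$1_{\mathcal V}$-graded $\mathcal V$-natural transformations.\<close>

definition v_nat_trans :: "('c, 'o, 'm) vcat \<Rightarrow> ('d, 'o, 'm) vcat \<Rightarrow>
    ('c, 'd, 'm) vfun \<Rightarrow> ('c, 'd, 'm) vfun \<Rightarrow> ('c \<Rightarrow> 'm) \<Rightarrow> bool" where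
  "v_nat_trans C D F G \<sigma> \<longleftrightarrow>
     (\<forall>a\<in>vObj C. \<sigma> a \<in> hom V \<one> (vHom D (fObj F a) (fObj G a)))
   \<and> (\<forall>a\<in>vObj C. \<forall>b\<in>vObj C.
        inverse (LUnit V (vHom C a b)) \<cdot> (\<sigma> a \<otimes> fHom G a b)
          \<cdot> vComp D (fObj F a) (fObj G a) (fObj G b)
      = inverse (RUnit V (vHom C a b)) \<cdot> (fHom F a b \<otimes> \<sigma> b)
          \<cdot> vComp D (fObj F a) (fObj F b) (fObj G b))"

definition v_nat_iso :: "('c, 'o, 'm) vcat \<Rightarrow> ('d, 'o, 'm) vcat \<Rightarrow>
    ('c, 'd, 'm) vfun \<Rightarrow> ('c, 'd, 'm) vfun \<Rightarrow> ('c \<Rightarrow> 'm) \<Rightarrow> bool" where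
  "v_nat_iso C D F G \<sigma> \<longleftrightarrow> v_nat_trans C D F G \<sigma>
     \<and> (\<forall>a\<in>vObj C. u_iso D (fObj F a) (fObj G a) (\<sigma> a))"

definition v_equivalence :: "('c, 'o, 'm) vcat \<Rightarrow> ('d, 'o, 'm) vcat \<Rightarrow>
    ('c, 'd, 'm) vfun \<Rightarrow> ('d, 'c, 'm) vfun \<Rightarrow> bool" where
  "v_equivalence C D F G \<longleftrightarrow> v_functor C D F \<and> v_functor D C G
     \<and> (\<exists>\<sigma>. v_nat_iso C C (v_id_functor C) (v_comp_functor F G) \<sigma>)
     \<and> (\<exists>\<sigma>. v_nat_iso D D (v_comp_functor G F) (v_id_functor D) \<sigma>)"

text \<open>\<open>L\<close> is left \<open>V\<close>-adjoint to \<open>R\<close> via $\Psi_{a,b} : B(L a \to b) \cong A(a \to R b)$.  As \<open>V\<close> need not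
  be braided, there is no opposite \<open>V\<close>-category; \<open>V\<close>-naturality of \<open>\<Psi>\<close> in the contravariant variable
  is compatibility with precomposition by the hom objects of \<open>A\<close>.\<close>

definition v_adjunction :: "('c, 'o, 'm) vcat \<Rightarrow> ('d, 'o, 'm) vcat \<Rightarrow>
    ('c, 'd, 'm) vfun \<Rightarrow> ('d, 'c, 'm) vfun \<Rightarrow> ('c \<Rightarrow> 'd \<Rightarrow> 'm) \<Rightarrow> bool" where
  "v_adjunction A B L R \<Psi> \<longleftrightarrow> v_functor A B L \<and> v_functor B A R
   \<and> (\<forall>a\<in>vObj A. \<forall>b\<in>vObj B.
        \<Psi> a b \<in> hom V (vHom B (fObj L a) b) (vHom A a (fObj R b)) \<and> iso (\<Psi> a b))
   \<and> (\<forall>a\<in>vObj A. \<forall>b\<in>vObj B. \<forall>b'\<in>vObj B.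
        vComp B (fObj L a) b b' \<cdot> \<Psi> a b'
      = (\<Psi> a b \<otimes> fHom R b b') \<cdot> vComp A a (fObj R b) (fObj R b'))
   \<and> (\<forall>a\<in>vObj A. \<forall>a'\<in>vObj A. \<forall>b\<in>vObj B.
        (fHom L a a' \<otimes> Id V (vHom B (fObj L a') b))
          \<cdot> vComp B (fObj L a) (fObj L a') b \<cdot> \<Psi> a b
      = (Id V (vHom A a a') \<otimes> \<Psi> a' b) \<cdot> vComp A a a' (fObj R b))"

end


section \<open>Tensored categories\<close>

text \<open>\<open>tFun T a\<close> is the \<open>V\<close>-functor $v \mapsto a \vartriangleleft v$, and \<open>tAdj T a v b\<close> is the isomorphism
  $\mathcal C(a \vartriangleleft v \to b) \cong \widehat{\mathcal V}(v \to \mathcal C(a \to b))$.\<close>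

record ('c, 'o, 'm) tensoring =
  tFun :: "'c \<Rightarrow> ('o, 'c, 'm) vfun"
  tAdj :: "'c \<Rightarrow> 'o \<Rightarrow> 'c \<Rightarrow> 'm"

abbreviation tens :: "('c, 'o, 'm) tensoring \<Rightarrow> 'c \<Rightarrow> 'o \<Rightarrow> 'c" where
  "tens T a v \<equiv> fObj (tFun T a) v"

context closed_monoidal_category
begin

definition uncurry :: "'o \<Rightarrow> 'o \<Rightarrow> 'o \<Rightarrow> 'm \<Rightarrow> 'm" where
  "uncurry u w v = the_inv_into (hom V (u \<odot> w) v) (Curry V u w v)"

definition ev :: "'o \<Rightarrow> 'o \<Rightarrow> 'm" where
  "ev u v = uncurry u (IHom V u v) v (Id V (IHom V u v))"

text \<open>The self-enrichment $\widehat{\mathcal V}$.\<close>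

definition self :: "('o, 'o, 'm) vcat" where
  "self =
     \<lparr>vObj = Obj V,
      vHom = IHom V,
      vId = (\<lambda>u. Curry V u \<one> u (RUnit V u)),
      vComp = (\<lambda>u v w. Curry V u (IHom V u v \<odot> IHom V v w) w
        (inverse (Assoc V u (IHom V u v) (IHom V v w))
          \<cdot> (ev u v \<otimes> Id V (IHom V v w)) \<cdot> ev v w))\<rparr>"

text \<open>The identification of \<open>V\<close> with the underlying category of \<open>self\<close>.\<close>

definition self_arr :: "'o \<Rightarrow> 'o \<Rightarrow> 'm \<Rightarrow> 'm" where
  "self_arr u v g = Curry V u \<one> v (RUnit V u \<cdot> g)"

definition representable :: "('c, 'o, 'm) vcat \<Rightarrow> 'c \<Rightarrow> ('c, 'o, 'm) vfun" where
  "representable C a =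
     \<lparr>fObj = (\<lambda>b. vHom C a b),
      fHom = (\<lambda>b c. Curry V (vHom C a b) (vHom C b c) (vHom C a c) (vComp C a b c))\<rparr>"

definition tensored :: "('c, 'o, 'm) vcat \<Rightarrow> ('c, 'o, 'm) tensoring \<Rightarrow> bool" where
  "tensored C T \<longleftrightarrow> v_category C
     \<and> (\<forall>a\<in>vObj C. v_adjunction self C (tFun T a) (representable C a) (tAdj T a))"

text \<open>The two directions of the bijection
  $\mathcal C^{\mathcal V}(a \vartriangleleft v \to b) \cong \mathcal V(v \to \mathcal C(a \to b))$.\<close>

definition tens_down :: "('c, 'o, 'm) vcat \<Rightarrow> ('c, 'o, 'm) tensoring \<Rightarrow> 'c \<Rightarrow> 'o \<Rightarrow> 'c \<Rightarrow> 'm \<Rightarrow> 'm" where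
  "tens_down C T a v b f =
     inverse (RUnit V v) \<cdot> uncurry v \<one> (vHom C a b) (f \<cdot> tAdj T a v b)"

definition tens_up :: "('c, 'o, 'm) vcat \<Rightarrow> ('c, 'o, 'm) tensoring \<Rightarrow> 'c \<Rightarrow> 'o \<Rightarrow> 'c \<Rightarrow> 'm \<Rightarrow> 'm" where
  "tens_up C T a v b g = self_arr v (vHom C a b) g \<cdot> inverse (tAdj T a v b)"

definition tens_unit :: "('c, 'o, 'm) vcat \<Rightarrow> ('c, 'o, 'm) tensoring \<Rightarrow> 'c \<Rightarrow> 'o \<Rightarrow> 'm" where
  "tens_unit C T a v = tens_down C T a v (tens T a v) (vId C (tens T a v))"

definition tens_counit :: "('c, 'o, 'm) vcat \<Rightarrow> ('c, 'o, 'm) tensoring \<Rightarrow> 'c \<Rightarrow> 'c \<Rightarrow> 'm" where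
  "tens_counit C T a b = tens_up C T a (vHom C a b) b (Id V (vHom C a b))"

text \<open>$f \vartriangleleft \mathrm{id}_v$ for \<open>f \<in> uhom C a b\<close>, and $\mathrm{id}_a \vartriangleleft g$ for \<open>g \<in> hom V u v\<close>;
  the latter is the action on \<open>g\<close> of the functor underlying \<open>tFun T a\<close>.\<close>

definition tens_arr_id :: "('c, 'o, 'm) vcat \<Rightarrow> ('c, 'o, 'm) tensoring \<Rightarrow>
    'c \<Rightarrow> 'c \<Rightarrow> 'm \<Rightarrow> 'o \<Rightarrow> 'm" where
  "tens_arr_id C T a b f v =
     tens_up C T a v (tens T b v)
       (inverse (LUnit V v) \<cdot> (f \<otimes> tens_unit C T b v) \<cdot> vComp C a b (tens T b v))"

definition tens_id_arr :: "('c, 'o, 'm) tensoring \<Rightarrow> 'c \<Rightarrow> 'o \<Rightarrow> 'o \<Rightarrow> 'm \<Rightarrow> 'm" where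
  "tens_id_arr T a u v g = self_arr u v g \<cdot> fHom (tFun T a) u v"

text \<open>$\alpha_{a,u,v} : a \vartriangleleft uv \to (a \vartriangleleft u) \vartriangleleft v$.\<close>

definition tens_assoc :: "('c, 'o, 'm) vcat \<Rightarrow> ('c, 'o, 'm) tensoring \<Rightarrow> 'c \<Rightarrow> 'o \<Rightarrow> 'o \<Rightarrow> 'm" where
  "tens_assoc C T a u v =
     tens_up C T a (u \<odot> v) (tens T (tens T a u) v)
       ((tens_unit C T a u \<otimes> tens_unit C T (tens T a u) v)
         \<cdot> vComp C a (tens T a u) (tens T (tens T a u) v))"

text \<open>$\mu^F_{c,v} : F(c) \vartriangleleft v \to F(c \vartriangleleft v)$.\<close>

definition tens_mu :: "('c, 'o, 'm) vcat \<Rightarrow> ('c, 'o, 'm) tensoring \<Rightarrow>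
    ('d, 'o, 'm) vcat \<Rightarrow> ('d, 'o, 'm) tensoring \<Rightarrow> ('c, 'd, 'm) vfun \<Rightarrow> 'c \<Rightarrow> 'o \<Rightarrow> 'm" where
  "tens_mu C T D S F c v =
     tens_up D S (fObj F c) v (fObj F (tens T c v))
       (tens_unit C T c v \<cdot> fHom F c (tens T c v))"

definition tensored_functor :: "('c, 'o, 'm) vcat \<Rightarrow> ('c, 'o, 'm) tensoring \<Rightarrow>
    ('d, 'o, 'm) vcat \<Rightarrow> ('d, 'o, 'm) tensoring \<Rightarrow> ('c, 'd, 'm) vfun \<Rightarrow> bool" where
  "tensored_functor C T D S F \<longleftrightarrow> v_functor C D F
     \<and> (\<forall>c\<in>vObj C. \<forall>v\<in>Obj V.
          u_iso D (tens S (fObj F c) v) (fObj F (tens T c v)) (tens_mu C T D S F c v))"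

text \<open>The isomorphism $\widehat{\mathcal V}(uv \to w) \cong \widehat{\mathcal V}(v \to \widehat{\mathcal V}(u \to w))$.\<close>

definition ihom_curry :: "'o \<Rightarrow> 'o \<Rightarrow> 'o \<Rightarrow> 'm" where
  "ihom_curry u v w =
     Curry V v (IHom V (u \<odot> v) w) (IHom V u w)
       (Curry V u (v \<odot> IHom V (u \<odot> v) w) w
         (inverse (Assoc V u v (IHom V (u \<odot> v) w)) \<cdot> ev (u \<odot> v) w))"

definition self_tensoring :: "('o, 'o, 'm) tensoring" where
  "self_tensoring =
     \<lparr>tFun = (\<lambda>u.
        \<lparr>fObj = (\<lambda>v. u \<odot> v),
         fHom = (\<lambda>v w. Curry V (u \<odot> v) (IHom V v w) (u \<odot> w)
           (Assoc V u v (IHom V v w) \<cdot> (Id V u \<otimes> ev v w)))\<rparr>),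
      tAdj = (\<lambda>u v w. ihom_curry u v w)\<rparr>"


section \<open>The completion\<close>

text \<open>The formal symbol $a \blacktriangleleft u$ is the pair \<open>(a, u)\<close>.\<close>

definition completion :: "('c, 'o, 'm) vcat \<Rightarrow> ('c \<times> 'o, 'o, 'm) vcat" where
  "completion C =
     \<lparr>vObj = vObj C \<times> Obj V,
      vHom = (\<lambda>(a, u) (b, v). IHom V u (vHom C a b \<odot> v)),
      vId = (\<lambda>(a, u). Curry V u \<one> (vHom C a a \<odot> u)
        (RUnit V u \<cdot> inverse (LUnit V u) \<cdot> (vId C a \<otimes> Id V u))),
      vComp = (\<lambda>(a, u) (b, v) (c, w).
        let H = IHom V u (vHom C a b \<odot> v); K = IHom V v (vHom C b c \<odot> w) in
        Curry V u (H \<odot> K) (vHom C a c \<odot> w)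
          (inverse (Assoc V u H K)
            \<cdot> (ev u (vHom C a b \<odot> v) \<otimes> Id V K)
            \<cdot> Assoc V (vHom C a b) v K
            \<cdot> (Id V (vHom C a b) \<otimes> ev v (vHom C b c \<odot> w))
            \<cdot> inverse (Assoc V (vHom C a b) (vHom C b c) w)
            \<cdot> (vComp C a b c \<otimes> Id V w)))\<rparr>"

text \<open>The tensoring $(a \blacktriangleleft u) \vartriangleleft v = a \blacktriangleleft uv$.  Its action on hom objects is the mate of
  $uv\,\widehat{\mathcal V}(v \to w) \to uw \to \mathcal C(a \to a)\,uw$, and its adjunction isomorphism is
  $\widehat{\mathcal V}(uv \to \mathcal C(a \to b)w) \cong \widehat{\mathcal V}(v \to \widehat{\mathcal V}(u \to \mathcal C(a \to b)w))$.\<close>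

definition completion_tensoring :: "('c, 'o, 'm) vcat \<Rightarrow> ('c \<times> 'o, 'o, 'm) tensoring" where
  "completion_tensoring C =
     \<lparr>tFun = (\<lambda>(a, u).
        \<lparr>fObj = (\<lambda>v. (a, u \<odot> v)),
         fHom = (\<lambda>v w. Curry V (u \<odot> v) (IHom V v w) (vHom C a a \<odot> (u \<odot> w))
           (Assoc V u v (IHom V v w) \<cdot> (Id V u \<otimes> ev v w)
             \<cdot> inverse (LUnit V (u \<odot> w)) \<cdot> (vId C a \<otimes> Id V (u \<odot> w))))\<rparr>),
      tAdj = (\<lambda>(a, u) v (b, w). ihom_curry u v (vHom C a b \<odot> w))\<rparr>"

text \<open>The morphism $a \blacktriangleleft u \to a \blacktriangleleft v$ induced by \<open>g \<in> hom V u v\<close>.\<close>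

definition completion_arr :: "('c, 'o, 'm) vcat \<Rightarrow> 'c \<Rightarrow> 'o \<Rightarrow> 'o \<Rightarrow> 'm \<Rightarrow> 'm" where
  "completion_arr C a u v g =
     Curry V u \<one> (vHom C a a \<odot> v)
       (RUnit V u \<cdot> g \<cdot> inverse (LUnit V v) \<cdot> (vId C a \<otimes> Id V v))"

definition incl :: "('c, 'o, 'm) vcat \<Rightarrow> ('c, 'c \<times> 'o, 'm) vfun" where
  "incl C =
     \<lparr>fObj = (\<lambda>a. (a, \<one>)),
      fHom = (\<lambda>a b. Curry V \<one> (vHom C a b) (vHom C a b \<odot> \<one>)
        (LUnit V (vHom C a b) \<cdot> inverse (RUnit V (vHom C a b))))\<rparr>"

text \<open>The \<open>V\<close>-functor $\overline{\mathrm{id}^{\mathcal C}} : a \blacktriangleleft u \mapsto a \vartriangleleft u$.\<close>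

definition realize :: "('c, 'o, 'm) vcat \<Rightarrow> ('c, 'o, 'm) tensoring \<Rightarrow> ('c \<times> 'o, 'c, 'm) vfun" where
  "realize C T =
     \<lparr>fObj = (\<lambda>(a, u). tens T a u),
      fHom = (\<lambda>(a, u) (b, v).
        let K = vHom C a b; H = IHom V u (K \<odot> v);
            x0 = tens T (tens T a u) H;
            x1 = tens T a (u \<odot> H);
            x2 = tens T a (K \<odot> v);
            x3 = tens T (tens T a K) v;
            x4 = tens T b v;
            f1 = u_inverse C x1 x0 (tens_assoc C T a u H);
            f2 = tens_id_arr T a (u \<odot> H) (K \<odot> v) (ev u (K \<odot> v));
            f3 = tens_assoc C T a K v;
            f4 = tens_arr_id C T (tens T a K) b (tens_counit C T a b) v
        in tens_down C T (tens T a u) H x4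
             (ucomp C x0 x3 x4 (ucomp C x0 x2 x3 (ucomp C x0 x1 x2 f1 f2) f3) f4))\<rparr>"

text \<open>$\tau_{a \blacktriangleleft u} = \mu^{\mathcal I}_{a,u}$.  The source of $\mu^{\mathcal I}_{a,u}$ is
  $(a \blacktriangleleft 1) \vartriangleleft u = a \blacktriangleleft 1u$, so \<open>\<tau>\<close> precomposes it with the unitor $a \blacktriangleleft u \cong a \blacktriangleleft 1u$.\<close>

definition tau :: "('c, 'o, 'm) vcat \<Rightarrow> ('c, 'o, 'm) tensoring \<Rightarrow> 'c \<times> 'o \<Rightarrow> 'm" where
  "tau C T = (\<lambda>(a, u).
     ucomp (completion C) (a, u) (a, \<one> \<odot> u) (tens T a u, \<one>)
       (completion_arr C a u (\<one> \<odot> u) (inverse (LUnit V u)))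
       (tens_mu C T (completion C) (completion_tensoring C) (incl C) a u))"

end

end

theory Submission
  imports Defs
begin

text \<open>Morphisms \<open>u \<rightarrow> C(a, b)\<close> of arbitrary grade \<open>u\<close> compose by multiplying grades, and \<open>a \<triangleleft> v\<close> is characterized
  by a universal morphism \<open>\<eta> : v \<rightarrow> C(a, a \<triangleleft> v)\<close>: composing with \<open>\<eta>\<close> is a bijection from the morphisms
  \<open>a \<triangleleft> v \<rightarrow> b\<close> of grade \<open>w\<close> to the morphisms \<open>a \<rightarrow> b\<close> of grade \<open>v \<odot> w\<close>.  Let \<open>s : C(c, a) \<odot> u \<rightarrow> C(c, a \<triangleleft> u)\<close> be
  composition with \<open>\<eta>\<close>.  Condition (1) says that every \<open>s\<close> is invertible.  The morphism \<open>\<tau>\<close> at \<open>(a, u)\<close> is the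
  arrow \<open>\<eta>\<close> followed by a unitor, so postcomposition with \<open>\<tau>\<close> on morphisms out of \<open>(c, w)\<close> is postcomposition
  of arrows \<open>w \<rightarrow> C(c, a) \<odot> u\<close> with \<open>s\<close>; by Yoneda \<open>\<tau>\<close> is invertible iff every \<open>s\<close> is.  As \<open>\<tau>\<close> is always
  \<open>V\<close>-natural and equals \<open>\<mu>\<close> up to a unitor, this gives the equivalence of (1), (2) and (3).  The units
  \<open>\<eta> : a \<rightarrow> a \<triangleleft> \<one>\<close> always form a \<open>V\<close>-natural isomorphism, so (3) gives (4).  Conversely, precomposition with \<open>\<tau>\<close>
  is bijective on morphisms into objects \<open>(b, \<one>)\<close>, and under (4) every object is isomorphic to one of these.\<close>


section \<open>Categories and monoidal coherence\<close>

text \<open>The completion, \<open>incl\<close> and \<open>realize\<close> are given by raw formulas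
  over a category that is neither strict nor braided, so their laws have to be derived, and
  coherence is the main obstacle. The remedy is to leave internal homs at once: arrows into
  \<open>IHom V u v\<close> are compared through \<open>uncurry\<close>, arrows out of
  \<open>a \<triangleleft> v\<close> through composition with \<open>\<eta>\<close>, and what
  remains are equations between arrows of V built from \<open>vComp\<close>. On mates the completion
  is a Kleisli construction for the operations \<open>C(a, b) \<odot> -\<close>, and
  \<open>realize\<close> is evaluation followed by \<open>s\<close>. The Yoneda step works because
  the second component of an object of the completion is arbitrary:
  \<open>(c, C(c, a) \<odot> u)\<close> carries a generic arrow to \<open>(a, u)\<close>, namely the
  mate of an identity. In (4) the isomorphism between the composite and the identity is not assumed
  to be \<open>\<tau>\<close>, so invertibility of \<open>\<tau>\<close> itself has to be recovered
  from the universal property of \<open>a \<triangleleft> u\<close>.\<close>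

context category
begin

lemma homD:
  assumes "f \<in> hom V u v"
  shows "f \<in> Arr V" "Dom V f = u" "Cod V f = v" "u \<in> Obj V" "v \<in> Obj V"
  using assms dom_in cod_in by (auto simp: hom_def)

lemma arr_hom: "f \<in> Arr V \<Longrightarrow> f \<in> hom V (Dom V f) (Cod V f)"
  by (simp add: hom_def)

declare dom_in [simp] cod_in [simp]

lemma comp_simps [simp]:
  assumes "f \<in> Arr V" "g \<in> Arr V" "Cod V f = Dom V g"
  shows "f \<cdot> g \<in> Arr V" "Dom V (f \<cdot> g) = Dom V f" "Cod V (f \<cdot> g) = Cod V g"
  using comp_in[of f "Dom V f" "Dom V g" g "Cod V g"] assms by (auto simp: hom_def)

lemma id_simps [simp]:
  assumes "u \<in> Obj V"
  shows "Id V u \<in> Arr V" "Dom V (Id V u) = u" "Cod V (Id V u) = u"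
  using id_in[OF assms] by (auto simp: hom_def)

lemma id_comp' [simp]: "\<lbrakk>f \<in> Arr V; Dom V f = u\<rbrakk> \<Longrightarrow> Id V u \<cdot> f = f"
  using id_comp[of f u "Cod V f"] by (auto simp: hom_def)

lemma comp_id' [simp]: "\<lbrakk>f \<in> Arr V; Cod V f = u\<rbrakk> \<Longrightarrow> f \<cdot> Id V u = f"
  using comp_id[of f "Dom V f" u] by (auto simp: hom_def)

lemma comp_assoc' [simp]:
  "\<lbrakk>f \<in> Arr V; g \<in> Arr V; h \<in> Arr V; Cod V f = Dom V g; Cod V g = Dom V h\<rbrakk>
    \<Longrightarrow> (f \<cdot> g) \<cdot> h = f \<cdot> (g \<cdot> h)"
  using comp_assoc[of f "Dom V f" "Cod V f" g "Cod V g" h "Cod V h"] by (auto simp: hom_def)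

text \<open>The simplifier brackets composites to the right, so an equation with left side
  \<open>f \<cdot> g\<close> no longer matches inside a longer composite. Applied with
  \<open>THEN\<close>, this rule gives it a tail \<open>k\<close>.\<close>

lemma comp_reassoc:
  "\<lbrakk>f \<cdot> g = h; f \<in> Arr V; g \<in> Arr V; k \<in> Arr V; Cod V f = Dom V g; Cod V g = Dom V k\<rbrakk>
    \<Longrightarrow> f \<cdot> (g \<cdot> k) = h \<cdot> k"
  by (metis comp_assoc')

lemma inverse_arrowsI:
  "\<lbrakk>f \<in> Arr V; g \<in> Arr V; Dom V g = Cod V f; Cod V g = Dom V f; f \<cdot> g = Id V (Dom V f);
    g \<cdot> f = Id V (Cod V f)\<rbrakk> \<Longrightarrow> inverse_arrows f g"
  by (simp add: inverse_arrows_def hom_def)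

lemma inverse_arrows_unique:
  assumes "inverse_arrows f g" "inverse_arrows f g'"
  shows "g = g'"
proof -
  have "g = g \<cdot> (f \<cdot> g')"
    using assms by (auto simp: inverse_arrows_def hom_def)
  also have "\<dots> = (g \<cdot> f) \<cdot> g'"
    using assms by (subst comp_assoc') (auto simp: inverse_arrows_def hom_def)
  also have "\<dots> = g'"
    using assms by (auto simp: inverse_arrows_def hom_def)
  finally show ?thesis .
qed

lemma inverse_eqI: "inverse_arrows f g \<Longrightarrow> inverse f = g"
  unfolding inverse_def using inverse_arrows_unique by blast

lemma isoI: "inverse_arrows f g \<Longrightarrow> iso f"
  by (auto simp: iso_def)

lemma inverse_arrows_inverse: "iso f \<Longrightarrow> inverse_arrows f (inverse f)"
  using inverse_eqI by (auto simp: iso_def)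

lemma iso_simps [simp]:
  assumes "iso f"
  shows "f \<in> Arr V" "inverse f \<in> Arr V" "Dom V (inverse f) = Cod V f" "Cod V (inverse f) = Dom V f"
    "f \<cdot> inverse f = Id V (Dom V f)" "inverse f \<cdot> f = Id V (Cod V f)"
  using inverse_arrows_inverse[OF assms] by (auto simp: inverse_arrows_def hom_def)

lemma iso_cancel [simp]:
  assumes "iso f" "k \<in> Arr V"
  shows "Dom V k = Dom V f \<Longrightarrow> f \<cdot> (inverse f \<cdot> k) = k"
    "Dom V k = Cod V f \<Longrightarrow> inverse f \<cdot> (f \<cdot> k) = k"
  using assms comp_assoc'[of f "inverse f" k] comp_assoc'[of "inverse f" f k] by auto

lemma iso_inverse: "iso f \<Longrightarrow> iso (inverse f)"
  by (rule isoI[of _ f], rule inverse_arrowsI) auto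

lemma iso_comp: "\<lbrakk>iso f; iso g; Cod V f = Dom V g\<rbrakk> \<Longrightarrow> iso (f \<cdot> g)"
  by (rule isoI[of _ "inverse g \<cdot> inverse f"], rule inverse_arrowsI) auto

lemma iso_id: "u \<in> Obj V \<Longrightarrow> iso (Id V u)"
  by (rule isoI[of _ "Id V u"], rule inverse_arrowsI) auto

lemma iso_epi:
  assumes "iso f" "g \<in> Arr V" "h \<in> Arr V" "Dom V g = Cod V f" "Dom V h = Cod V f" "f \<cdot> g = f \<cdot> h"
  shows "g = h"
  using assms by (metis iso_cancel(2))

lemma iso_mono:
  assumes "iso f" "g \<in> Arr V" "h \<in> Arr V" "Cod V g = Dom V f" "Cod V h = Dom V f" "g \<cdot> f = h \<cdot> f"
  shows "g = h"
proof -
  have "(g \<cdot> f) \<cdot> inverse f = (h \<cdot> f) \<cdot> inverse f"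
    using assms by simp
  then show ?thesis
    using assms(1-5) by simp
qed

end

section \<open>Monoidal categories: inverse constraints and Kelly's unit coherences\<close>

context monoidal_category
begin

abbreviation "Assoc' u v w \<equiv> inverse (Assoc V u v w)"
abbreviation "LUnit' u \<equiv> inverse (LUnit V u)"
abbreviation "RUnit' u \<equiv> inverse (RUnit V u)"

declare tens_obj_in [simp] unit_in [simp] assoc_iso [simp] lunit_iso [simp] runit_iso [simp]
declare tens_id [simp]

lemma tens_simps [simp]:
  assumes "f \<in> Arr V" "g \<in> Arr V"
  shows "f \<otimes> g \<in> Arr V" "Dom V (f \<otimes> g) = Dom V f \<odot> Dom V g" "Cod V (f \<otimes> g) = Cod V f \<odot> Cod V g"
  using tens_arr_in[OF arr_hom[OF assms(1)] arr_hom[OF assms(2)]] by (auto simp: hom_def)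

lemma tens_comp [simp]:
  "\<lbrakk>f \<in> Arr V; f' \<in> Arr V; g \<in> Arr V; g' \<in> Arr V; Cod V f = Dom V f'; Cod V g = Dom V g'\<rbrakk>
    \<Longrightarrow> (f \<otimes> g) \<cdot> (f' \<otimes> g') = (f \<cdot> f') \<otimes> (g \<cdot> g')"
  using interchange[of f "Dom V f" "Cod V f" f' "Cod V f'" g "Dom V g" "Cod V g" g' "Cod V g'"]
  by (auto simp: hom_def)

lemmas tens_comp_reassoc [simp] = tens_comp [THEN comp_reassoc]

lemma unitor_simps [simp]:
  assumes "u \<in> Obj V"
  shows "Dom V (LUnit V u) = \<one> \<odot> u" "Cod V (LUnit V u) = u"
    "Dom V (RUnit V u) = u \<odot> \<one>" "Cod V (RUnit V u) = u"
  using lunit_in[OF assms] runit_in[OF assms] by (auto simp: hom_def)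

lemma assoc_simps [simp]:
  assumes "u \<in> Obj V" "v \<in> Obj V" "w \<in> Obj V"
  shows "Dom V (Assoc V u v w) = (u \<odot> v) \<odot> w" "Cod V (Assoc V u v w) = u \<odot> (v \<odot> w)"
  using assoc_in[OF assms] by (auto simp: hom_def)

lemma lunit_nat: "\<lbrakk>f \<in> Arr V; Cod V f = v\<rbrakk> \<Longrightarrow> (Id V \<one> \<otimes> f) \<cdot> LUnit V v = LUnit V (Dom V f) \<cdot> f"
  using lunit_natural[of f "Dom V f" v] by (auto simp: hom_def)

lemma runit_nat: "\<lbrakk>f \<in> Arr V; Cod V f = v\<rbrakk> \<Longrightarrow> (f \<otimes> Id V \<one>) \<cdot> RUnit V v = RUnit V (Dom V f) \<cdot> f"
  using runit_natural[of f "Dom V f" v] by (auto simp: hom_def)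

lemma lunit'_nat:
  assumes "f \<in> Arr V" "Cod V f = v"
  shows "f \<cdot> LUnit' v = LUnit' (Dom V f) \<cdot> (Id V \<one> \<otimes> f)"
proof (rule iso_epi[of "LUnit V (Dom V f)"])
  have v: "v \<in> Obj V" using assms cod_in by blast
  have "LUnit V (Dom V f) \<cdot> (f \<cdot> LUnit' v) = ((Id V \<one> \<otimes> f) \<cdot> LUnit V v) \<cdot> LUnit' v"
    using assms v by (subst lunit_nat[OF assms]) simp
  then show "LUnit V (Dom V f) \<cdot> (f \<cdot> LUnit' v) = LUnit V (Dom V f) \<cdot> (LUnit' (Dom V f) \<cdot> (Id V \<one> \<otimes> f))"
    using assms v by simp
qed (use assms cod_in in auto)

lemma runit'_nat:
  assumes "f \<in> Arr V" "Cod V f = v"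
  shows "f \<cdot> RUnit' v = RUnit' (Dom V f) \<cdot> (f \<otimes> Id V \<one>)"
proof (rule iso_epi[of "RUnit V (Dom V f)"])
  have v: "v \<in> Obj V" using assms cod_in by blast
  have "RUnit V (Dom V f) \<cdot> (f \<cdot> RUnit' v) = ((f \<otimes> Id V \<one>) \<cdot> RUnit V v) \<cdot> RUnit' v"
    using assms v by (subst runit_nat[OF assms]) simp
  then show "RUnit V (Dom V f) \<cdot> (f \<cdot> RUnit' v) = RUnit V (Dom V f) \<cdot> (RUnit' (Dom V f) \<cdot> (f \<otimes> Id V \<one>))"
    using assms v by simp
qed (use assms cod_in in auto)

lemma assoc_nat:
  "\<lbrakk>f \<in> Arr V; g \<in> Arr V; h \<in> Arr V; Cod V f = u; Cod V g = v; Cod V h = w\<rbrakk>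
    \<Longrightarrow> ((f \<otimes> g) \<otimes> h) \<cdot> Assoc V u v w = Assoc V (Dom V f) (Dom V g) (Dom V h) \<cdot> (f \<otimes> (g \<otimes> h))"
  using assoc_natural[of f "Dom V f" u g "Dom V g" v h "Dom V h" w] by (auto simp: hom_def)

lemma assoc'_nat:
  assumes "f \<in> Arr V" "g \<in> Arr V" "h \<in> Arr V" "Cod V f = u" "Cod V g = v" "Cod V h = w"
  shows "(f \<otimes> (g \<otimes> h)) \<cdot> Assoc' u v w = Assoc' (Dom V f) (Dom V g) (Dom V h) \<cdot> ((f \<otimes> g) \<otimes> h)"
proof (rule iso_epi[of "Assoc V (Dom V f) (Dom V g) (Dom V h)"])
  let ?A = "Assoc V (Dom V f) (Dom V g) (Dom V h)"
  have o: "u \<in> Obj V" "v \<in> Obj V" "w \<in> Obj V" using assms cod_in by blast+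
  have "?A \<cdot> ((f \<otimes> (g \<otimes> h)) \<cdot> Assoc' u v w) = (((f \<otimes> g) \<otimes> h) \<cdot> Assoc V u v w) \<cdot> Assoc' u v w"
    using assms o by (subst assoc_nat[OF assms]) simp
  then show "?A \<cdot> ((f \<otimes> (g \<otimes> h)) \<cdot> Assoc' u v w)
      = ?A \<cdot> (Assoc' (Dom V f) (Dom V g) (Dom V h) \<cdot> ((f \<otimes> g) \<otimes> h))"
    using assms o by simp
qed (use assms cod_in in auto)

lemma iso_tens: "\<lbrakk>iso f; iso g\<rbrakk> \<Longrightarrow> iso (f \<otimes> g)"
  by (rule isoI[of _ "inverse f \<otimes> inverse g"], rule inverse_arrowsI) auto

text \<open>Naturality of the unitor makes \<open>\<one> \<odot> -\<close> naturally isomorphic to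
  the identity functor, hence faithful. The unit coherences below can therefore be proved after
  tensoring with \<open>\<one>\<close>.\<close>

lemma unit_tens_faithful:
  assumes "f \<in> Arr V" "g \<in> Arr V" "Dom V f = Dom V g" "Cod V f = Cod V g" "Id V \<one> \<otimes> f = Id V \<one> \<otimes> g"
  shows "f = g"
proof (rule iso_epi[of "LUnit V (Dom V f)"])
  show "LUnit V (Dom V f) \<cdot> f = LUnit V (Dom V f) \<cdot> g"
    using lunit_nat[OF assms(1) refl] lunit_nat[OF assms(2) refl] unfolding assms(3,4,5) by simp
qed (use assms(1-4) in auto)

lemma tens_unit_faithful:
  assumes "f \<in> Arr V" "g \<in> Arr V" "Dom V f = Dom V g" "Cod V f = Cod V g" "f \<otimes> Id V \<one> = g \<otimes> Id V \<one>"
  shows "f = g"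
proof (rule iso_epi[of "RUnit V (Dom V f)"])
  show "RUnit V (Dom V f) \<cdot> f = RUnit V (Dom V f) \<cdot> g"
    using runit_nat[OF assms(1) refl] runit_nat[OF assms(2) refl] unfolding assms(3,4,5) by simp
qed (use assms(1-4) in auto)

lemma pentagon':
  "\<lbrakk>u \<in> Obj V; v \<in> Obj V; w \<in> Obj V; x \<in> Obj V\<rbrakk>
    \<Longrightarrow> (Assoc V u v w \<otimes> Id V x) \<cdot> (Assoc V u (v \<odot> w) x \<cdot> (Id V u \<otimes> Assoc V v w x))
      = Assoc V (u \<odot> v) w x \<cdot> Assoc V u v (w \<odot> x)"
  using pentagon[of u v w x] by simp

text \<open>Kelly's derivation: after tensoring with \<open>\<one>\<close> on the left, the pentagon
  at \<open>\<one>, \<one>, u, v\<close> and two uses of the triangle identify both sides up to the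
  invertible prefix \<open>?p\<close>.\<close>

lemma lunit_tensor:
  assumes [simp]: "u \<in> Obj V" "v \<in> Obj V"
  shows "Assoc V \<one> u v \<cdot> LUnit V (u \<odot> v) = LUnit V u \<otimes> Id V v"
proof (rule unit_tens_faithful)
  let ?p = "(Assoc V \<one> \<one> u \<otimes> Id V v) \<cdot> Assoc V \<one> (\<one> \<odot> u) v"
  show "Id V \<one> \<otimes> (Assoc V \<one> u v \<cdot> LUnit V (u \<odot> v)) = Id V \<one> \<otimes> (LUnit V u \<otimes> Id V v)"
  proof (rule iso_epi[of ?p])
    have "?p \<cdot> (Id V \<one> \<otimes> (Assoc V \<one> u v \<cdot> LUnit V (u \<odot> v)))
        = ((Assoc V \<one> \<one> u \<otimes> Id V v) \<cdot> (Assoc V \<one> (\<one> \<odot> u) v \<cdot> (Id V \<one> \<otimes> Assoc V \<one> u v)))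
            \<cdot> (Id V \<one> \<otimes> LUnit V (u \<odot> v))"
      by simp
    also have "\<dots> = Assoc V (\<one> \<odot> \<one>) u v \<cdot> (Assoc V \<one> \<one> (u \<odot> v) \<cdot> (Id V \<one> \<otimes> LUnit V (u \<odot> v)))"
      by (subst pentagon') auto
    also have "\<dots> = Assoc V (\<one> \<odot> \<one>) u v \<cdot> (RUnit V \<one> \<otimes> (Id V u \<otimes> Id V v))"
      by (subst triangle) auto
    also have "\<dots> = ((RUnit V \<one> \<otimes> Id V u) \<otimes> Id V v) \<cdot> Assoc V \<one> u v"
      by (subst assoc_nat) auto
    also have "\<dots> = ((Assoc V \<one> \<one> u \<cdot> (Id V \<one> \<otimes> LUnit V u)) \<otimes> Id V v) \<cdot> Assoc V \<one> u v"
      by (subst triangle) auto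
    also have "\<dots> = ((Assoc V \<one> \<one> u \<otimes> Id V v) \<cdot> ((Id V \<one> \<otimes> LUnit V u) \<otimes> Id V v)) \<cdot> Assoc V \<one> u v"
      by (subst tens_comp) auto
    also have "\<dots> = (Assoc V \<one> \<one> u \<otimes> Id V v) \<cdot> (((Id V \<one> \<otimes> LUnit V u) \<otimes> Id V v) \<cdot> Assoc V \<one> u v)"
      by (subst comp_assoc') auto
    also have "\<dots> = ?p \<cdot> (Id V \<one> \<otimes> (LUnit V u \<otimes> Id V v))"
      by (subst assoc_nat) auto
    finally show "?p \<cdot> (Id V \<one> \<otimes> (Assoc V \<one> u v \<cdot> LUnit V (u \<odot> v)))
      = ?p \<cdot> (Id V \<one> \<otimes> (LUnit V u \<otimes> Id V v))" .
  qed (auto intro!: iso_comp iso_tens iso_id)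
qed auto

text \<open>The mirror image: the pentagon at \<open>u, v, \<one>, \<one>\<close>, after tensoring
  with \<open>\<one>\<close> on the right.\<close>

lemma runit_tensor:
  assumes [simp]: "u \<in> Obj V" "v \<in> Obj V"
  shows "Assoc V u v \<one> \<cdot> (Id V u \<otimes> RUnit V v) = RUnit V (u \<odot> v)"
proof (rule tens_unit_faithful)
  show "(Assoc V u v \<one> \<cdot> (Id V u \<otimes> RUnit V v)) \<otimes> Id V \<one> = RUnit V (u \<odot> v) \<otimes> Id V \<one>"
  proof (rule iso_mono[of "Assoc V u v \<one>"])
    have "(RUnit V (u \<odot> v) \<otimes> Id V \<one>) \<cdot> Assoc V u v \<one>
        = Assoc V (u \<odot> v) \<one> \<one> \<cdot> (((Id V u \<otimes> Id V v) \<otimes> LUnit V \<one>) \<cdot> Assoc V u v \<one>)"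
      by (subst triangle[symmetric]) auto
    also have "\<dots> = (Assoc V (u \<odot> v) \<one> \<one> \<cdot> Assoc V u v (\<one> \<odot> \<one>)) \<cdot> (Id V u \<otimes> (Id V v \<otimes> LUnit V \<one>))"
      by (subst assoc_nat) auto
    also have "\<dots> = (Assoc V u v \<one> \<otimes> Id V \<one>) \<cdot> (Assoc V u (v \<odot> \<one>) \<one>
        \<cdot> (Id V u \<otimes> (Assoc V v \<one> \<one> \<cdot> (Id V v \<otimes> LUnit V \<one>))))"
      by (subst pentagon'[symmetric]) auto
    also have "\<dots> = (Assoc V u v \<one> \<otimes> Id V \<one>) \<cdot> (((Id V u \<otimes> RUnit V v) \<otimes> Id V \<one>) \<cdot> Assoc V u v \<one>)"
      by (subst triangle, simp, simp, subst assoc_nat) auto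
    also have "\<dots> = ((Assoc V u v \<one> \<otimes> Id V \<one>) \<cdot> ((Id V u \<otimes> RUnit V v) \<otimes> Id V \<one>)) \<cdot> Assoc V u v \<one>"
      by (subst comp_assoc') auto
    finally show "((Assoc V u v \<one> \<cdot> (Id V u \<otimes> RUnit V v)) \<otimes> Id V \<one>) \<cdot> Assoc V u v \<one>
      = (RUnit V (u \<odot> v) \<otimes> Id V \<one>) \<cdot> Assoc V u v \<one>" by simp
  qed auto
qed auto

text \<open>At \<open>\<one>, \<one>\<close>, \<open>lunit_tensor\<close> and the triangle have the
  same left side once \<open>Id V \<one> \<otimes> LUnit V \<one>\<close> is known to be
  \<open>LUnit V (\<one> \<odot> \<one>)\<close>. That is naturality of \<open>LUnit\<close> at the
  arrow \<open>LUnit V \<one>\<close>, which can then be cancelled.\<close>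

lemma lunit_unit: "LUnit V \<one> = RUnit V \<one>"
proof (rule tens_unit_faithful)
  have 1: "Id V \<one> \<otimes> LUnit V \<one> = LUnit V (\<one> \<odot> \<one>)"
    by (rule iso_mono[of "LUnit V \<one>"]) (auto simp: lunit_nat)
  show "LUnit V \<one> \<otimes> Id V \<one> = RUnit V \<one> \<otimes> Id V \<one>"
    using lunit_tensor[of \<one> \<one>] triangle[of \<one> \<one>] by (simp add: 1)
qed auto

end

section \<open>Closed structure\<close>

context closed_monoidal_category
begin

declare ihom_in [simp]

lemma curry_simps [simp]:
  assumes "f \<in> Arr V" "Dom V f = u \<odot> w" "Cod V f = v" "u \<in> Obj V" "w \<in> Obj V"
  shows "Curry V u w v f \<in> Arr V" "Dom V (Curry V u w v f) = w" "Cod V (Curry V u w v f) = IHom V u v"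
proof -
  have "Curry V u w v f \<in> hom V w (IHom V u v)"
    using curry_bij[of u w v] assms cod_in[of f] by (auto simp: bij_betw_def hom_def)
  then show "Curry V u w v f \<in> Arr V" "Dom V (Curry V u w v f) = w" "Cod V (Curry V u w v f) = IHom V u v"
    by (auto simp: hom_def)
qed

lemma uncurry_simps [simp]:
  assumes "x \<in> Arr V" "Dom V x = w" "Cod V x = IHom V u v" "u \<in> Obj V" "v \<in> Obj V"
  shows "uncurry u w v x \<in> Arr V" "Dom V (uncurry u w v x) = u \<odot> w" "Cod V (uncurry u w v x) = v"
    "Curry V u w v (uncurry u w v x) = x"
proof -
  have w: "w \<in> Obj V" using assms dom_in by blast
  have x: "x \<in> Curry V u w v ` hom V (u \<odot> w) v"
    using curry_bij[of u w v] assms w by (auto simp: bij_betw_def hom_def)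
  have i: "inj_on (Curry V u w v) (hom V (u \<odot> w) v)"
    using curry_bij[of u w v] assms w by (auto simp: bij_betw_def)
  have "uncurry u w v x \<in> hom V (u \<odot> w) v"
    unfolding uncurry_def using the_inv_into_into[OF i x] by blast
  then show "uncurry u w v x \<in> Arr V" "Dom V (uncurry u w v x) = u \<odot> w" "Cod V (uncurry u w v x) = v"
    by (auto simp: hom_def)
  show "Curry V u w v (uncurry u w v x) = x"
    unfolding uncurry_def using f_the_inv_into_f[OF i x] .
qed

lemma uncurry_curry [simp]:
  assumes "f \<in> Arr V" "Dom V f = u \<odot> w" "Cod V f = v" "u \<in> Obj V" "w \<in> Obj V"
  shows "uncurry u w v (Curry V u w v f) = f"
  using curry_bij[of u w v] assms cod_in[of f]
  by (auto simp: bij_betw_def uncurry_def hom_def intro!: the_inv_into_f_f)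

lemma curry_nat:
  assumes "f \<in> Arr V" "Dom V f = u \<odot> w" "Cod V f = v" "u \<in> Obj V" "h \<in> Arr V" "Cod V h = w"
  shows "h \<cdot> Curry V u w v f = Curry V u (Dom V h) v ((Id V u \<otimes> h) \<cdot> f)"
  using curry_natural[of u v h "Dom V h" w f] assms cod_in[of f] by (auto simp: hom_def)

text \<open>As a simp rule this turns every precomposition into whiskering. Proofs that need the
  mate of a specific composite, as in \<open>uncurry_ihom_curry\<close> or
  \<open>uncurry_comp_tAdj\<close>, have to delete it.\<close>

lemma uncurry_comp [simp]:
  assumes "x \<in> Arr V" "Cod V x = IHom V u v" "u \<in> Obj V" "v \<in> Obj V" "h \<in> Arr V" "Cod V h = Dom V x"
    "Dom V h = w"
  shows "uncurry u w v (h \<cdot> x) = (Id V u \<otimes> h) \<cdot> uncurry u (Dom V x) v x"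
proof -
  have w: "w \<in> Obj V" using assms dom_in by blast
  have "h \<cdot> x = h \<cdot> Curry V u (Dom V x) v (uncurry u (Dom V x) v x)"
    using assms by simp
  also have "\<dots> = Curry V u w v ((Id V u \<otimes> h) \<cdot> uncurry u (Dom V x) v x)"
    using assms w by (subst curry_nat) auto
  finally have "uncurry u w v (h \<cdot> x)
      = uncurry u w v (Curry V u w v ((Id V u \<otimes> h) \<cdot> uncurry u (Dom V x) v x))"
    by simp
  then show ?thesis
    using assms w by simp
qed

lemma uncurry_inject:
  assumes "x \<in> Arr V" "Cod V x = IHom V u v" "y \<in> Arr V" "Cod V y = IHom V u v" "Dom V x = w"
    "Dom V y = w" "u \<in> Obj V" "v \<in> Obj V" "uncurry u w v x = uncurry u w v y"
  shows "x = y"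
  using assms by (metis uncurry_simps(4))

lemma ev_simps [simp]:
  assumes "u \<in> Obj V" "v \<in> Obj V"
  shows "ev u v \<in> Arr V" "Dom V (ev u v) = u \<odot> IHom V u v" "Cod V (ev u v) = v"
  using assms by (simp_all add: ev_def)

lemma uncurry_id [simp]: "uncurry u (IHom V u v) v (Id V (IHom V u v)) = ev u v"
  by (simp add: ev_def)

lemma uncurry_ev:
  assumes "x \<in> Arr V" "Cod V x = IHom V u v" "Dom V x = w" "u \<in> Obj V" "v \<in> Obj V"
  shows "(Id V u \<otimes> x) \<cdot> ev u v = uncurry u w v x"
  using uncurry_comp[of "Id V (IHom V u v)" u v x w] assms by simp

end

section \<open>Graded morphisms of an enriched category\<close>

text \<open>An arrow \<open>f : u \<rightarrow> vHom C a b\<close> is regarded as a morphism \<open>a \<rightarrow> b\<close> of grade \<open>u\<close>.  The operation \<open>gc\<close>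
  composes graded morphisms, multiplying the grades; \<open>lact\<close> and \<open>ract\<close> are composition with a
  morphism of grade \<open>\<one>\<close>, with the unitor removed from the grade.\<close>

locale enriched_category = monoidal_category V
  for V :: "('o, 'm, 'z) moncat_scheme" (structure) +
  fixes C :: "('c, 'o, 'm) vcat"
  assumes v_cat: "v_category C"
begin

definition gc :: "'c \<Rightarrow> 'c \<Rightarrow> 'c \<Rightarrow> 'm \<Rightarrow> 'm \<Rightarrow> 'm" where
  "gc a b c f g = (f \<otimes> g) \<cdot> vComp C a b c"

definition lact :: "'c \<Rightarrow> 'c \<Rightarrow> 'c \<Rightarrow> 'm \<Rightarrow> 'm \<Rightarrow> 'm" where
  "lact a b c f x = LUnit' (Dom V x) \<cdot> gc a b c f x"

definition ract :: "'c \<Rightarrow> 'c \<Rightarrow> 'c \<Rightarrow> 'm \<Rightarrow> 'm \<Rightarrow> 'm" where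
  "ract a b c x f = RUnit' (Dom V x) \<cdot> gc a b c x f"

lemma vHom_Obj [simp]: "\<lbrakk>a \<in> vObj C; b \<in> vObj C\<rbrakk> \<Longrightarrow> vHom C a b \<in> Obj V"
  using v_cat by (auto simp: v_category_def)

lemma vId_simps [simp]:
  assumes "a \<in> vObj C"
  shows "vId C a \<in> Arr V" "Dom V (vId C a) = \<one>" "Cod V (vId C a) = vHom C a a"
  using v_cat assms by (auto simp: v_category_def hom_def)

lemma vComp_simps [simp]:
  assumes "a \<in> vObj C" "b \<in> vObj C" "c \<in> vObj C"
  shows "vComp C a b c \<in> Arr V" "Dom V (vComp C a b c) = vHom C a b \<odot> vHom C b c"
    "Cod V (vComp C a b c) = vHom C a c"
  using v_cat assms by (auto simp: v_category_def hom_def)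

lemma vId_left:
  "\<lbrakk>a \<in> vObj C; b \<in> vObj C\<rbrakk> \<Longrightarrow> (vId C a \<otimes> Id V (vHom C a b)) \<cdot> vComp C a a b = LUnit V (vHom C a b)"
  using v_cat by (auto simp: v_category_def)

lemma vId_right:
  "\<lbrakk>a \<in> vObj C; b \<in> vObj C\<rbrakk> \<Longrightarrow> (Id V (vHom C a b) \<otimes> vId C b) \<cdot> vComp C a b b = RUnit V (vHom C a b)"
  using v_cat by (auto simp: v_category_def)

lemma vComp_assoc:
  "\<lbrakk>a \<in> vObj C; b \<in> vObj C; c \<in> vObj C; d \<in> vObj C\<rbrakk>
    \<Longrightarrow> (vComp C a b c \<otimes> Id V (vHom C c d)) \<cdot> vComp C a c d
      = Assoc V (vHom C a b) (vHom C b c) (vHom C c d)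
          \<cdot> ((Id V (vHom C a b) \<otimes> vComp C b c d) \<cdot> vComp C a b d)"
  using v_cat unfolding v_category_def by simp

lemma gc_simps [simp]:
  assumes "f \<in> Arr V" "g \<in> Arr V" "Cod V f = vHom C a b" "Cod V g = vHom C b c"
    "a \<in> vObj C" "b \<in> vObj C" "c \<in> vObj C"
  shows "gc a b c f g \<in> Arr V" "Dom V (gc a b c f g) = Dom V f \<odot> Dom V g" "Cod V (gc a b c f g) = vHom C a c"
  using assms by (auto simp: gc_def)

lemma gc_id:
  assumes "a \<in> vObj C" "b \<in> vObj C" "c \<in> vObj C"
  shows "gc a b c (Id V (vHom C a b)) (Id V (vHom C b c)) = vComp C a b c"
  using assms by (simp add: gc_def)

lemma gc_comp_left:
  assumes "f \<in> Arr V" "g \<in> Arr V" "Cod V f = vHom C a b" "Cod V g = vHom C b c"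
    "a \<in> vObj C" "b \<in> vObj C" "c \<in> vObj C" "p \<in> Arr V" "Cod V p = Dom V f"
  shows "gc a b c (p \<cdot> f) g = (p \<otimes> Id V (Dom V g)) \<cdot> gc a b c f g"
  using assms by (simp add: gc_def)

lemma gc_comp_right:
  assumes "f \<in> Arr V" "g \<in> Arr V" "Cod V f = vHom C a b" "Cod V g = vHom C b c"
    "a \<in> vObj C" "b \<in> vObj C" "c \<in> vObj C" "q \<in> Arr V" "Cod V q = Dom V g"
  shows "gc a b c f (q \<cdot> g) = (Id V (Dom V f) \<otimes> q) \<cdot> gc a b c f g"
  using assms by (simp add: gc_def)

lemma gc_vId_left:
  assumes "a \<in> vObj C" "b \<in> vObj C" "f \<in> Arr V" "Cod V f = vHom C a b"
  shows "gc a a b (vId C a) f = LUnit V (Dom V f) \<cdot> f"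
proof -
  have "gc a a b (vId C a) f = (Id V \<one> \<otimes> f) \<cdot> ((vId C a \<otimes> Id V (vHom C a b)) \<cdot> vComp C a a b)"
    using assms by (simp add: gc_def)
  then show ?thesis
    using assms by (simp add: vId_left lunit_nat del: tens_comp_reassoc)
qed

lemma gc_vId_right:
  assumes "a \<in> vObj C" "b \<in> vObj C" "f \<in> Arr V" "Cod V f = vHom C a b"
  shows "gc a b b f (vId C b) = RUnit V (Dom V f) \<cdot> f"
proof -
  have "gc a b b f (vId C b) = (f \<otimes> Id V \<one>) \<cdot> ((Id V (vHom C a b) \<otimes> vId C b) \<cdot> vComp C a b b)"
    using assms by (simp add: gc_def)
  then show ?thesis
    using assms by (simp add: vId_right runit_nat del: tens_comp_reassoc)
qed

lemma gc_assoc: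
  assumes [simp]: "a \<in> vObj C" "b \<in> vObj C" "c \<in> vObj C" "d \<in> vObj C"
    "f \<in> Arr V" "g \<in> Arr V" "h \<in> Arr V"
    "Cod V f = vHom C a b" "Cod V g = vHom C b c" "Cod V h = vHom C c d"
  shows "gc a c d (gc a b c f g) h = Assoc V (Dom V f) (Dom V g) (Dom V h) \<cdot> gc a b d f (gc b c d g h)"
proof -
  have "gc a c d (gc a b c f g) h
      = ((f \<otimes> g) \<otimes> h) \<cdot> ((vComp C a b c \<otimes> Id V (vHom C c d)) \<cdot> vComp C a c d)"
    by (simp add: gc_def)
  also have "\<dots> = (((f \<otimes> g) \<otimes> h) \<cdot> Assoc V (vHom C a b) (vHom C b c) (vHom C c d))
      \<cdot> ((Id V (vHom C a b) \<otimes> vComp C b c d) \<cdot> vComp C a b d)"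
    by (subst vComp_assoc) auto
  also have "\<dots> = Assoc V (Dom V f) (Dom V g) (Dom V h) \<cdot> gc a b d f (gc b c d g h)"
    by (subst assoc_nat) (auto simp: gc_def)
  finally show ?thesis .
qed

lemma act_simps [simp]:
  assumes "f \<in> Arr V" "g \<in> Arr V" "Cod V f = vHom C a b" "Cod V g = vHom C b c"
    "a \<in> vObj C" "b \<in> vObj C" "c \<in> vObj C"
  shows "Dom V f = \<one> \<Longrightarrow> lact a b c f g \<in> Arr V"
    "Dom V f = \<one> \<Longrightarrow> Dom V (lact a b c f g) = Dom V g"
    "Dom V f = \<one> \<Longrightarrow> Cod V (lact a b c f g) = vHom C a c"
    "Dom V g = \<one> \<Longrightarrow> ract a b c f g \<in> Arr V"
    "Dom V g = \<one> \<Longrightarrow> Dom V (ract a b c f g) = Dom V f"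
    "Dom V g = \<one> \<Longrightarrow> Cod V (ract a b c f g) = vHom C a c"
  using assms by (auto simp: lact_def ract_def)

lemma lact_vId [simp]:
  assumes "a \<in> vObj C" "b \<in> vObj C" "f \<in> Arr V" "Cod V f = vHom C a b"
  shows "lact a a b (vId C a) f = f"
  using assms by (simp add: lact_def gc_vId_left)

lemma ract_vId [simp]:
  assumes "a \<in> vObj C" "b \<in> vObj C" "f \<in> Arr V" "Cod V f = vHom C a b"
  shows "ract a b b f (vId C b) = f"
  using assms by (simp add: ract_def gc_vId_right)

lemma lact_comp:
  assumes [simp]: "f \<in> Arr V" "g \<in> Arr V" "Cod V f = vHom C a b" "Cod V g = vHom C b c"
    "a \<in> vObj C" "b \<in> vObj C" "c \<in> vObj C" "p \<in> Arr V" "Cod V p = Dom V g" "Dom V f = \<one>"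
  shows "lact a b c f (p \<cdot> g) = p \<cdot> lact a b c f g"
proof -
  have "lact a b c f (p \<cdot> g) = (LUnit' (Dom V p) \<cdot> (Id V \<one> \<otimes> p)) \<cdot> gc a b c f g"
    by (simp add: lact_def gc_comp_right)
  also have "\<dots> = p \<cdot> LUnit' (Dom V g) \<cdot> gc a b c f g"
    by (subst lunit'_nat) auto
  finally show ?thesis by (simp add: lact_def)
qed

lemma ract_comp:
  assumes [simp]: "f \<in> Arr V" "g \<in> Arr V" "Cod V f = vHom C a b" "Cod V g = vHom C b c"
    "a \<in> vObj C" "b \<in> vObj C" "c \<in> vObj C" "p \<in> Arr V" "Cod V p = Dom V f" "Dom V g = \<one>"
  shows "ract a b c (p \<cdot> f) g = p \<cdot> ract a b c f g"
proof -
  have "ract a b c (p \<cdot> f) g = (RUnit' (Dom V p) \<cdot> (p \<otimes> Id V \<one>)) \<cdot> gc a b c f g"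
    by (simp add: ract_def gc_comp_left)
  also have "\<dots> = p \<cdot> RUnit' (Dom V f) \<cdot> gc a b c f g"
    by (subst runit'_nat) auto
  finally show ?thesis by (simp add: ract_def)
qed

text \<open>An instance of \<open>gc_assoc\<close> with a first factor of grade
  \<open>\<one>\<close>. The unitor is stripped from grade \<open>u\<close> on one side and from
  \<open>u \<odot> v\<close> on the other; \<open>lunit_tensor\<close> reconciles the two.\<close>

lemma gc_lact:
  assumes [simp]: "a \<in> vObj C" "b \<in> vObj C" "c \<in> vObj C" "d \<in> vObj C"
    "f \<in> Arr V" "g \<in> Arr V" "h \<in> Arr V"
    "Cod V f = vHom C a b" "Cod V g = vHom C b c" "Cod V h = vHom C c d" "Dom V f = \<one>"
  shows "gc a c d (lact a b c f g) h = lact a b d f (gc b c d g h)"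
proof (rule iso_epi[of "LUnit V (Dom V g \<odot> Dom V h)"])
  let ?u = "Dom V g" and ?v = "Dom V h"
  have "LUnit V (?u \<odot> ?v) \<cdot> gc a c d (lact a b c f g) h
      = (Assoc' \<one> ?u ?v \<cdot> (LUnit V ?u \<otimes> Id V ?v)) \<cdot> gc a c d (lact a b c f g) h"
    by (subst lunit_tensor[symmetric]) auto
  then show "LUnit V (?u \<odot> ?v) \<cdot> gc a c d (lact a b c f g) h
      = LUnit V (?u \<odot> ?v) \<cdot> lact a b d f (gc b c d g h)"
    by (simp add: lact_def gc_comp_left gc_assoc)
qed auto

lemma gc_ract:
  assumes [simp]: "a \<in> vObj C" "b \<in> vObj C" "c \<in> vObj C" "d \<in> vObj C"
    "f \<in> Arr V" "g \<in> Arr V" "h \<in> Arr V"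
    "Cod V f = vHom C a b" "Cod V g = vHom C b c" "Cod V h = vHom C c d" "Dom V h = \<one>"
  shows "gc a b d f (ract b c d g h) = ract a c d (gc a b c f g) h"
proof (rule iso_epi[of "RUnit V (Dom V f \<odot> Dom V g)"])
  let ?u = "Dom V f" and ?v = "Dom V g"
  have "RUnit V (?u \<odot> ?v) \<cdot> gc a b d f (ract b c d g h)
      = Assoc V ?u ?v \<one> \<cdot> ((Id V ?u \<otimes> RUnit V ?v) \<cdot> gc a b d f (ract b c d g h))"
    by (subst runit_tensor[symmetric]) auto
  then show "RUnit V (?u \<odot> ?v) \<cdot> gc a b d f (ract b c d g h)
      = RUnit V (?u \<odot> ?v) \<cdot> ract a c d (gc a b c f g) h"
    by (simp add: ract_def gc_comp_right gc_assoc)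
qed auto

text \<open>A middle factor of grade \<open>\<one>\<close> may be absorbed on either side: the
  triangle identity at the level of grades.\<close>

lemma gc_ract_left:
  assumes [simp]: "a \<in> vObj C" "b \<in> vObj C" "c \<in> vObj C" "d \<in> vObj C"
    "f \<in> Arr V" "g \<in> Arr V" "h \<in> Arr V"
    "Cod V f = vHom C a b" "Cod V g = vHom C b c" "Cod V h = vHom C c d" "Dom V g = \<one>"
  shows "gc a c d (ract a b c f g) h = gc a b d f (lact b c d g h)"
proof (rule iso_epi[of "RUnit V (Dom V f) \<otimes> Id V (Dom V h)"])
  let ?u = "Dom V f" and ?v = "Dom V h"
  have "(RUnit V ?u \<otimes> Id V ?v) \<cdot> gc a b d f (lact b c d g h)
      = Assoc V ?u \<one> ?v \<cdot> ((Id V ?u \<otimes> LUnit V ?v) \<cdot> gc a b d f (lact b c d g h))"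
    by (subst triangle[symmetric]) auto
  then show "(RUnit V ?u \<otimes> Id V ?v) \<cdot> gc a c d (ract a b c f g) h
      = (RUnit V ?u \<otimes> Id V ?v) \<cdot> gc a b d f (lact b c d g h)"
    by (simp add: ract_def lact_def gc_comp_right gc_comp_left gc_assoc)
qed (auto intro!: iso_tens iso_id)

section \<open>The underlying category and natural transformations\<close>

lemma ucomp_lact:
  assumes "a \<in> vObj C" "b \<in> vObj C" "c \<in> vObj C" "f \<in> Arr V" "g \<in> Arr V"
    "Cod V f = vHom C a b" "Cod V g = vHom C b c" "Dom V f = \<one>" "Dom V g = \<one>"
  shows "ucomp C a b c f g = lact a b c f g"
  using assms by (simp add: ucomp_def lact_def gc_def)

text \<open>The definition of \<open>ucomp\<close> uses the left unitor; since
  \<open>LUnit V \<one> = RUnit V \<one>\<close>, composition in the underlying category is an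
  instance of \<open>ract\<close> as well.\<close>

lemma ucomp_ract:
  assumes "a \<in> vObj C" "b \<in> vObj C" "c \<in> vObj C" "f \<in> Arr V" "g \<in> Arr V"
    "Cod V f = vHom C a b" "Cod V g = vHom C b c" "Dom V f = \<one>" "Dom V g = \<one>"
  shows "ucomp C a b c f g = ract a b c f g"
  using assms by (simp add: ucomp_def ract_def gc_def lunit_unit)

lemma ucomp_simps [simp]:
  assumes "a \<in> vObj C" "b \<in> vObj C" "c \<in> vObj C" "f \<in> Arr V" "g \<in> Arr V"
    "Cod V f = vHom C a b" "Cod V g = vHom C b c" "Dom V f = \<one>" "Dom V g = \<one>"
  shows "ucomp C a b c f g \<in> Arr V" "Dom V (ucomp C a b c f g) = \<one>" "Cod V (ucomp C a b c f g) = vHom C a c"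
  using assms by (auto simp: ucomp_lact)

lemma lact_lact:
  assumes [simp]: "a \<in> vObj C" "b \<in> vObj C" "c \<in> vObj C" "d \<in> vObj C"
    "f \<in> Arr V" "g \<in> Arr V" "h \<in> Arr V"
    "Cod V f = vHom C a b" "Cod V g = vHom C b c" "Cod V h = vHom C c d" "Dom V f = \<one>" "Dom V g = \<one>"
  shows "lact a b d f (lact b c d g h) = lact a c d (ucomp C a b c f g) h"
proof -
  have "lact a b d f (lact b c d g h) = LUnit' (Dom V h) \<cdot> lact a b d f (gc b c d g h)"
    by (simp add: lact_def[of b c d] lact_comp)
  then show ?thesis
    by (simp add: lact_def[of a c d] ucomp_lact gc_lact)
qed

lemma ract_ract:
  assumes [simp]: "a \<in> vObj C" "b \<in> vObj C" "c \<in> vObj C" "d \<in> vObj C"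
    "f \<in> Arr V" "g \<in> Arr V" "h \<in> Arr V"
    "Cod V f = vHom C a b" "Cod V g = vHom C b c" "Cod V h = vHom C c d" "Dom V g = \<one>" "Dom V h = \<one>"
  shows "ract a c d (ract a b c f g) h = ract a b d f (ucomp C b c d g h)"
  by (simp add: ract_def[of a c d] ract_def[of a b d] ucomp_lact gc_ract_left)

lemma lact_ract:
  assumes [simp]: "a \<in> vObj C" "b \<in> vObj C" "c \<in> vObj C" "d \<in> vObj C"
    "f \<in> Arr V" "g \<in> Arr V" "h \<in> Arr V"
    "Cod V f = vHom C a b" "Cod V g = vHom C b c" "Cod V h = vHom C c d" "Dom V f = \<one>" "Dom V h = \<one>"
  shows "lact a b d f (ract b c d g h) = ract a c d (lact a b c f g) h"
  by (simp add: lact_def gc_ract ract_comp)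

lemma ucomp_assoc:
  assumes "a \<in> vObj C" "b \<in> vObj C" "c \<in> vObj C" "d \<in> vObj C"
    "f \<in> uhom C a b" "g \<in> uhom C b c" "h \<in> uhom C c d"
  shows "ucomp C a c d (ucomp C a b c f g) h = ucomp C a b d f (ucomp C b c d g h)"
proof -
  have h: "f \<in> Arr V" "Dom V f = \<one>" "Cod V f = vHom C a b" "g \<in> Arr V" "Dom V g = \<one>"
    "Cod V g = vHom C b c" "h \<in> Arr V" "Dom V h = \<one>" "Cod V h = vHom C c d"
    using assms by (auto simp: uhom_def hom_def)
  show ?thesis
    using lact_lact[of a b c d f g h] assms(1-4) h by (simp add: ucomp_lact)
qed

lemma u_inverse_arrows_unique:
  assumes "a \<in> vObj C" "b \<in> vObj C" "u_inverse_arrows C a b f g" "u_inverse_arrows C a b f h"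
  shows "g = h"
proof -
  have h: "f \<in> Arr V" "Dom V f = \<one>" "Cod V f = vHom C a b" "g \<in> Arr V" "Dom V g = \<one>"
    "Cod V g = vHom C b a" "h \<in> Arr V" "Dom V h = \<one>" "Cod V h = vHom C b a"
    "ucomp C a b a f h = vId C a" "ucomp C b a b g f = vId C b"
    using assms by (auto simp: u_inverse_arrows_def uhom_def hom_def)
  have "g = ract b a a g (ucomp C a b a f h)"
    using assms(1,2) h by simp
  also have "\<dots> = ract b b a (ract b a b g f) h"
    using assms(1,2) h(1-9) by (simp add: ract_ract)
  also have "\<dots> = ract b b a (vId C b) h"
    using assms(1,2) h by (simp add: ucomp_ract)
  also have "\<dots> = h"
    using assms(1,2) h(1-9) by (simp add: ucomp_lact flip: ucomp_ract)
  finally show ?thesis .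
qed

lemma u_inverse_eqI:
  "\<lbrakk>a \<in> vObj C; b \<in> vObj C; u_inverse_arrows C a b f g\<rbrakk> \<Longrightarrow> u_inverse C a b f = g"
  unfolding u_inverse_def using u_inverse_arrows_unique by blast

lemma u_inverse_arrows_u_inverse:
  "\<lbrakk>a \<in> vObj C; b \<in> vObj C; u_iso C a b f\<rbrakk> \<Longrightarrow> u_inverse_arrows C a b f (u_inverse C a b f)"
  unfolding u_iso_def using u_inverse_eqI by auto

lemma u_iso_sym: "u_inverse_arrows C a b f g \<Longrightarrow> u_iso C b a g"
  by (auto simp: u_iso_def u_inverse_arrows_def)

lemma u_iso_ucomp:
  assumes [simp]: "a \<in> vObj C" "b \<in> vObj C" "c \<in> vObj C"
    and f: "u_iso C a b f" and g: "u_iso C b c g"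
  shows "u_iso C a c (ucomp C a b c f g)"
proof -
  obtain f' g' where fg: "u_inverse_arrows C a b f f'" "u_inverse_arrows C b c g g'"
    using f g by (auto simp: u_iso_def)
  note u = fg[unfolded u_inverse_arrows_def]
  have [simp]: "f \<in> Arr V" "Dom V f = \<one>" "Cod V f = vHom C a b" "f' \<in> Arr V" "Dom V f' = \<one>" "Cod V f' = vHom C b a"
    "g \<in> Arr V" "Dom V g = \<one>" "Cod V g = vHom C b c" "g' \<in> Arr V" "Dom V g' = \<one>" "Cod V g' = vHom C c b"
    "ucomp C a b a f f' = vId C a" "ucomp C b a b f' f = vId C b"
    "ucomp C b c b g g' = vId C b" "ucomp C c b c g' g = vId C c"
    using u by (auto simp: uhom_def hom_def)
  \<comment> \<open>Stated for arbitrary composable isomorphisms because it is needed twice: for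
    \<open>f, g\<close>, and for \<open>g', f'\<close> with inverses \<open>g, f\<close>.\<close>
  have cancel: "ucomp C x z x (ucomp C x y z p q) (ucomp C z y x q' p') = vId C x"
    if "u_inverse_arrows C x y p p'" "u_inverse_arrows C y z q q'" and [simp]: "x \<in> vObj C" "y \<in> vObj C" "z \<in> vObj C"
    for x y z p q p' q'
  proof -
    have [simp]: "p \<in> Arr V" "Dom V p = \<one>" "Cod V p = vHom C x y" "p' \<in> Arr V" "Dom V p' = \<one>" "Cod V p' = vHom C y x"
      "q \<in> Arr V" "Dom V q = \<one>" "Cod V q = vHom C y z" "q' \<in> Arr V" "Dom V q' = \<one>" "Cod V q' = vHom C z y"
      and e: "ucomp C x y x p p' = vId C x" "ucomp C y z y q q' = vId C y"
      using that(1,2) by (auto simp: u_inverse_arrows_def uhom_def hom_def)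
    have "ucomp C x z x (ucomp C x y z p q) (ucomp C z y x q' p')
        = ucomp C x y x (ucomp C x z y (ucomp C x y z p q) q') p'"
      by (rule ucomp_assoc[symmetric]) (auto simp: uhom_def hom_def)
    also have "ucomp C x z y (ucomp C x y z p q) q' = ucomp C x y y p (ucomp C y z y q q')"
      by (rule ucomp_assoc) (auto simp: uhom_def hom_def)
    also have "\<dots> = p"
      by (simp add: e ucomp_ract)
    finally show ?thesis
      by (simp add: e)
  qed
  have "u_inverse_arrows C b a f' f" "u_inverse_arrows C c b g' g"
    using fg by (auto simp: u_inverse_arrows_def)
  then have "u_inverse_arrows C a c (ucomp C a b c f g) (ucomp C c b a g' f')"
    using fg cancel[of a b f f' c g g'] cancel[of c b g' g a f' f] unfolding u_inverse_arrows_def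
    by (auto simp: uhom_def hom_def)
  then show ?thesis
    by (auto simp: u_iso_def)
qed

text \<open>Only typing is asked of \<open>F\<close> and \<open>G\<close>, so composites can be
  inserted without first proving them functorial.\<close>

lemma v_nat_trans_iff:
  assumes "\<And>a. a \<in> vObj A \<Longrightarrow> fObj F a \<in> vObj C" "\<And>a. a \<in> vObj A \<Longrightarrow> fObj G a \<in> vObj C"
    "\<And>a b. \<lbrakk>a \<in> vObj A; b \<in> vObj A\<rbrakk> \<Longrightarrow> fHom F a b \<in> hom V (vHom A a b) (vHom C (fObj F a) (fObj F b))"
    "\<And>a b. \<lbrakk>a \<in> vObj A; b \<in> vObj A\<rbrakk> \<Longrightarrow> fHom G a b \<in> hom V (vHom A a b) (vHom C (fObj G a) (fObj G b))"
  shows "v_nat_trans A C F G \<sigma> \<longleftrightarrow>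
    (\<forall>a\<in>vObj A. \<sigma> a \<in> hom V \<one> (vHom C (fObj F a) (fObj G a)))
    \<and> (\<forall>a\<in>vObj A. \<forall>b\<in>vObj A. lact (fObj F a) (fObj G a) (fObj G b) (\<sigma> a) (fHom G a b)
        = ract (fObj F a) (fObj F b) (fObj G b) (fHom F a b) (\<sigma> b))"
proof -
  have *: "(inverse (LUnit V (vHom A a b)) \<cdot> (\<sigma> a \<otimes> fHom G a b)
          \<cdot> vComp C (fObj F a) (fObj G a) (fObj G b)
      = inverse (RUnit V (vHom A a b)) \<cdot> (fHom F a b \<otimes> \<sigma> b)
          \<cdot> vComp C (fObj F a) (fObj F b) (fObj G b))
    \<longleftrightarrow> lact (fObj F a) (fObj G a) (fObj G b) (\<sigma> a) (fHom G a b)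
        = ract (fObj F a) (fObj F b) (fObj G b) (fHom F a b) (\<sigma> b)"
    if "\<forall>a\<in>vObj A. \<sigma> a \<in> hom V \<one> (vHom C (fObj F a) (fObj G a))" "a \<in> vObj A" "b \<in> vObj A" for a b
  proof -
    note [simp] = that assms(1,2)[OF that(2)] assms(1,2)[OF that(3)]
      homD[OF assms(3)[OF that(2,3)]] homD[OF assms(4)[OF that(2,3)]]
      homD(1-3)[OF that(1)[rule_format, OF that(2)]] homD(1-3)[OF that(1)[rule_format, OF that(3)]]
    show ?thesis
      by (simp add: lact_def ract_def gc_def)
  qed
  show ?thesis
    unfolding v_nat_trans_def using * by auto
qed

text \<open>Condition (3) supplies a transformation out of the identity, while
  \<open>v_equivalence\<close> asks for one into it. The naturality square is composed with an
  inverse component on each side.\<close>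

lemma v_nat_iso_inverse:
  assumes F: "\<And>a. a \<in> vObj A \<Longrightarrow> fObj F a \<in> vObj C" and G: "\<And>a. a \<in> vObj A \<Longrightarrow> fObj G a \<in> vObj C"
    and F': "\<And>a b. \<lbrakk>a \<in> vObj A; b \<in> vObj A\<rbrakk> \<Longrightarrow> fHom F a b \<in> hom V (vHom A a b) (vHom C (fObj F a) (fObj F b))"
    and G': "\<And>a b. \<lbrakk>a \<in> vObj A; b \<in> vObj A\<rbrakk> \<Longrightarrow> fHom G a b \<in> hom V (vHom A a b) (vHom C (fObj G a) (fObj G b))"
    and \<sigma>: "v_nat_iso A C F G \<sigma>"
  shows "v_nat_iso A C G F (\<lambda>a. u_inverse C (fObj F a) (fObj G a) (\<sigma> a))"
proof -
  let ?t = "\<lambda>a. u_inverse C (fObj F a) (fObj G a) (\<sigma> a)"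
  have inv: "u_inverse_arrows C (fObj F a) (fObj G a) (\<sigma> a) (?t a)" if "a \<in> vObj A" for a
    using \<sigma> that F G by (auto simp: v_nat_iso_def intro: u_inverse_arrows_u_inverse)
  have nat: "lact (fObj F a) (fObj G a) (fObj G b) (\<sigma> a) (fHom G a b)
        = ract (fObj F a) (fObj F b) (fObj G b) (fHom F a b) (\<sigma> b)"
    if "a \<in> vObj A" "b \<in> vObj A" for a b
    using \<sigma> that v_nat_trans_iff[of A F G \<sigma>, OF F G F' G'] by (simp add: v_nat_iso_def)
  have "lact (fObj G a) (fObj F a) (fObj F b) (?t a) (fHom F a b)
      = ract (fObj G a) (fObj G b) (fObj F b) (fHom G a b) (?t b)"
    if a [simp]: "a \<in> vObj A" and b [simp]: "b \<in> vObj A" for a b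
  proof -
    note [simp] = F G homD[OF F'[OF a b]] homD[OF G'[OF a b]]
    have [simp]: "\<sigma> a \<in> Arr V" "Dom V (\<sigma> a) = \<one>" "Cod V (\<sigma> a) = vHom C (fObj F a) (fObj G a)"
      "\<sigma> b \<in> Arr V" "Dom V (\<sigma> b) = \<one>" "Cod V (\<sigma> b) = vHom C (fObj F b) (fObj G b)"
      "?t a \<in> Arr V" "Dom V (?t a) = \<one>" "Cod V (?t a) = vHom C (fObj G a) (fObj F a)"
      "?t b \<in> Arr V" "Dom V (?t b) = \<one>" "Cod V (?t b) = vHom C (fObj G b) (fObj F b)"
      and c: "ucomp C (fObj F b) (fObj G b) (fObj F b) (\<sigma> b) (?t b) = vId C (fObj F b)"
      "ucomp C (fObj G a) (fObj F a) (fObj G a) (?t a) (\<sigma> a) = vId C (fObj G a)"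
      using inv[OF a] inv[OF b] by (auto simp: u_inverse_arrows_def uhom_def hom_def)
    have "lact (fObj G a) (fObj F a) (fObj F b) (?t a) (fHom F a b)
        = lact (fObj G a) (fObj F a) (fObj F b) (?t a)
            (ract (fObj F a) (fObj F b) (fObj F b) (fHom F a b) (vId C (fObj F b)))"
      by simp
    also have "\<dots> = lact (fObj G a) (fObj F a) (fObj F b) (?t a)
        (ract (fObj F a) (fObj G b) (fObj F b)
          (lact (fObj F a) (fObj G a) (fObj G b) (\<sigma> a) (fHom G a b)) (?t b))"
      unfolding nat[OF a b] by (simp add: ract_ract c del: ract_vId)
    also have "\<dots> = ract (fObj G a) (fObj G b) (fObj F b)
        (lact (fObj G a) (fObj G a) (fObj G b) (vId C (fObj G a)) (fHom G a b)) (?t b)"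
      by (simp add: lact_ract lact_lact c del: lact_vId)
    finally show ?thesis by simp
  qed
  then have "v_nat_trans A C G F ?t"
    using inv by (subst v_nat_trans_iff[of A G F, OF G F G' F']) (auto simp: u_inverse_arrows_def uhom_def)
  moreover have "u_iso C (fObj G a) (fObj F a) (?t a)" if "a \<in> vObj A" for a
    using inv[OF that] by (rule u_iso_sym)
  ultimately show ?thesis
    by (auto simp: v_nat_iso_def)
qed

end

section \<open>The self-enrichment\<close>

context closed_monoidal_category
begin

lemma self_sel [simp]:
  "vObj self = Obj V" "vHom self = IHom V" "vId self = (\<lambda>u. Curry V u \<one> u (RUnit V u))"
  by (simp_all add: self_def)

lemma vComp_self_simps [simp]:
  assumes "u \<in> Obj V" "v \<in> Obj V" "w \<in> Obj V"
  shows "vComp self u v w \<in> Arr V" "Dom V (vComp self u v w) = IHom V u v \<odot> IHom V v w"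
    "Cod V (vComp self u v w) = IHom V u w"
  using assms by (simp_all add: self_def)

lemma uncurry_vComp_self:
  assumes [simp]: "u \<in> Obj V" "v \<in> Obj V" "w \<in> Obj V" "p \<in> Obj V" "q \<in> Obj V" "x \<in> Arr V" "y \<in> Arr V"
    "Dom V x = p" "Cod V x = IHom V u v" "Dom V y = q" "Cod V y = IHom V v w"
  shows "uncurry u (p \<odot> q) w ((x \<otimes> y) \<cdot> vComp self u v w)
    = Assoc' u p q \<cdot> ((uncurry u p v x \<otimes> Id V q) \<cdot> uncurry v q w y)"
proof -
  have "uncurry u (p \<odot> q) w ((x \<otimes> y) \<cdot> vComp self u v w)
      = (Id V u \<otimes> (x \<otimes> y)) \<cdot> (Assoc' u (IHom V u v) (IHom V v w)
          \<cdot> ((ev u v \<otimes> Id V (IHom V v w)) \<cdot> ev v w))"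
    by (simp add: self_def)
  also have "\<dots> = Assoc' u p q \<cdot> (((Id V u \<otimes> x) \<otimes> y) \<cdot> ((ev u v \<otimes> Id V (IHom V v w)) \<cdot> ev v w))"
    by (subst assoc'_nat[THEN comp_reassoc]) auto
  also have "\<dots> = Assoc' u p q \<cdot> ((((Id V u \<otimes> x) \<cdot> ev u v) \<otimes> Id V q) \<cdot> ((Id V v \<otimes> y) \<cdot> ev v w))"
    by simp
  finally show ?thesis
    by (simp add: uncurry_ev)
qed

lemma self_arr_simps [simp]:
  assumes "g \<in> Arr V" "Dom V g = u" "Cod V g = v"
  shows "self_arr u v g \<in> Arr V" "Dom V (self_arr u v g) = \<one>" "Cod V (self_arr u v g) = IHom V u v"
    "uncurry u \<one> v (self_arr u v g) = RUnit V u \<cdot> g"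
  using assms dom_in[of g] cod_in[of g] by (simp_all add: self_arr_def)

lemma self_arr_inject:
  assumes "g \<in> Arr V" "Dom V g = u" "Cod V g = v" "h \<in> Arr V" "Dom V h = u" "Cod V h = v"
    "self_arr u v g = self_arr u v h"
  shows "g = h"
proof (rule iso_epi[of "RUnit V u"])
  show "RUnit V u \<cdot> g = RUnit V u \<cdot> h"
    using assms self_arr_simps(4) by metis
qed (use assms dom_in[of g] in auto)

lemma self_arr_surj:
  assumes "x \<in> Arr V" "Dom V x = \<one>" "Cod V x = IHom V u v" "u \<in> Obj V" "v \<in> Obj V"
  obtains g where "g \<in> Arr V" "Dom V g = u" "Cod V g = v" "x = self_arr u v g"
proof
  show "x = self_arr u v (RUnit' u \<cdot> uncurry u \<one> v x)"
    using assms by (simp add: self_arr_def)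
qed (use assms in auto)

lemma triangle':
  assumes [simp]: "u \<in> Obj V" "v \<in> Obj V"
  shows "(Id V u \<otimes> LUnit' v) \<cdot> (Assoc' u \<one> v \<cdot> (RUnit V u \<otimes> Id V v)) = Id V (u \<odot> v)"
  by (subst triangle[symmetric]) auto

text \<open>Together with \<open>self_arr_inject\<close>, \<open>self_arr_surj\<close> and
  \<open>vId_self\<close> this makes V isomorphic to the underlying category of \<open>self\<close>,
  so invertibility there can be tested in V.\<close>

lemma ucomp_self_arr:
  assumes [simp]: "f \<in> Arr V" "Dom V f = u" "Cod V f = v" "g \<in> Arr V" "Dom V g = v" "Cod V g = w"
  shows "ucomp self u v w (self_arr u v f) (self_arr v w g) = self_arr u w (f \<cdot> g)"
proof (rule uncurry_inject[where w = \<one> and u = u and v = w])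
  have [simp]: "u \<in> Obj V" "v \<in> Obj V" "w \<in> Obj V"
    using dom_in[of f] cod_in[of f] cod_in[of g] by auto
  show "u \<in> Obj V" "w \<in> Obj V" by auto
  have "uncurry u \<one> w (ucomp self u v w (self_arr u v f) (self_arr v w g))
      = (Id V u \<otimes> LUnit' \<one>) \<cdot> uncurry u (\<one> \<odot> \<one>) w ((self_arr u v f \<otimes> self_arr v w g) \<cdot> vComp self u v w)"
    by (simp add: ucomp_def)
  also have "\<dots> = (Id V u \<otimes> LUnit' \<one>) \<cdot> (Assoc' u \<one> \<one> \<cdot> (((RUnit V u \<cdot> f) \<otimes> Id V \<one>) \<cdot> (RUnit V v \<cdot> g)))"
    by (subst uncurry_vComp_self) auto
  also have "((RUnit V u \<cdot> f) \<otimes> Id V \<one>) \<cdot> (RUnit V v \<cdot> g)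
      = (RUnit V u \<otimes> Id V \<one>) \<cdot> (((f \<otimes> Id V \<one>) \<cdot> RUnit V v) \<cdot> g)"
    by simp
  also have "\<dots> = (RUnit V u \<otimes> Id V \<one>) \<cdot> (RUnit V u \<cdot> (f \<cdot> g))"
    by (subst runit_nat) auto
  also have "(Id V u \<otimes> LUnit' \<one>) \<cdot> (Assoc' u \<one> \<one> \<cdot> \<dots>)
      = ((Id V u \<otimes> LUnit' \<one>) \<cdot> (Assoc' u \<one> \<one> \<cdot> (RUnit V u \<otimes> Id V \<one>))) \<cdot> (RUnit V u \<cdot> (f \<cdot> g))"
    by simp
  also have "\<dots> = RUnit V u \<cdot> (f \<cdot> g)"
    by (subst triangle') auto
  finally show "uncurry u \<one> w (ucomp self u v w (self_arr u v f) (self_arr v w g))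
      = uncurry u \<one> w (self_arr u w (f \<cdot> g))" by simp
qed (use dom_in[of f] cod_in[of f] cod_in[of g] in \<open>auto simp: ucomp_def\<close>)

lemma vId_self: "u \<in> Obj V \<Longrightarrow> vId self u = self_arr u u (Id V u)"
  by (simp add: self_arr_def)

lemma u_iso_self_arr:
  assumes [simp]: "f \<in> Arr V" "Dom V f = u" "Cod V f = v"
  shows "u_iso self u v (self_arr u v f) \<longleftrightarrow> iso f"
proof
  have [simp]: "u \<in> Obj V" "v \<in> Obj V"
    using dom_in[of f] cod_in[of f] by auto
  {
    assume "u_iso self u v (self_arr u v f)"
    then obtain x where x: "x \<in> Arr V" "Dom V x = \<one>" "Cod V x = IHom V v u"
      "ucomp self u v u (self_arr u v f) x = vId self u" "ucomp self v u v x (self_arr u v f) = vId self v"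
      by (auto simp: u_iso_def u_inverse_arrows_def uhom_def hom_def)
    then obtain g where g: "g \<in> Arr V" "Dom V g = v" "Cod V g = u" "x = self_arr v u g"
      by (auto elim: self_arr_surj)
    have "f \<cdot> g = Id V u"
      by (rule self_arr_inject[of _ u u]) (use x g in \<open>auto simp: ucomp_self_arr vId_self simp del: self_sel\<close>)
    moreover have "g \<cdot> f = Id V v"
      by (rule self_arr_inject[of _ v v]) (use x g in \<open>auto simp: ucomp_self_arr vId_self simp del: self_sel\<close>)
    ultimately show "iso f"
      by (intro isoI[of f g] inverse_arrowsI) (use g in auto)
  }
  {
    assume i: "iso f"
    then have "u_inverse_arrows self u v (self_arr u v f) (self_arr v u (inverse f))"
      by (simp add: u_inverse_arrows_def uhom_def hom_def ucomp_self_arr flip: self_arr_def)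
        (simp add: self_arr_def)
    then show "u_iso self u v (self_arr u v f)"
      by (auto simp: u_iso_def)
  }
qed

section \<open>Internal currying as an isomorphism\<close>

lemma ihom_curry_simps [simp]:
  assumes "u \<in> Obj V" "v \<in> Obj V" "w \<in> Obj V"
  shows "ihom_curry u v w \<in> Arr V" "Dom V (ihom_curry u v w) = IHom V (u \<odot> v) w"
    "Cod V (ihom_curry u v w) = IHom V v (IHom V u w)"
  using assms by (simp_all add: ihom_curry_def)

lemma uncurry_ihom_curry:
  assumes [simp]: "u \<in> Obj V" "v \<in> Obj V" "w \<in> Obj V" "x \<in> Arr V" "Dom V x = z" "Cod V x = IHom V (u \<odot> v) w"
  shows "uncurry u (v \<odot> z) w (uncurry v z (IHom V u w) (x \<cdot> ihom_curry u v w))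
    = Assoc' u v z \<cdot> uncurry (u \<odot> v) z w x"
proof -
  have [simp]: "z \<in> Obj V" using dom_in[of x] by simp
  have "uncurry u (v \<odot> z) w (uncurry v z (IHom V u w) (x \<cdot> ihom_curry u v w))
      = (Id V u \<otimes> (Id V v \<otimes> x)) \<cdot> (Assoc' u v (IHom V (u \<odot> v) w) \<cdot> ev (u \<odot> v) w)"
    by (simp add: ihom_curry_def)
  also have "\<dots> = Assoc' u v z \<cdot> (((Id V u \<otimes> Id V v) \<otimes> x) \<cdot> ev (u \<odot> v) w)"
    by (subst assoc'_nat[THEN comp_reassoc]) auto
  finally show ?thesis
    by (simp add: uncurry_ev)
qed

lemma iso_ihom_curry [simp]:
  assumes [simp]: "u \<in> Obj V" "v \<in> Obj V" "w \<in> Obj V"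
  shows "iso (ihom_curry u v w)"
proof (rule isoI, rule inverse_arrowsI)
  let ?H = "IHom V (u \<odot> v) w" and ?K = "IHom V v (IHom V u w)"
  \<comment> \<open>The mate of evaluating twice: \<open>(u \<odot> v) \<odot> ?K\<close>,
    reassociated, goes to \<open>u \<odot> IHom V u w\<close> by \<open>ev v (IHom V u w)\<close>,
    and from there to \<open>w\<close>.\<close>
  let ?g = "Curry V (u \<odot> v) ?K w (Assoc V u v ?K \<cdot> ((Id V u \<otimes> ev v (IHom V u w)) \<cdot> ev u w))"
  show [simp]: "ihom_curry u v w \<in> Arr V" "?g \<in> Arr V" "Dom V ?g = Cod V (ihom_curry u v w)"
    "Cod V ?g = Dom V (ihom_curry u v w)"
    by auto
  show "?g \<cdot> ihom_curry u v w = Id V (Cod V (ihom_curry u v w))"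
  proof (rule uncurry_inject[of _ v "IHom V u w" _ ?K])
    show "uncurry v ?K (IHom V u w) (?g \<cdot> ihom_curry u v w)
        = uncurry v ?K (IHom V u w) (Id V (Cod V (ihom_curry u v w)))"
      by (rule uncurry_inject[of _ u w _ "v \<odot> ?K"])
        (auto simp: uncurry_ihom_curry uncurry_ev simp del: uncurry_comp)
  qed auto
  show "ihom_curry u v w \<cdot> ?g = Id V (Dom V (ihom_curry u v w))"
  proof (rule uncurry_inject[of _ "u \<odot> v" w _ ?H])
    have "uncurry (u \<odot> v) ?H w (ihom_curry u v w \<cdot> ?g)
        = (((Id V u \<otimes> Id V v) \<otimes> ihom_curry u v w) \<cdot> Assoc V u v ?K) \<cdot> ((Id V u \<otimes> ev v (IHom V u w)) \<cdot> ev u w)"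
      by simp
    also have "\<dots> = Assoc V u v ?H \<cdot> ((Id V u \<otimes> ((Id V v \<otimes> ihom_curry u v w) \<cdot> ev v (IHom V u w))) \<cdot> ev u w)"
      by (subst assoc_nat) auto
    also have "\<dots> = ev (u \<odot> v) w"
      by (simp add: uncurry_ev) (simp add: ihom_curry_def)
    finally show "uncurry (u \<odot> v) ?H w (ihom_curry u v w \<cdot> ?g)
        = uncurry (u \<odot> v) ?H w (Id V (Dom V (ihom_curry u v w)))" by simp
  qed auto
qed

text \<open>The tensorings of \<open>self\<close> and of the completion both have
  \<open>ihom_curry\<close> as adjunction isomorphism. This equation evaluates
  \<open>tens_up\<close> for both of them: up to \<open>self_arr\<close>, it undoes
  \<open>Curry\<close>.\<close>

lemma self_arr_ihom_curry:
  assumes [simp]: "u \<in> Obj V" "v \<in> Obj V" "f \<in> Arr V" "Dom V f = u \<odot> v" "Cod V f = w"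
  shows "self_arr v (IHom V u w) (Curry V u v w f) \<cdot> inverse (ihom_curry u v w) = self_arr (u \<odot> v) w f"
proof (rule iso_mono[of "ihom_curry u v w"])
  have w [simp]: "w \<in> Obj V" using cod_in[of f] by simp
  have "self_arr (u \<odot> v) w f \<cdot> ihom_curry u v w = self_arr v (IHom V u w) (Curry V u v w f)"
  proof (rule uncurry_inject[of _ v "IHom V u w" _ \<one>])
    show "uncurry v \<one> (IHom V u w) (self_arr (u \<odot> v) w f \<cdot> ihom_curry u v w)
      = uncurry v \<one> (IHom V u w) (self_arr v (IHom V u w) (Curry V u v w f))"
    proof (rule uncurry_inject[of _ u w _ "v \<odot> \<one>"])
      have "Assoc' u v \<one> \<cdot> RUnit V (u \<odot> v) = Id V u \<otimes> RUnit V v"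
        by (subst runit_tensor[symmetric]) auto
      then show "uncurry u (v \<odot> \<one>) w (uncurry v \<one> (IHom V u w) (self_arr (u \<odot> v) w f \<cdot> ihom_curry u v w))
        = uncurry u (v \<odot> \<one>) w (uncurry v \<one> (IHom V u w) (self_arr v (IHom V u w) (Curry V u v w f)))"
        by (simp add: uncurry_ihom_curry comp_reassoc[of "Assoc' u v \<one>" "RUnit V (u \<odot> v)"] del: uncurry_comp)
          simp
    qed auto
  qed auto
  then show "(self_arr v (IHom V u w) (Curry V u v w f) \<cdot> inverse (ihom_curry u v w)) \<cdot> ihom_curry u v w
      = self_arr (u \<odot> v) w f \<cdot> ihom_curry u v w"
    by simp
qed (use cod_in[of f] in auto)

end

section \<open>Tensored categories\<close>

locale tensored_category = closed_monoidal_category V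
  for V :: "('o, 'm, 'z) closed_moncat_scheme" (structure) +
  fixes C :: "('c, 'o, 'm) vcat" and T :: "('c, 'o, 'm) tensoring"
  assumes tensored: "tensored C T"

sublocale tensored_category \<subseteq> enriched_category V C
  by unfold_locales (use tensored in \<open>simp add: tensored_def\<close>)

context tensored_category
begin

abbreviation "\<eta> \<equiv> tens_unit C T"

lemma adjunction: "a \<in> vObj C \<Longrightarrow> v_adjunction self C (tFun T a) (representable C a) (tAdj T a)"
  using tensored by (simp add: tensored_def)

lemma tens_Obj [simp]: "\<lbrakk>a \<in> vObj C; v \<in> Obj V\<rbrakk> \<Longrightarrow> tens T a v \<in> vObj C"
  using adjunction[of a] by (simp add: v_adjunction_def v_functor_def)

lemma tFun_simps [simp]:
  assumes "a \<in> vObj C" "u \<in> Obj V" "v \<in> Obj V"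
  shows "fHom (tFun T a) u v \<in> Arr V" "Dom V (fHom (tFun T a) u v) = IHom V u v"
    "Cod V (fHom (tFun T a) u v) = vHom C (tens T a u) (tens T a v)"
  using adjunction[of a] assms by (simp_all add: v_adjunction_def v_functor_def hom_def)

lemma tAdj_simps [simp]:
  assumes "a \<in> vObj C" "v \<in> Obj V" "b \<in> vObj C"
  shows "iso (tAdj T a v b)" "Dom V (tAdj T a v b) = vHom C (tens T a v) b"
    "Cod V (tAdj T a v b) = IHom V v (vHom C a b)"
  using adjunction[of a] assms by (simp_all add: v_adjunction_def hom_def representable_def)

lemma representable_functor: "a \<in> vObj C \<Longrightarrow> v_functor C self (representable C a)"
  using adjunction[of a] by (simp add: v_adjunction_def)

lemma tens_unit_simps [simp]:
  assumes "a \<in> vObj C" "v \<in> Obj V"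
  shows "\<eta> a v \<in> Arr V" "Dom V (\<eta> a v) = v" "Cod V (\<eta> a v) = vHom C a (tens T a v)"
  using assms by (simp_all add: tens_unit_def tens_down_def)

lemma vId_tAdj:
  assumes "a \<in> vObj C" "v \<in> Obj V"
  shows "vId C (tens T a v) \<cdot> tAdj T a v (tens T a v) = self_arr v (vHom C a (tens T a v)) (\<eta> a v)"
  using assms by (simp add: self_arr_def tens_unit_def tens_down_def del: uncurry_comp)

text \<open>A Yoneda argument: naturality in \<open>b\<close>, applied to the identity of \<open>a \<triangleleft> v\<close>, shows that \<open>tAdj\<close> is the mate of
  composition with the unit.\<close>

lemma uncurry_tAdj:
  assumes [simp]: "a \<in> vObj C" "v \<in> Obj V" "b \<in> vObj C"
  shows "uncurry v (vHom C (tens T a v) b) (vHom C a b) (tAdj T a v b)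
    = gc a (tens T a v) b (\<eta> a v) (Id V (vHom C (tens T a v) b))"
proof -
  let ?t = "tens T a v"
  let ?H = "vHom C ?t b" and ?K = "vHom C a ?t" and ?L = "vHom C a b"
  let ?R = "fHom (representable C a) ?t b"
  have R: "?R = Curry V ?K ?H ?L (vComp C a ?t b)"
    by (simp add: representable_def)
  have "vComp C ?t ?t b \<cdot> tAdj T a v b = (tAdj T a v ?t \<otimes> ?R) \<cdot> vComp self v ?K ?L"
    using adjunction[of a] unfolding v_adjunction_def by (simp add: representable_def)
  then have "(vId C ?t \<otimes> Id V ?H) \<cdot> (vComp C ?t ?t b \<cdot> tAdj T a v b)
      = (vId C ?t \<otimes> Id V ?H) \<cdot> ((tAdj T a v ?t \<otimes> ?R) \<cdot> vComp self v ?K ?L)"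
    by simp
  then have "((vId C ?t \<otimes> Id V ?H) \<cdot> vComp C ?t ?t b) \<cdot> tAdj T a v b
      = ((vId C ?t \<cdot> tAdj T a v ?t) \<otimes> ?R) \<cdot> vComp self v ?K ?L"
    by (simp add: R)
  then have eq: "LUnit V ?H \<cdot> tAdj T a v b = (self_arr v ?K (\<eta> a v) \<otimes> ?R) \<cdot> vComp self v ?K ?L"
    by (simp add: vId_left vId_tAdj)
  have "(Id V v \<otimes> LUnit V ?H) \<cdot> uncurry v ?H ?L (tAdj T a v b) = uncurry v (\<one> \<odot> ?H) ?L (LUnit V ?H \<cdot> tAdj T a v b)"
    by simp
  also have "\<dots> = Assoc' v \<one> ?H \<cdot> (((RUnit V v \<cdot> \<eta> a v) \<otimes> Id V ?H) \<cdot> vComp C a ?t b)"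
    unfolding eq by (subst uncurry_vComp_self) (auto simp: R)
  also have "\<dots> = Assoc' v \<one> ?H \<cdot> ((RUnit V v \<otimes> Id V ?H) \<cdot> gc a ?t b (\<eta> a v) (Id V ?H))"
    by (simp add: gc_def)
  also have "\<dots> = (Id V v \<otimes> LUnit V ?H) \<cdot> gc a ?t b (\<eta> a v) (Id V ?H)"
    by (subst triangle[symmetric]) auto
  finally show ?thesis
    by (rule iso_epi[rotated -1]) (auto intro!: iso_tens iso_id)
qed

lemma uncurry_comp_tAdj:
  assumes [simp]: "a \<in> vObj C" "v \<in> Obj V" "b \<in> vObj C" "x \<in> Arr V" "Dom V x = w" "Cod V x = vHom C (tens T a v) b"
  shows "uncurry v w (vHom C a b) (x \<cdot> tAdj T a v b) = gc a (tens T a v) b (\<eta> a v) x"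
  using dom_in[of x] gc_comp_right[of "\<eta> a v" "Id V (vHom C (tens T a v) b)" a "tens T a v" b x]
  by (simp add: uncurry_tAdj)

text \<open>Uniqueness half of the universal property of \<open>a \<triangleleft> v\<close>, at
  every grade \<open>w\<close>: by \<open>uncurry_comp_tAdj\<close>, composing with
  \<open>\<eta>\<close> amounts to applying \<open>tAdj\<close> and then \<open>uncurry\<close>, and
  both are injective.\<close>

lemma gc_unit_inject:
  assumes "a \<in> vObj C" "v \<in> Obj V" "b \<in> vObj C" "x \<in> Arr V" "y \<in> Arr V"
    "Cod V x = vHom C (tens T a v) b" "Cod V y = vHom C (tens T a v) b" "Dom V x = w" "Dom V y = w"
    "gc a (tens T a v) b (\<eta> a v) x = gc a (tens T a v) b (\<eta> a v) y"
  shows "x = y"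
proof (rule iso_mono[of "tAdj T a v b"])
  show "x \<cdot> tAdj T a v b = y \<cdot> tAdj T a v b"
    by (rule uncurry_inject[of _ v "vHom C a b" _ w])
      (use assms in \<open>auto simp: uncurry_comp_tAdj simp del: uncurry_comp\<close>)
qed (use assms in auto)

lemma ract_unit_inject:
  assumes "a \<in> vObj C" "v \<in> Obj V" "b \<in> vObj C" "x \<in> Arr V" "y \<in> Arr V"
    "Cod V x = vHom C (tens T a v) b" "Cod V y = vHom C (tens T a v) b" "Dom V x = \<one>" "Dom V y = \<one>"
    "ract a (tens T a v) b (\<eta> a v) x = ract a (tens T a v) b (\<eta> a v) y"
  shows "x = y"
proof (rule gc_unit_inject)
  show "gc a (tens T a v) b (\<eta> a v) x = gc a (tens T a v) b (\<eta> a v) y"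
    by (rule iso_epi[of "RUnit' v"]) (use assms in \<open>auto simp: ract_def intro: iso_inverse\<close>)
qed (use assms in auto)

text \<open>Existence half of the universal property: the morphism of grade \<open>w\<close> out of
  \<open>a \<triangleleft> v\<close> through which \<open>z\<close>, of grade
  \<open>v \<odot> w\<close>, factors.\<close>

definition lift :: "'c \<Rightarrow> 'o \<Rightarrow> 'c \<Rightarrow> 'o \<Rightarrow> 'm \<Rightarrow> 'm" where
  "lift a v b w z = Curry V v w (vHom C a b) z \<cdot> inverse (tAdj T a v b)"

lemma lift_simps [simp]:
  assumes [simp]: "a \<in> vObj C" "v \<in> Obj V" "b \<in> vObj C" "w \<in> Obj V" "z \<in> Arr V" "Dom V z = v \<odot> w"
    "Cod V z = vHom C a b"
  shows "lift a v b w z \<in> Arr V" "Dom V (lift a v b w z) = w" "Cod V (lift a v b w z) = vHom C (tens T a v) b"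
    "gc a (tens T a v) b (\<eta> a v) (lift a v b w z) = z"
proof -
  show 1: "lift a v b w z \<in> Arr V" "Dom V (lift a v b w z) = w" "Cod V (lift a v b w z) = vHom C (tens T a v) b"
    by (simp_all add: lift_def)
  have "gc a (tens T a v) b (\<eta> a v) (lift a v b w z) = uncurry v w (vHom C a b) (lift a v b w z \<cdot> tAdj T a v b)"
    using 1 by (simp add: uncurry_comp_tAdj del: uncurry_comp)
  then show "gc a (tens T a v) b (\<eta> a v) (lift a v b w z) = z"
    by (simp add: lift_def)
qed

lemma tens_down_eq:
  assumes "a \<in> vObj C" "v \<in> Obj V" "b \<in> vObj C" "f \<in> Arr V" "Dom V f = \<one>" "Cod V f = vHom C (tens T a v) b"
  shows "tens_down C T a v b f = ract a (tens T a v) b (\<eta> a v) f"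
  using assms by (simp add: tens_down_def ract_def uncurry_comp_tAdj del: uncurry_comp)

lemma tens_up_simps [simp]:
  assumes [simp]: "a \<in> vObj C" "v \<in> Obj V" "b \<in> vObj C" "g \<in> Arr V" "Dom V g = v" "Cod V g = vHom C a b"
  shows "tens_up C T a v b g \<in> Arr V" "Dom V (tens_up C T a v b g) = \<one>"
    "Cod V (tens_up C T a v b g) = vHom C (tens T a v) b"
    "ract a (tens T a v) b (\<eta> a v) (tens_up C T a v b g) = g"
proof -
  have "tens_up C T a v b g = lift a v b \<one> (RUnit V v \<cdot> g)"
    by (simp add: tens_up_def lift_def self_arr_def)
  then show "tens_up C T a v b g \<in> Arr V" "Dom V (tens_up C T a v b g) = \<one>"
    "Cod V (tens_up C T a v b g) = vHom C (tens T a v) b"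
    "ract a (tens T a v) b (\<eta> a v) (tens_up C T a v b g) = g"
    by (simp_all add: ract_def)
qed

text \<open>The action of \<open>tFun T a\<close> on hom objects is tied to \<open>\<eta>\<close> by
  naturality of \<open>tAdj\<close> in the contravariant variable. Evaluated at
  \<open>self_arr u v g\<close> and the identity of \<open>a \<triangleleft> v\<close>, this
  naturality gives the last equation.\<close>

lemma tens_id_arr_simps [simp]:
  assumes [simp]: "a \<in> vObj C" "g \<in> Arr V" "Dom V g = u" "Cod V g = v"
  shows "tens_id_arr T a u v g \<in> Arr V" "Dom V (tens_id_arr T a u v g) = \<one>"
    "Cod V (tens_id_arr T a u v g) = vHom C (tens T a u) (tens T a v)"
    "ract a (tens T a u) (tens T a v) (\<eta> a u) (tens_id_arr T a u v g) = g \<cdot> \<eta> a v"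
proof -
  have [simp]: "u \<in> Obj V" "v \<in> Obj V" using dom_in[of g] cod_in[of g] by auto
  let ?t = "tens T a v" and ?s = "tens T a u"
  let ?g = "tens_id_arr T a u v g"
  show [simp]: "?g \<in> Arr V" "Dom V ?g = \<one>" "Cod V ?g = vHom C ?s ?t"
    by (simp_all add: tens_id_arr_def)
  have "(fHom (tFun T a) u v \<otimes> Id V (vHom C ?t ?t)) \<cdot> vComp C ?s ?t ?t \<cdot> tAdj T a u ?t
      = (Id V (IHom V u v) \<otimes> tAdj T a v ?t) \<cdot> vComp self u v (vHom C a ?t)"
    using adjunction[of a] unfolding v_adjunction_def by (simp add: representable_def del: comp_assoc')
  then have "(fHom (tFun T a) u v \<otimes> Id V (vHom C ?t ?t)) \<cdot> (vComp C ?s ?t ?t \<cdot> tAdj T a u ?t)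
      = (Id V (IHom V u v) \<otimes> tAdj T a v ?t) \<cdot> vComp self u v (vHom C a ?t)"
    by simp
  then have "(self_arr u v g \<otimes> vId C ?t) \<cdot> ((fHom (tFun T a) u v \<otimes> Id V (vHom C ?t ?t)) \<cdot> (vComp C ?s ?t ?t \<cdot> tAdj T a u ?t))
      = (self_arr u v g \<otimes> vId C ?t) \<cdot> ((Id V (IHom V u v) \<otimes> tAdj T a v ?t) \<cdot> vComp self u v (vHom C a ?t))"
    by simp
  then have "gc ?s ?t ?t ?g (vId C ?t) \<cdot> tAdj T a u ?t
      = (self_arr u v g \<otimes> self_arr v (vHom C a ?t) (\<eta> a v)) \<cdot> vComp self u v (vHom C a ?t)"
    by (simp add: gc_def tens_id_arr_def vId_tAdj)
  then have "RUnit' \<one> \<cdot> (gc ?s ?t ?t ?g (vId C ?t) \<cdot> tAdj T a u ?t)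
      = ucomp self u v (vHom C a ?t) (self_arr u v g) (self_arr v (vHom C a ?t) (\<eta> a v))"
    by (simp add: ucomp_def lunit_unit)
  then have "?g \<cdot> tAdj T a u ?t = self_arr u (vHom C a ?t) (g \<cdot> \<eta> a v)"
    by (simp add: gc_vId_right ucomp_self_arr)
  then have "tens_down C T a u ?t ?g = g \<cdot> \<eta> a v"
    by (simp add: tens_down_def del: uncurry_comp)
  then show "ract a ?s ?t (\<eta> a u) ?g = g \<cdot> \<eta> a v"
    by (simp add: tens_down_eq)
qed

lemma tens_counit_simps [simp]:
  assumes "a \<in> vObj C" "b \<in> vObj C"
  shows "tens_counit C T a b \<in> Arr V" "Dom V (tens_counit C T a b) = \<one>"
    "Cod V (tens_counit C T a b) = vHom C (tens T a (vHom C a b)) b"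
    "ract a (tens T a (vHom C a b)) b (\<eta> a (vHom C a b)) (tens_counit C T a b) = Id V (vHom C a b)"
  using assms by (simp_all add: tens_counit_def)

lemma tens_arr_id_simps [simp]:
  assumes "a \<in> vObj C" "b \<in> vObj C" "v \<in> Obj V" "f \<in> Arr V" "Dom V f = \<one>" "Cod V f = vHom C a b"
  shows "tens_arr_id C T a b f v \<in> Arr V" "Dom V (tens_arr_id C T a b f v) = \<one>"
    "Cod V (tens_arr_id C T a b f v) = vHom C (tens T a v) (tens T b v)"
    "ract a (tens T a v) (tens T b v) (\<eta> a v) (tens_arr_id C T a b f v) = lact a b (tens T b v) f (\<eta> b v)"
proof -
  have "tens_arr_id C T a b f v = tens_up C T a v (tens T b v) (lact a b (tens T b v) f (\<eta> b v))"
    using assms by (simp add: tens_arr_id_def lact_def gc_def)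
  then show "tens_arr_id C T a b f v \<in> Arr V" "Dom V (tens_arr_id C T a b f v) = \<one>"
    "Cod V (tens_arr_id C T a b f v) = vHom C (tens T a v) (tens T b v)"
    "ract a (tens T a v) (tens T b v) (\<eta> a v) (tens_arr_id C T a b f v) = lact a b (tens T b v) f (\<eta> b v)"
    using assms by auto
qed

lemma tens_assoc_simps [simp]:
  assumes "a \<in> vObj C" "u \<in> Obj V" "v \<in> Obj V"
  shows "tens_assoc C T a u v \<in> Arr V" "Dom V (tens_assoc C T a u v) = \<one>"
    "Cod V (tens_assoc C T a u v) = vHom C (tens T a (u \<odot> v)) (tens T (tens T a u) v)"
    "ract a (tens T a (u \<odot> v)) (tens T (tens T a u) v) (\<eta> a (u \<odot> v)) (tens_assoc C T a u v)
      = gc a (tens T a u) (tens T (tens T a u) v) (\<eta> a u) (\<eta> (tens T a u) v)"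
  using assms by (simp_all add: tens_assoc_def flip: gc_def)

text \<open>Both objects represent morphisms out of \<open>a\<close> of grade
  \<open>u \<odot> v\<close>: one directly, the other in two steps, first \<open>u\<close> and then
  \<open>v\<close>. Accordingly uniqueness is used once for one composite and twice for the
  other.\<close>

lemma u_iso_tens_assoc:
  assumes [simp]: "a \<in> vObj C" "u \<in> Obj V" "v \<in> Obj V"
  shows "u_iso C (tens T a (u \<odot> v)) (tens T (tens T a u) v) (tens_assoc C T a u v)"
proof -
  let ?t = "tens T a (u \<odot> v)" and ?b = "tens T a u"
  let ?s = "tens T ?b v"
  let ?\<alpha> = "tens_assoc C T a u v"
  \<comment> \<open>The unit \<open>\<eta> a (u \<odot> v)\<close> is factored through
    \<open>\<eta> a u\<close>, and the resulting \<open>y\<close> of grade \<open>v\<close> through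
    \<open>\<eta> ?b v\<close>; this produces the inverse \<open>\<beta>\<close>.\<close>
  define y where "y = lift a u ?t v (\<eta> a (u \<odot> v))"
  have y [simp]: "y \<in> Arr V" "Dom V y = v" "Cod V y = vHom C ?b ?t" "gc a ?b ?t (\<eta> a u) y = \<eta> a (u \<odot> v)"
    by (simp_all add: y_def)
  define \<beta> where "\<beta> = tens_up C T ?b v ?t y"
  have \<beta> [simp]: "\<beta> \<in> Arr V" "Dom V \<beta> = \<one>" "Cod V \<beta> = vHom C ?s ?t" "ract ?b ?s ?t (\<eta> ?b v) \<beta> = y"
    by (simp_all add: \<beta>_def)
  have 1: "ucomp C ?t ?s ?t ?\<alpha> \<beta> = vId C ?t"
  proof (rule ract_unit_inject[of a "u \<odot> v" ?t])
    show "ract a ?t ?t (\<eta> a (u \<odot> v)) (ucomp C ?t ?s ?t ?\<alpha> \<beta>) = ract a ?t ?t (\<eta> a (u \<odot> v)) (vId C ?t)"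
      by (simp add: ract_ract[symmetric]) (simp add: gc_ract[symmetric])
  qed auto
  have 2: "ucomp C ?s ?t ?s \<beta> ?\<alpha> = vId C ?s"
  proof (rule ract_unit_inject[of ?b v ?s])
    show "ract ?b ?s ?s (\<eta> ?b v) (ucomp C ?s ?t ?s \<beta> ?\<alpha>) = ract ?b ?s ?s (\<eta> ?b v) (vId C ?s)"
    proof (rule gc_unit_inject[of a u ?s _ _ v])
      show "gc a ?b ?s (\<eta> a u) (ract ?b ?s ?s (\<eta> ?b v) (ucomp C ?s ?t ?s \<beta> ?\<alpha>))
        = gc a ?b ?s (\<eta> a u) (ract ?b ?s ?s (\<eta> ?b v) (vId C ?s))"
        by (simp add: ract_ract[symmetric]) (simp add: gc_ract)
    qed auto
  qed auto
  show ?thesis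
    unfolding u_iso_def u_inverse_arrows_def uhom_def hom_def using 1 2 by (intro exI[of _ \<beta>]) auto
qed

text \<open>The canonical morphism \<open>C(a, b) \<odot> v \<rightarrow> C(a, b \<triangleleft> v)\<close>; all four conditions of the theorem amount to its
  invertibility.\<close>

definition strength :: "'c \<Rightarrow> 'c \<Rightarrow> 'o \<Rightarrow> 'm" where
  "strength a b v = gc a b (tens T b v) (Id V (vHom C a b)) (\<eta> b v)"

lemma strength_simps [simp]:
  assumes "a \<in> vObj C" "b \<in> vObj C" "v \<in> Obj V"
  shows "strength a b v \<in> Arr V" "Dom V (strength a b v) = vHom C a b \<odot> v"
    "Cod V (strength a b v) = vHom C a (tens T b v)"
  using assms by (simp_all add: strength_def)

lemma tens_strength:
  assumes "a \<in> vObj C" "b \<in> vObj C" "v \<in> Obj V" "f \<in> Arr V" "Cod V f = vHom C a b" "g \<in> Arr V" "Cod V g = v"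
  shows "(f \<otimes> g) \<cdot> strength a b v = gc a b (tens T b v) f (g \<cdot> \<eta> b v)"
  using assms by (simp add: strength_def gc_def)

text \<open>By \<open>curry_nat\<close>, \<open>\<eta> c v\<close> followed by the curried
  \<open>vComp\<close> is the curried \<open>strength\<close>; \<open>tens_up\<close> in
  \<open>self\<close> undoes the currying.\<close>

lemma tens_mu_representable:
  assumes [simp]: "a \<in> vObj C" "c \<in> vObj C" "v \<in> Obj V"
  shows "tens_mu C T self self_tensoring (representable C a) c v
    = self_arr (vHom C a c \<odot> v) (vHom C a (tens T c v)) (strength a c v)"
proof -
  let ?K = "vHom C a c" and ?L = "vHom C a (tens T c v)" and ?H = "vHom C c (tens T c v)"
  have "Curry V ?K v ?L (strength a c v) = \<eta> c v \<cdot> Curry V ?K ?H ?L (vComp C a c (tens T c v))"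
    by (subst curry_nat) (auto simp: strength_def gc_def)
  then show ?thesis
    using self_arr_ihom_curry[of ?K v "strength a c v" ?L]
    by (simp add: tens_mu_def tens_up_def self_tensoring_def representable_def)
qed

lemma representables_tensored_iff:
  "(\<forall>a\<in>vObj C. tensored_functor C T self self_tensoring (representable C a))
    \<longleftrightarrow> (\<forall>a\<in>vObj C. \<forall>c\<in>vObj C. \<forall>v\<in>Obj V. iso (strength a c v))"
proof -
  have "u_iso self (tens self_tensoring (fObj (representable C a) c) v) (fObj (representable C a) (tens T c v))
      (tens_mu C T self self_tensoring (representable C a) c v) \<longleftrightarrow> iso (strength a c v)"
    if "a \<in> vObj C" "c \<in> vObj C" "v \<in> Obj V" for a c v
    using that by (simp add: tens_mu_representable u_iso_self_arr)
      (simp add: u_iso_self_arr self_tensoring_def representable_def)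
  then show ?thesis
    by (auto simp: tensored_functor_def representable_functor)
qed

end

section \<open>The completion\<close>

locale enriched_over_closed = closed_monoidal_category V + enriched_category V C
  for V :: "('o, 'm, 'z) closed_moncat_scheme" (structure) and C :: "('c, 'o, 'm) vcat"
begin

text \<open>Multiplication of a many-object monad with parts
  \<open>z \<mapsto> C(a, b) \<odot> z\<close> and unit
  \<open>LUnit' z \<cdot> (vId C a \<otimes> Id V z)\<close>; the completion is its Kleisli
  construction. The monad laws are \<open>act_assoc\<close> and \<open>act_unit\<close>.\<close>

definition act :: "'c \<Rightarrow> 'c \<Rightarrow> 'c \<Rightarrow> 'o \<Rightarrow> 'm" where
  "act a b c z = Assoc' (vHom C a b) (vHom C b c) z \<cdot> (vComp C a b c \<otimes> Id V z)"

lemma act_simps [simp]: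
  assumes "a \<in> vObj C" "b \<in> vObj C" "c \<in> vObj C" "z \<in> Obj V"
  shows "act a b c z \<in> Arr V" "Dom V (act a b c z) = vHom C a b \<odot> (vHom C b c \<odot> z)"
    "Cod V (act a b c z) = vHom C a c \<odot> z"
  using assms by (simp_all add: act_def)

text \<open>This is \<open>vComp_assoc\<close> tensored with \<open>z\<close>. Both sides are
  precomposed with associators so as to start from the fully left-bracketed product, where the
  pentagon applies.\<close>

lemma act_assoc:
  assumes [simp]: "a \<in> vObj C" "b \<in> vObj C" "c \<in> vObj C" "d \<in> vObj C" "z \<in> Obj V"
  shows "(Id V (vHom C a b) \<otimes> act b c d z) \<cdot> act a b d z = act a b c (vHom C c d \<odot> z) \<cdot> act a c d z"
proof (rule iso_epi[of "Assoc V (vHom C a b \<odot> vHom C b c) (vHom C c d) z \<cdot> Assoc V (vHom C a b) (vHom C b c) (vHom C c d \<odot> z)"])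
  let ?K = "vHom C a b" and ?L = "vHom C b c" and ?N = "vHom C c d"
  let ?p = "Assoc V (?K \<odot> ?L) ?N z \<cdot> Assoc V ?K ?L (?N \<odot> z)"
  have "?p \<cdot> (act a b c (?N \<odot> z) \<cdot> act a c d z)
      = Assoc V (?K \<odot> ?L) ?N z \<cdot> (((vComp C a b c \<otimes> (Id V ?N \<otimes> Id V z)) \<cdot> Assoc' (vHom C a c) ?N z)
          \<cdot> (vComp C a c d \<otimes> Id V z))"
    by (simp add: act_def)
  also have "\<dots> = (((vComp C a b c \<otimes> Id V ?N) \<cdot> vComp C a c d) \<otimes> Id V z)"
    by (subst assoc'_nat) auto
  also have "\<dots> = (Assoc V ?K ?L ?N \<otimes> Id V z)
      \<cdot> (((Id V ?K \<otimes> vComp C b c d) \<otimes> Id V z) \<cdot> (vComp C a b d \<otimes> Id V z))"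
    by (subst vComp_assoc) auto
  also have "((Id V ?K \<otimes> vComp C b c d) \<otimes> Id V z) \<cdot> (vComp C a b d \<otimes> Id V z)
      = (((Id V ?K \<otimes> vComp C b c d) \<otimes> Id V z) \<cdot> Assoc V ?K (vHom C b d) z) \<cdot> act a b d z"
    by (simp add: act_def)
  also have "\<dots> = Assoc V ?K (?L \<odot> ?N) z \<cdot> ((Id V ?K \<otimes> (vComp C b c d \<otimes> Id V z)) \<cdot> act a b d z)"
    by (subst assoc_nat) auto
  also have "(Id V ?K \<otimes> (vComp C b c d \<otimes> Id V z)) \<cdot> act a b d z
      = (Id V ?K \<otimes> Assoc V ?L ?N z) \<cdot> ((Id V ?K \<otimes> act b c d z) \<cdot> act a b d z)"
    by (simp add: act_def[of b c d])
  also have "(Assoc V ?K ?L ?N \<otimes> Id V z) \<cdot> (Assoc V ?K (?L \<odot> ?N) z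
        \<cdot> ((Id V ?K \<otimes> Assoc V ?L ?N z) \<cdot> ((Id V ?K \<otimes> act b c d z) \<cdot> act a b d z)))
      = ((Assoc V ?K ?L ?N \<otimes> Id V z) \<cdot> (Assoc V ?K (?L \<odot> ?N) z
        \<cdot> (Id V ?K \<otimes> Assoc V ?L ?N z))) \<cdot> ((Id V ?K \<otimes> act b c d z) \<cdot> act a b d z)"
    by simp
  also have "\<dots> = ?p \<cdot> ((Id V ?K \<otimes> act b c d z) \<cdot> act a b d z)"
    by (subst pentagon') auto
  finally show "?p \<cdot> ((Id V ?K \<otimes> act b c d z) \<cdot> act a b d z) = ?p \<cdot> (act a b c (?N \<odot> z) \<cdot> act a c d z)"
    by (rule sym)
qed (auto intro!: iso_comp)

lemma act_unit:
  assumes [simp]: "a \<in> vObj C" "b \<in> vObj C" "z \<in> Obj V"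
  shows "LUnit' (vHom C a b \<odot> z) \<cdot> ((vId C a \<otimes> Id V (vHom C a b \<odot> z)) \<cdot> act a a b z) = Id V (vHom C a b \<odot> z)"
    "(Id V (vHom C a b) \<otimes> (LUnit' z \<cdot> (vId C b \<otimes> Id V z))) \<cdot> act a b b z = Id V (vHom C a b \<odot> z)"
proof -
  let ?K = "vHom C a b"
  have "(vId C a \<otimes> Id V (?K \<odot> z)) \<cdot> act a a b z
      = ((vId C a \<otimes> (Id V ?K \<otimes> Id V z)) \<cdot> Assoc' (vHom C a a) ?K z) \<cdot> (vComp C a a b \<otimes> Id V z)"
    by (simp add: act_def)
  also have "\<dots> = Assoc' \<one> ?K z \<cdot> (((vId C a \<otimes> Id V ?K) \<cdot> vComp C a a b) \<otimes> Id V z)"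
    by (subst assoc'_nat) auto
  also have "\<dots> = Assoc' \<one> ?K z \<cdot> (Assoc V \<one> ?K z \<cdot> LUnit V (?K \<odot> z))"
    by (subst vId_left, simp, simp, subst lunit_tensor) auto
  finally show "LUnit' (?K \<odot> z) \<cdot> ((vId C a \<otimes> Id V (?K \<odot> z)) \<cdot> act a a b z) = Id V (?K \<odot> z)"
    by simp
  have "(Id V ?K \<otimes> (LUnit' z \<cdot> (vId C b \<otimes> Id V z))) \<cdot> act a b b z
      = (Id V ?K \<otimes> LUnit' z) \<cdot> (((Id V ?K \<otimes> (vId C b \<otimes> Id V z)) \<cdot> Assoc' ?K (vHom C b b) z) \<cdot> (vComp C a b b \<otimes> Id V z))"
    by (simp add: act_def)
  also have "\<dots> = (Id V ?K \<otimes> LUnit' z) \<cdot> (Assoc' ?K \<one> z \<cdot> (((Id V ?K \<otimes> vId C b) \<cdot> vComp C a b b) \<otimes> Id V z))"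
    by (subst assoc'_nat) auto
  also have "\<dots> = Id V (?K \<odot> z)"
    by (subst vId_right, simp, simp, subst triangle') auto
  finally show "(Id V ?K \<otimes> (LUnit' z \<cdot> (vId C b \<otimes> Id V z))) \<cdot> act a b b z = Id V (?K \<odot> z)" .
qed

text \<open>For a mate \<open>f : v \<odot> q \<rightarrow> C(b, c) \<odot> w\<close> of a graded morphism of the completion, \<open>ext a b c v q w f\<close> is the
  map \<open>(C(a, b) \<odot> v) \<odot> q \<rightarrow> C(a, c) \<odot> w\<close> by which composition with that morphism acts on mates.\<close>

definition ext :: "'c \<Rightarrow> 'c \<Rightarrow> 'c \<Rightarrow> 'o \<Rightarrow> 'o \<Rightarrow> 'o \<Rightarrow> 'm \<Rightarrow> 'm" where
  "ext a b c v q w f = Assoc V (vHom C a b) v q \<cdot> ((Id V (vHom C a b) \<otimes> f) \<cdot> act a b c w)"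

lemma ext_simps [simp]:
  assumes "a \<in> vObj C" "b \<in> vObj C" "c \<in> vObj C" "v \<in> Obj V" "q \<in> Obj V" "w \<in> Obj V"
    "f \<in> Arr V" "Dom V f = v \<odot> q" "Cod V f = vHom C b c \<odot> w"
  shows "ext a b c v q w f \<in> Arr V" "Dom V (ext a b c v q w f) = (vHom C a b \<odot> v) \<odot> q"
    "Cod V (ext a b c v q w f) = vHom C a c \<odot> w"
  using assms by (simp_all add: ext_def)

text \<open>The pentagon with some associators moved across, in the three shapes that occur in the
  associativity proof of the completion.\<close>

lemma pentagon_inv:
  assumes [simp]: "u \<in> Obj V" "v \<in> Obj V" "w \<in> Obj V" "x \<in> Obj V"
  shows "(Assoc' u v w \<otimes> Id V x) \<cdot> (Assoc V (u \<odot> v) w x \<cdot> Assoc V u v (w \<odot> x))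
      = Assoc V u (v \<odot> w) x \<cdot> (Id V u \<otimes> Assoc V v w x)"
    "(Assoc V u v w \<otimes> Id V x) \<cdot> Assoc V u (v \<odot> w) x
      = Assoc V (u \<odot> v) w x \<cdot> (Assoc V u v (w \<odot> x) \<cdot> (Id V u \<otimes> Assoc' v w x))"
    "Assoc' u (v \<odot> w) x \<cdot> ((Assoc' u v w \<otimes> Id V x) \<cdot> Assoc V (u \<odot> v) w x)
      = (Id V u \<otimes> Assoc V v w x) \<cdot> Assoc' u v (w \<odot> x)"
proof -
  show 1: "(Assoc' u v w \<otimes> Id V x) \<cdot> (Assoc V (u \<odot> v) w x \<cdot> Assoc V u v (w \<odot> x))
      = Assoc V u (v \<odot> w) x \<cdot> (Id V u \<otimes> Assoc V v w x)"
    by (subst pentagon'[symmetric]) auto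
  have "Assoc V (u \<odot> v) w x \<cdot> (Assoc V u v (w \<odot> x) \<cdot> (Id V u \<otimes> Assoc' v w x))
      = ((Assoc V u v w \<otimes> Id V x) \<cdot> (Assoc V u (v \<odot> w) x \<cdot> (Id V u \<otimes> Assoc V v w x))) \<cdot> (Id V u \<otimes> Assoc' v w x)"
    by (subst pentagon') auto
  then show "(Assoc V u v w \<otimes> Id V x) \<cdot> Assoc V u (v \<odot> w) x
      = Assoc V (u \<odot> v) w x \<cdot> (Assoc V u v (w \<odot> x) \<cdot> (Id V u \<otimes> Assoc' v w x))"
    by simp
  have "Assoc' u (v \<odot> w) x \<cdot> (((Assoc' u v w \<otimes> Id V x)
        \<cdot> (Assoc V (u \<odot> v) w x \<cdot> Assoc V u v (w \<odot> x))) \<cdot> Assoc' u v (w \<odot> x))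
      = (Id V u \<otimes> Assoc V v w x) \<cdot> Assoc' u v (w \<odot> x)"
    unfolding 1 by simp
  then show "Assoc' u (v \<odot> w) x \<cdot> ((Assoc' u v w \<otimes> Id V x) \<cdot> Assoc V (u \<odot> v) w x)
      = (Id V u \<otimes> Assoc V v w x) \<cdot> Assoc' u v (w \<odot> x)"
    by simp
qed

text \<open>Associativity of Kleisli extension: the argument of \<open>ext\<close> on the right is
  the mate of the composite of \<open>y\<close> and \<open>z\<close>. Fact 1 is
  \<open>act_assoc\<close> with \<open>z\<close> moved past the first two hom objects; the rest
  transports it through associators.\<close>

lemma ext_ext:
  assumes [simp]: "a \<in> vObj C" "b \<in> vObj C" "c \<in> vObj C" "d \<in> vObj C" "v \<in> Obj V" "q \<in> Obj V" "w \<in> Obj V"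
    "r \<in> Obj V" "t \<in> Obj V" "y \<in> Arr V" "Dom V y = v \<odot> q" "Cod V y = vHom C b c \<odot> w"
    "z \<in> Arr V" "Dom V z = w \<odot> r" "Cod V z = vHom C c d \<odot> t"
  shows "(ext a b c v q w y \<otimes> Id V r) \<cdot> ext a c d w r t z
    = Assoc V (vHom C a b \<odot> v) q r
        \<cdot> ext a b d v (q \<odot> r) t (Assoc' v q r \<cdot> ((y \<otimes> Id V r) \<cdot> ext b c d w r t z))"
proof -
  let ?K = "vHom C a b" and ?L = "vHom C b c" and ?N = "vHom C c d" and ?M = "vComp C a b c"
  have "(?M \<otimes> Id V (w \<odot> r)) \<cdot> ((Id V (vHom C a c) \<otimes> z) \<cdot> act a c d t)
      = (Id V (?K \<odot> ?L) \<otimes> z) \<cdot> (Assoc V ?K ?L (?N \<odot> t) \<cdot> (act a b c (?N \<odot> t) \<cdot> act a c d t))"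
    by (simp add: act_def[of a b c])
  also have "\<dots> = (((Id V ?K \<otimes> Id V ?L) \<otimes> z) \<cdot> Assoc V ?K ?L (?N \<odot> t))
      \<cdot> ((Id V ?K \<otimes> act b c d t) \<cdot> act a b d t)"
    by (subst act_assoc[symmetric]) auto
  also have "\<dots> = Assoc V ?K ?L (w \<odot> r) \<cdot> ((Id V ?K \<otimes> (Id V ?L \<otimes> z)) \<cdot> ((Id V ?K \<otimes> act b c d t) \<cdot> act a b d t))"
    by (subst assoc_nat) auto
  finally have 1: "(?M \<otimes> Id V (w \<odot> r)) \<cdot> ((Id V (vHom C a c) \<otimes> z) \<cdot> act a c d t)
      = Assoc V ?K ?L (w \<odot> r) \<cdot> ((Id V ?K \<otimes> ((Id V ?L \<otimes> z) \<cdot> act b c d t)) \<cdot> act a b d t)"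
    by simp
  let ?R = "(Id V ?K \<otimes> ((Id V ?L \<otimes> z) \<cdot> act b c d t)) \<cdot> act a b d t"
  have R [simp]: "?R \<in> Arr V" "Dom V ?R = ?K \<odot> (?L \<odot> (w \<odot> r))" "Cod V ?R = vHom C a d \<odot> t"
    by auto
  have "(act a b c w \<otimes> Id V r) \<cdot> ext a c d w r t z
      = (Assoc' ?K ?L w \<otimes> Id V r) \<cdot> ((((?M \<otimes> Id V w) \<otimes> Id V r) \<cdot> Assoc V (vHom C a c) w r)
          \<cdot> ((Id V (vHom C a c) \<otimes> z) \<cdot> act a c d t))"
    by (simp add: act_def[of a b c] ext_def)
  also have "\<dots> = (Assoc' ?K ?L w \<otimes> Id V r) \<cdot> (Assoc V (?K \<odot> ?L) w r
      \<cdot> ((?M \<otimes> Id V (w \<odot> r)) \<cdot> ((Id V (vHom C a c) \<otimes> z) \<cdot> act a c d t)))"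
    by (subst assoc_nat) auto
  also have "\<dots> = ((Assoc' ?K ?L w \<otimes> Id V r) \<cdot> (Assoc V (?K \<odot> ?L) w r \<cdot> Assoc V ?K ?L (w \<odot> r))) \<cdot> ?R"
    unfolding 1 by simp
  also have "\<dots> = Assoc V ?K (?L \<odot> w) r \<cdot> ((Id V ?K \<otimes> Assoc V ?L w r) \<cdot> ?R)"
    by (subst pentagon_inv(1)) auto
  also have "(Id V ?K \<otimes> Assoc V ?L w r) \<cdot> ?R = (Id V ?K \<otimes> ext b c d w r t z) \<cdot> act a b d t"
    by (simp add: ext_def)
  finally have 2: "(act a b c w \<otimes> Id V r) \<cdot> ext a c d w r t z
      = Assoc V ?K (?L \<odot> w) r \<cdot> ((Id V ?K \<otimes> ext b c d w r t z) \<cdot> act a b d t)" .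
  have "(ext a b c v q w y \<otimes> Id V r) \<cdot> ext a c d w r t z
      = (Assoc V ?K v q \<otimes> Id V r) \<cdot> (((Id V ?K \<otimes> y) \<otimes> Id V r) \<cdot> ((act a b c w \<otimes> Id V r) \<cdot> ext a c d w r t z))"
    by (simp add: ext_def[of a b c])
  also have "\<dots> = (Assoc V ?K v q \<otimes> Id V r) \<cdot> ((((Id V ?K \<otimes> y) \<otimes> Id V r) \<cdot> Assoc V ?K (?L \<odot> w) r)
      \<cdot> ((Id V ?K \<otimes> ext b c d w r t z) \<cdot> act a b d t))"
    unfolding 2 by simp
  also have "\<dots> = ((Assoc V ?K v q \<otimes> Id V r) \<cdot> Assoc V ?K (v \<odot> q) r)
      \<cdot> ((Id V ?K \<otimes> (y \<otimes> Id V r)) \<cdot> ((Id V ?K \<otimes> ext b c d w r t z) \<cdot> act a b d t))"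
    by (subst assoc_nat) auto
  also have "\<dots> = Assoc V (?K \<odot> v) q r \<cdot> (Assoc V ?K v (q \<odot> r) \<cdot> ((Id V ?K \<otimes> Assoc' v q r)
      \<cdot> ((Id V ?K \<otimes> (y \<otimes> Id V r)) \<cdot> ((Id V ?K \<otimes> ext b c d w r t z) \<cdot> act a b d t))))"
    by (subst pentagon_inv(2)) auto
  finally show ?thesis
    by (simp add: ext_def[of a b d])
qed

section \<open>Composition and identities of the completion\<close>

abbreviation "Cbar \<equiv> completion C"

lemma completion_sel [simp]:
  "vObj Cbar = vObj C \<times> Obj V" "vHom Cbar (a, u) (b, v) = IHom V u (vHom C a b \<odot> v)"
  by (simp_all add: completion_def)

lemma completion_vId: "vId Cbar (a, u) = self_arr u (vHom C a a \<odot> u) (LUnit' u \<cdot> (vId C a \<otimes> Id V u))"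
  if "a \<in> vObj C" "u \<in> Obj V"
  using that by (simp add: completion_def self_arr_def)

lemma completion_vComp:
  assumes "a \<in> vObj C" "b \<in> vObj C" "c \<in> vObj C" "u \<in> Obj V" "v \<in> Obj V" "w \<in> Obj V"
  shows "vComp Cbar (a, u) (b, v) (c, w) \<in> Arr V"
    "Dom V (vComp Cbar (a, u) (b, v) (c, w)) = IHom V u (vHom C a b \<odot> v) \<odot> IHom V v (vHom C b c \<odot> w)"
    "Cod V (vComp Cbar (a, u) (b, v) (c, w)) = IHom V u (vHom C a c \<odot> w)"
  using assms by (simp_all add: completion_def Let_def)

text \<open>On mates, composition is Kleisli composition: the mate of \<open>x\<close> followed by
  the extension of the mate of \<open>y\<close>. Later arguments use this in place of the
  definition.\<close>

lemma uncurry_completion_vComp: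
  assumes [simp]: "a \<in> vObj C" "b \<in> vObj C" "c \<in> vObj C" "u \<in> Obj V" "v \<in> Obj V" "w \<in> Obj V"
    "x \<in> Arr V" "y \<in> Arr V" "p \<in> Obj V" "q \<in> Obj V" "Dom V x = p" "Cod V x = IHom V u (vHom C a b \<odot> v)"
    "Dom V y = q" "Cod V y = IHom V v (vHom C b c \<odot> w)"
  shows "uncurry u (p \<odot> q) (vHom C a c \<odot> w) ((x \<otimes> y) \<cdot> vComp Cbar (a, u) (b, v) (c, w))
    = Assoc' u p q \<cdot> ((uncurry u p (vHom C a b \<odot> v) x \<otimes> Id V q)
        \<cdot> ext a b c v q w (uncurry v q (vHom C b c \<odot> w) y))"
proof -
  let ?K = "vHom C a b" and ?L = "vHom C b c"
  let ?P = "IHom V u (?K \<odot> v)" and ?Q = "IHom V v (?L \<odot> w)"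
  have "uncurry u (p \<odot> q) (vHom C a c \<odot> w) ((x \<otimes> y) \<cdot> vComp Cbar (a, u) (b, v) (c, w))
      = (Id V u \<otimes> (x \<otimes> y)) \<cdot> (Assoc' u ?P ?Q \<cdot> ((ev u (?K \<odot> v) \<otimes> Id V ?Q)
          \<cdot> (Assoc V ?K v ?Q \<cdot> ((Id V ?K \<otimes> ev v (?L \<odot> w)) \<cdot> act a b c w))))"
    by (simp add: completion_def Let_def act_def)
  also have "\<dots> = Assoc' u p q \<cdot> (((Id V u \<otimes> x) \<otimes> y) \<cdot> ((ev u (?K \<odot> v) \<otimes> Id V ?Q)
          \<cdot> (Assoc V ?K v ?Q \<cdot> ((Id V ?K \<otimes> ev v (?L \<odot> w)) \<cdot> act a b c w))))"
    by (subst assoc'_nat[THEN comp_reassoc]) auto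
  also have "\<dots> = Assoc' u p q \<cdot> ((((Id V u \<otimes> x) \<cdot> ev u (?K \<odot> v)) \<otimes> Id V q)
      \<cdot> ((((Id V ?K \<otimes> Id V v) \<otimes> y) \<cdot> Assoc V ?K v ?Q) \<cdot> ((Id V ?K \<otimes> ev v (?L \<odot> w)) \<cdot> act a b c w)))"
    by simp
  also have "\<dots> = Assoc' u p q \<cdot> ((((Id V u \<otimes> x) \<cdot> ev u (?K \<odot> v)) \<otimes> Id V q)
      \<cdot> (Assoc V ?K v q \<cdot> ((Id V ?K \<otimes> ((Id V v \<otimes> y) \<cdot> ev v (?L \<odot> w))) \<cdot> act a b c w)))"
    by (subst assoc_nat) auto
  finally show ?thesis
    by (simp add: uncurry_ev ext_def)
qed

text \<open>The identities of \<open>P\<close>, \<open>Q\<close> and \<open>R\<close> have the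
  evaluations as mates, so associativity becomes \<open>ext_ext\<close> at evaluations;
  \<open>pentagon_inv(3)\<close> accounts for the associators in front.\<close>

lemma completion_assoc:
  assumes [simp]: "a \<in> vObj C" "b \<in> vObj C" "c \<in> vObj C" "d \<in> vObj C" "u \<in> Obj V" "v \<in> Obj V" "w \<in> Obj V" "t \<in> Obj V"
  defines "P \<equiv> IHom V u (vHom C a b \<odot> v)" and "Q \<equiv> IHom V v (vHom C b c \<odot> w)" and "R \<equiv> IHom V w (vHom C c d \<odot> t)"
  shows "(vComp Cbar (a, u) (b, v) (c, w) \<otimes> Id V R) \<cdot> vComp Cbar (a, u) (c, w) (d, t)
    = Assoc V P Q R \<cdot> ((Id V P \<otimes> vComp Cbar (b, v) (c, w) (d, t)) \<cdot> vComp Cbar (a, u) (b, v) (d, t))"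
proof -
  note [simp] = completion_vComp
  have [simp]: "P \<in> Obj V" "Q \<in> Obj V" "R \<in> Obj V"
    by (simp_all add: P_def Q_def R_def)
  note D = P_def[symmetric] Q_def[symmetric] R_def[symmetric]
  let ?W = "vHom C a d \<odot> t"
  let ?x = "ev u (vHom C a b \<odot> v)" and ?y = "ev v (vHom C b c \<odot> w)" and ?z = "ev w (vHom C c d \<odot> t)"
  have xyz [simp]: "Dom V ?x = u \<odot> P" "Dom V ?y = v \<odot> Q" "Dom V ?z = w \<odot> R"
    by (simp_all add: D)
  have uc [simp]: "uncurry u P (vHom C a b \<odot> v) (Id V P) = ?x" "uncurry v Q (vHom C b c \<odot> w) (Id V Q) = ?y"
    "uncurry w R (vHom C c d \<odot> t) (Id V R) = ?z"
    by (simp_all add: P_def Q_def R_def)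
  have 1: "uncurry u (P \<odot> Q) (vHom C a c \<odot> w) (vComp Cbar (a, u) (b, v) (c, w))
      = Assoc' u P Q \<cdot> ((?x \<otimes> Id V Q) \<cdot> ext a b c v Q w ?y)"
    using uncurry_completion_vComp[of a b c u v w "Id V P" "Id V Q" P Q] by (simp add: D)
  have 2: "uncurry v (Q \<odot> R) (vHom C b d \<odot> t) (vComp Cbar (b, v) (c, w) (d, t))
      = Assoc' v Q R \<cdot> ((?y \<otimes> Id V R) \<cdot> ext b c d w R t ?z)"
    using uncurry_completion_vComp[of b c d v w t "Id V Q" "Id V R" Q R] by (simp add: D)
  let ?E = "ext a b d v (Q \<odot> R) t (Assoc' v Q R \<cdot> ((?y \<otimes> Id V R) \<cdot> ext b c d w R t ?z))"
  have E [simp]: "?E \<in> Arr V" "Dom V ?E = (vHom C a b \<odot> v) \<odot> (Q \<odot> R)" "Cod V ?E = ?W"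
    by auto
  show ?thesis
  proof (rule uncurry_inject[of _ u ?W _ "(P \<odot> Q) \<odot> R"])
    have "uncurry u ((P \<odot> Q) \<odot> R) ?W ((vComp Cbar (a, u) (b, v) (c, w) \<otimes> Id V R) \<cdot> vComp Cbar (a, u) (c, w) (d, t))
        = Assoc' u (P \<odot> Q) R \<cdot> (((Assoc' u P Q \<cdot> ((?x \<otimes> Id V Q) \<cdot> ext a b c v Q w ?y)) \<otimes> Id V R) \<cdot> ext a c d w R t ?z)"
      by (subst uncurry_completion_vComp) (auto simp: 1 D)
    also have "\<dots> = Assoc' u (P \<odot> Q) R \<cdot> ((Assoc' u P Q \<otimes> Id V R) \<cdot> (((?x \<otimes> Id V Q) \<otimes> Id V R)
        \<cdot> ((ext a b c v Q w ?y \<otimes> Id V R) \<cdot> ext a c d w R t ?z)))"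
      by simp
    also have "\<dots> = Assoc' u (P \<odot> Q) R \<cdot> ((Assoc' u P Q \<otimes> Id V R) \<cdot> ((((?x \<otimes> Id V Q) \<otimes> Id V R)
        \<cdot> Assoc V (vHom C a b \<odot> v) Q R) \<cdot> ?E))"
      by (subst ext_ext) auto
    also have "\<dots> = (Assoc' u (P \<odot> Q) R \<cdot> ((Assoc' u P Q \<otimes> Id V R) \<cdot> Assoc V (u \<odot> P) Q R))
        \<cdot> ((?x \<otimes> Id V (Q \<odot> R)) \<cdot> ?E)"
      by (subst assoc_nat) auto
    also have "\<dots> = (Id V u \<otimes> Assoc V P Q R) \<cdot> (Assoc' u P (Q \<odot> R) \<cdot> ((?x \<otimes> Id V (Q \<odot> R)) \<cdot> ?E))"
      by (subst pentagon_inv(3)) auto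
    also have "\<dots> = (Id V u \<otimes> Assoc V P Q R) \<cdot> uncurry u (P \<odot> (Q \<odot> R)) ?W
        ((Id V P \<otimes> vComp Cbar (b, v) (c, w) (d, t)) \<cdot> vComp Cbar (a, u) (b, v) (d, t))"
      by (subst uncurry_completion_vComp) (auto simp: 2 D)
    also have "\<dots> = uncurry u ((P \<odot> Q) \<odot> R) ?W (Assoc V P Q R \<cdot>
        ((Id V P \<otimes> vComp Cbar (b, v) (c, w) (d, t)) \<cdot> vComp Cbar (a, u) (b, v) (d, t)))"
      by (subst uncurry_comp) (auto simp: D)
    finally show "uncurry u ((P \<odot> Q) \<odot> R) ?W ((vComp Cbar (a, u) (b, v) (c, w) \<otimes> Id V R) \<cdot> vComp Cbar (a, u) (c, w) (d, t))
      = uncurry u ((P \<odot> Q) \<odot> R) ?W (Assoc V P Q R \<cdot>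
        ((Id V P \<otimes> vComp Cbar (b, v) (c, w) (d, t)) \<cdot> vComp Cbar (a, u) (b, v) (d, t)))" .
  qed (auto simp: D)
qed

text \<open>The unitors cancel by \<open>triangle'\<close>, so that acting on the left by an arrow
  \<open>f\<close> of V is plain precomposition with \<open>f \<otimes> Id V q\<close>.\<close>

lemma uncurry_self_arr_left:
  assumes [simp]: "a \<in> vObj C" "b \<in> vObj C" "c \<in> vObj C" "u \<in> Obj V" "v \<in> Obj V" "w \<in> Obj V"
    "y \<in> Arr V" "q \<in> Obj V" "Dom V y = q" "Cod V y = IHom V v (vHom C b c \<odot> w)"
    "f \<in> Arr V" "Dom V f = u" "Cod V f = vHom C a b \<odot> v"
  shows "uncurry u q (vHom C a c \<odot> w)
      (LUnit' q \<cdot> ((self_arr u (vHom C a b \<odot> v) f \<otimes> y) \<cdot> vComp Cbar (a, u) (b, v) (c, w)))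
    = (f \<otimes> Id V q) \<cdot> ext a b c v q w (uncurry v q (vHom C b c \<odot> w) y)"
proof -
  note [simp] = completion_vComp
  let ?E = "ext a b c v q w (uncurry v q (vHom C b c \<odot> w) y)"
  have "uncurry u q (vHom C a c \<odot> w)
      (LUnit' q \<cdot> ((self_arr u (vHom C a b \<odot> v) f \<otimes> y) \<cdot> vComp Cbar (a, u) (b, v) (c, w)))
      = (Id V u \<otimes> LUnit' q) \<cdot> (Assoc' u \<one> q \<cdot> (((RUnit V u \<cdot> f) \<otimes> Id V q) \<cdot> ?E))"
    by (subst uncurry_comp) (auto simp: uncurry_completion_vComp simp del: uncurry_comp)
  also have "\<dots> = ((Id V u \<otimes> LUnit' q) \<cdot> (Assoc' u \<one> q \<cdot> (RUnit V u \<otimes> Id V q))) \<cdot> ((f \<otimes> Id V q) \<cdot> ?E)"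
    by simp
  also have "\<dots> = (f \<otimes> Id V q) \<cdot> ?E"
    by (subst triangle') auto
  finally show ?thesis .
qed

text \<open>Here even \<open>ext\<close> disappears: the second grade is \<open>\<one>\<close>,
  \<open>runit_tensor\<close> absorbs its associator, and only postcomposition is left.\<close>

lemma uncurry_self_arr_right:
  assumes [simp]: "a \<in> vObj C" "b \<in> vObj C" "c \<in> vObj C" "u \<in> Obj V" "v \<in> Obj V" "w \<in> Obj V"
    "x \<in> Arr V" "p \<in> Obj V" "Dom V x = p" "Cod V x = IHom V u (vHom C a b \<odot> v)"
    "g \<in> Arr V" "Dom V g = v" "Cod V g = vHom C b c \<odot> w"
  shows "uncurry u p (vHom C a c \<odot> w)
      (RUnit' p \<cdot> ((x \<otimes> self_arr v (vHom C b c \<odot> w) g) \<cdot> vComp Cbar (a, u) (b, v) (c, w)))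
    = uncurry u p (vHom C a b \<odot> v) x \<cdot> ((Id V (vHom C a b) \<otimes> g) \<cdot> act a b c w)"
proof -
  note [simp] = completion_vComp
  let ?K = "vHom C a b"
  let ?x = "uncurry u p (?K \<odot> v) x" and ?R = "(Id V ?K \<otimes> g) \<cdot> act a b c w"
  have "uncurry u p (vHom C a c \<odot> w)
      (RUnit' p \<cdot> ((x \<otimes> self_arr v (vHom C b c \<odot> w) g) \<cdot> vComp Cbar (a, u) (b, v) (c, w)))
      = (Id V u \<otimes> RUnit' p) \<cdot> (Assoc' u p \<one> \<cdot> ((?x \<otimes> Id V \<one>) \<cdot> ext a b c v \<one> w (RUnit V v \<cdot> g)))"
    by (subst uncurry_comp) (auto simp: uncurry_completion_vComp simp del: uncurry_comp)
  also have "ext a b c v \<one> w (RUnit V v \<cdot> g) = (Assoc V ?K v \<one> \<cdot> (Id V ?K \<otimes> RUnit V v)) \<cdot> ?R"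
    by (simp add: ext_def)
  also have "\<dots> = RUnit V (?K \<odot> v) \<cdot> ?R"
    by (subst runit_tensor) auto
  also have "(?x \<otimes> Id V \<one>) \<cdot> \<dots> = RUnit V (u \<odot> p) \<cdot> (?x \<cdot> ?R)"
    by (subst runit_nat[THEN comp_reassoc]) auto
  also have "\<dots> = Assoc V u p \<one> \<cdot> ((Id V u \<otimes> RUnit V p) \<cdot> (?x \<cdot> ?R))"
    by (subst runit_tensor[symmetric]) auto
  finally show ?thesis by simp
qed

lemma completion_vId_left:
  assumes [simp]: "a \<in> vObj C" "b \<in> vObj C" "u \<in> Obj V" "v \<in> Obj V"
    and [simp]: "y \<in> Arr V" "q \<in> Obj V" "Dom V y = q" "Cod V y = IHom V u (vHom C a b \<odot> v)"
  shows "LUnit' q \<cdot> ((vId Cbar (a, u) \<otimes> y) \<cdot> vComp Cbar (a, u) (a, u) (b, v)) = y"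
proof (rule uncurry_inject[of _ u "vHom C a b \<odot> v" _ q])
  let ?y = "uncurry u q (vHom C a b \<odot> v) y"
  let ?A = "vHom C a a" and ?W = "vHom C a b \<odot> v"
  have "uncurry u q ?W (LUnit' q \<cdot> ((vId Cbar (a, u) \<otimes> y) \<cdot> vComp Cbar (a, u) (a, u) (b, v)))
      = ((LUnit' u \<cdot> (vId C a \<otimes> Id V u)) \<otimes> Id V q) \<cdot> ext a a b u q v ?y"
    by (simp add: completion_vId uncurry_self_arr_left del: uncurry_comp)
  also have "\<dots> = (LUnit' u \<otimes> Id V q) \<cdot> ((((vId C a \<otimes> Id V u) \<otimes> Id V q) \<cdot> Assoc V ?A u q)
      \<cdot> ((Id V ?A \<otimes> ?y) \<cdot> act a a b v))"
    by (simp add: ext_def)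
  also have "\<dots> = (LUnit' u \<otimes> Id V q) \<cdot> (Assoc V \<one> u q \<cdot> ((Id V \<one> \<otimes> ?y) \<cdot> ((vId C a \<otimes> Id V ?W) \<cdot> act a a b v)))"
    by (subst assoc_nat) auto
  also have "\<dots> = (LUnit' u \<otimes> Id V q) \<cdot> ((Assoc V \<one> u q \<cdot> LUnit V (u \<odot> q)) \<cdot> (LUnit' (u \<odot> q)
      \<cdot> ((Id V \<one> \<otimes> ?y) \<cdot> ((vId C a \<otimes> Id V ?W) \<cdot> act a a b v))))"
    by simp
  also have "\<dots> = (LUnit' (u \<odot> q) \<cdot> (Id V \<one> \<otimes> ?y)) \<cdot> ((vId C a \<otimes> Id V ?W) \<cdot> act a a b v)"
    by (subst lunit_tensor) auto
  also have "LUnit' (u \<odot> q) \<cdot> (Id V \<one> \<otimes> ?y) = ?y \<cdot> LUnit' ?W"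
    by (subst lunit'_nat) auto
  also have "(?y \<cdot> LUnit' ?W) \<cdot> ((vId C a \<otimes> Id V ?W) \<cdot> act a a b v)
      = ?y \<cdot> (LUnit' ?W \<cdot> ((vId C a \<otimes> Id V ?W) \<cdot> act a a b v))"
    by simp
  also have "\<dots> = ?y"
    by (subst act_unit) auto
  finally show "uncurry u q ?W (LUnit' q \<cdot> ((vId Cbar (a, u) \<otimes> y) \<cdot> vComp Cbar (a, u) (a, u) (b, v))) = ?y" .
qed (use assms in \<open>auto simp: completion_vComp completion_vId\<close>)

lemma completion_vId_right:
  assumes [simp]: "a \<in> vObj C" "b \<in> vObj C" "u \<in> Obj V" "v \<in> Obj V"
    and [simp]: "x \<in> Arr V" "p \<in> Obj V" "Dom V x = p" "Cod V x = IHom V u (vHom C a b \<odot> v)"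
  shows "RUnit' p \<cdot> ((x \<otimes> vId Cbar (b, v)) \<cdot> vComp Cbar (a, u) (b, v) (b, v)) = x"
proof (rule uncurry_inject[of _ u "vHom C a b \<odot> v" _ p])
  show "uncurry u p (vHom C a b \<odot> v) (RUnit' p \<cdot> ((x \<otimes> vId Cbar (b, v)) \<cdot> vComp Cbar (a, u) (b, v) (b, v)))
    = uncurry u p (vHom C a b \<odot> v) x"
    by (simp add: completion_vId uncurry_self_arr_right act_unit del: uncurry_comp tens_comp)
qed (use assms in \<open>auto simp: completion_vComp completion_vId\<close>)

lemma completion_v_category: "v_category Cbar"
proof -
  note [simp] = completion_vComp
  have id: "(vId Cbar (a, u) \<otimes> Id V (IHom V u (vHom C a b \<odot> v))) \<cdot> vComp Cbar (a, u) (a, u) (b, v)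
      = LUnit V (IHom V u (vHom C a b \<odot> v))"
    "(Id V (IHom V u (vHom C a b \<odot> v)) \<otimes> vId Cbar (b, v)) \<cdot> vComp Cbar (a, u) (b, v) (b, v)
      = RUnit V (IHom V u (vHom C a b \<odot> v))"
    if [simp]: "a \<in> vObj C" "b \<in> vObj C" "u \<in> Obj V" "v \<in> Obj V" for a b u v
  proof -
    let ?H = "IHom V u (vHom C a b \<odot> v)"
    have [simp]: "vId Cbar (c, w) \<in> Arr V" "Dom V (vId Cbar (c, w)) = \<one>"
      "Cod V (vId Cbar (c, w)) = IHom V w (vHom C c c \<odot> w)" if "c \<in> vObj C" "w \<in> Obj V" for c w
      using that by (simp_all add: completion_vId)
    show "(vId Cbar (a, u) \<otimes> Id V ?H) \<cdot> vComp Cbar (a, u) (a, u) (b, v) = LUnit V ?H"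
      by (rule iso_epi[of "LUnit' ?H"])
        (auto simp: completion_vId_left intro: iso_inverse)
    show "(Id V ?H \<otimes> vId Cbar (b, v)) \<cdot> vComp Cbar (a, u) (b, v) (b, v) = RUnit V ?H"
      by (rule iso_epi[of "RUnit' ?H"])
        (auto simp: completion_vId_right intro: iso_inverse)
  qed
  show ?thesis
    unfolding v_category_def by (auto simp: id completion_assoc hom_def) (auto simp: completion_vId)
qed

end

text \<open>From here on the graded calculus is available in the completion too, under the prefix
  \<open>Cb\<close>.\<close>

sublocale enriched_over_closed \<subseteq> Cb: enriched_category V "completion C"
  by unfold_locales (rule completion_v_category)

context enriched_over_closed
begin

lemma uncurry_Cb_lact:
  assumes "a \<in> vObj C" "b \<in> vObj C" "c \<in> vObj C" "u \<in> Obj V" "v \<in> Obj V" "w \<in> Obj V"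
    "y \<in> Arr V" "Dom V y = q" "Cod V y = IHom V v (vHom C b c \<odot> w)"
    "f \<in> Arr V" "Dom V f = u" "Cod V f = vHom C a b \<odot> v"
  shows "uncurry u q (vHom C a c \<odot> w) (Cb.lact (a, u) (b, v) (c, w) (self_arr u (vHom C a b \<odot> v) f) y)
    = (f \<otimes> Id V q) \<cdot> ext a b c v q w (uncurry v q (vHom C b c \<odot> w) y)"
  using uncurry_self_arr_left[of a b c u v w y q f] assms dom_in[of y] by (simp add: Cb.lact_def Cb.gc_def del: uncurry_comp)

lemma uncurry_Cb_ract:
  assumes "a \<in> vObj C" "b \<in> vObj C" "c \<in> vObj C" "u \<in> Obj V" "v \<in> Obj V" "w \<in> Obj V"
    "x \<in> Arr V" "Dom V x = p" "Cod V x = IHom V u (vHom C a b \<odot> v)"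
    "g \<in> Arr V" "Dom V g = v" "Cod V g = vHom C b c \<odot> w"
  shows "uncurry u p (vHom C a c \<odot> w) (Cb.ract (a, u) (b, v) (c, w) x (self_arr v (vHom C b c \<odot> w) g))
    = uncurry u p (vHom C a b \<odot> v) x \<cdot> ((Id V (vHom C a b) \<otimes> g) \<cdot> act a b c w)"
  using uncurry_self_arr_right[of a b c u v w x p g] assms dom_in[of x] by (simp add: Cb.ract_def Cb.gc_def del: uncurry_comp)

text \<open>Morphisms \<open>(a, u) \<rightarrow> (b, v)\<close> of the underlying category are
  arrows \<open>u \<rightarrow> C(a, b) \<odot> v\<close> of V, composed by the Kleisli rule, so
  inverses in the completion can be sought among arrows of V.\<close>

lemma Cb_ucomp:
  assumes [simp]: "a \<in> vObj C" "b \<in> vObj C" "c \<in> vObj C" "u \<in> Obj V" "v \<in> Obj V" "w \<in> Obj V"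
    "f \<in> Arr V" "Dom V f = u" "Cod V f = vHom C a b \<odot> v"
    "g \<in> Arr V" "Dom V g = v" "Cod V g = vHom C b c \<odot> w"
  shows "ucomp Cbar (a, u) (b, v) (c, w) (self_arr u (vHom C a b \<odot> v) f) (self_arr v (vHom C b c \<odot> w) g)
    = self_arr u (vHom C a c \<odot> w) (f \<cdot> ((Id V (vHom C a b) \<otimes> g) \<cdot> act a b c w))"
  by (rule uncurry_inject[of _ u "vHom C a c \<odot> w" _ \<one>])
    (auto simp: uncurry_Cb_ract Cb.ucomp_ract)

text \<open>At \<open>z = \<one>\<close> the action is composition itself up to right unitors. This
  relates morphisms into objects \<open>(c, \<one>)\<close> to morphisms of
  \<open>C\<close>.\<close>

lemma act_runit:
  assumes [simp]: "a \<in> vObj C" "b \<in> vObj C" "c \<in> vObj C"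
  shows "(Id V (vHom C a b) \<otimes> RUnit' (vHom C b c)) \<cdot> act a b c \<one> = vComp C a b c \<cdot> RUnit' (vHom C a c)"
proof (rule iso_epi[of "RUnit V (vHom C a b \<odot> vHom C b c)"])
  let ?K = "vHom C a b" and ?L = "vHom C b c"
  have "RUnit V (?K \<odot> ?L) \<cdot> (vComp C a b c \<cdot> RUnit' (vHom C a c))
      = RUnit V (?K \<odot> ?L) \<cdot> (RUnit' (?K \<odot> ?L) \<cdot> (vComp C a b c \<otimes> Id V \<one>))"
    by (subst runit'_nat) auto
  then show "RUnit V (?K \<odot> ?L) \<cdot> ((Id V ?K \<otimes> RUnit' ?L) \<cdot> act a b c \<one>)
      = RUnit V (?K \<odot> ?L) \<cdot> (vComp C a b c \<cdot> RUnit' (vHom C a c))"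
    by (subst (1) runit_tensor[symmetric]) (auto simp: act_def)
qed auto

section \<open>The inclusion as a V-functor\<close>

lemma incl_fObj [simp]: "fObj (incl C) a = (a, \<one>)"
  by (simp add: incl_def)

lemma incl_simps [simp]:
  assumes "a \<in> vObj C" "b \<in> vObj C"
  shows "fHom (incl C) a b \<in> Arr V" "Dom V (fHom (incl C) a b) = vHom C a b"
    "Cod V (fHom (incl C) a b) = IHom V \<one> (vHom C a b \<odot> \<one>)"
    "uncurry \<one> (vHom C a b) (vHom C a b \<odot> \<one>) (fHom (incl C) a b) = LUnit V (vHom C a b) \<cdot> RUnit' (vHom C a b)"
  using assms by (simp_all add: incl_def)

lemma vId_runit: "a \<in> vObj C \<Longrightarrow> LUnit' \<one> \<cdot> (vId C a \<otimes> Id V \<one>) = vId C a \<cdot> RUnit' (vHom C a a)"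
  by (subst runit'_nat) (auto simp: lunit_unit)

lemma incl_functor: "v_functor C Cbar (incl C)"
proof -
  have id: "vId C a \<cdot> fHom (incl C) a a = vId Cbar (a, \<one>)" if [simp]: "a \<in> vObj C" for a
  proof (rule uncurry_inject[of _ \<one> "vHom C a a \<odot> \<one>" _ \<one>])
    have "uncurry \<one> \<one> (vHom C a a \<odot> \<one>) (vId C a \<cdot> fHom (incl C) a a)
        = ((Id V \<one> \<otimes> vId C a) \<cdot> LUnit V (vHom C a a)) \<cdot> RUnit' (vHom C a a)"
      by simp
    also have "\<dots> = RUnit V \<one> \<cdot> (LUnit' \<one> \<cdot> (vId C a \<otimes> Id V \<one>))"
      by (subst lunit_nat) (auto simp: lunit_unit simp flip: vId_runit)
    finally show "uncurry \<one> \<one> (vHom C a a \<odot> \<one>) (vId C a \<cdot> fHom (incl C) a a)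
        = uncurry \<one> \<one> (vHom C a a \<odot> \<one>) (vId Cbar (a, \<one>))"
      by (simp add: completion_vId)
  qed (use that in \<open>auto simp: completion_vId\<close>)
  have comp: "vComp C a b c \<cdot> fHom (incl C) a c
      = (fHom (incl C) a b \<otimes> fHom (incl C) b c) \<cdot> vComp Cbar (a, \<one>) (b, \<one>) (c, \<one>)"
    if [simp]: "a \<in> vObj C" "b \<in> vObj C" "c \<in> vObj C" for a b c
  proof (rule uncurry_inject[of _ \<one> "vHom C a c \<odot> \<one>" _ "vHom C a b \<odot> vHom C b c"])
    let ?K = "vHom C a b" and ?L = "vHom C b c" and ?M = "vComp C a b c"
    have "uncurry \<one> (?K \<odot> ?L) (vHom C a c \<odot> \<one>)
          ((fHom (incl C) a b \<otimes> fHom (incl C) b c) \<cdot> vComp Cbar (a, \<one>) (b, \<one>) (c, \<one>))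
        = Assoc' \<one> ?K ?L \<cdot> ((LUnit V ?K \<otimes> Id V ?L) \<cdot> ((RUnit' ?K \<otimes> Id V ?L) \<cdot> ((Assoc V ?K \<one> ?L
            \<cdot> (Id V ?K \<otimes> LUnit V ?L)) \<cdot> ((Id V ?K \<otimes> RUnit' ?L) \<cdot> act a b c \<one>))))"
      by (subst uncurry_completion_vComp) (auto simp: ext_def)
    also have "\<dots> = Assoc' \<one> ?K ?L \<cdot> ((LUnit V ?K \<otimes> Id V ?L) \<cdot> ((Id V ?K \<otimes> RUnit' ?L) \<cdot> act a b c \<one>))"
      by (subst triangle) auto
    also have "\<dots> = LUnit V (?K \<odot> ?L) \<cdot> (?M \<cdot> RUnit' (vHom C a c))"
      by (subst act_runit, simp_all, subst lunit_tensor[symmetric]) auto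
    also have "\<dots> = ((Id V \<one> \<otimes> ?M) \<cdot> LUnit V (vHom C a c)) \<cdot> RUnit' (vHom C a c)"
      by (subst lunit_nat) auto
    also have "\<dots> = uncurry \<one> (?K \<odot> ?L) (vHom C a c \<odot> \<one>) (?M \<cdot> fHom (incl C) a c)"
      by simp
    finally show "uncurry \<one> (?K \<odot> ?L) (vHom C a c \<odot> \<one>) (?M \<cdot> fHom (incl C) a c)
        = uncurry \<one> (?K \<odot> ?L) (vHom C a c \<odot> \<one>)
          ((fHom (incl C) a b \<otimes> fHom (incl C) b c) \<cdot> vComp Cbar (a, \<one>) (b, \<one>) (c, \<one>))"
      by (rule sym)
  qed (use that completion_vComp[of a b c \<one> \<one> \<one>] in auto)
  show ?thesis
    unfolding v_functor_def using id comp by (auto simp: hom_def)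
qed

end

section \<open>The realization functor and the comparison transformation\<close>

sublocale tensored_category \<subseteq> enriched_over_closed V C
  by unfold_locales

context tensored_category
begin

lemma realize_fObj [simp]: "fObj (realize C T) (a, u) = tens T a u"
  by (simp add: realize_def)

text \<open>By the universal property of \<open>a \<triangleleft> u\<close>, the last equation below determines the action of \<open>realize\<close> on hom
  objects; it replaces the defining formula from here on.\<close>

lemma realize_fHom:
  assumes [simp]: "a \<in> vObj C" "b \<in> vObj C" "u \<in> Obj V" "v \<in> Obj V"
  shows "fHom (realize C T) (a, u) (b, v) \<in> Arr V"
    "Dom V (fHom (realize C T) (a, u) (b, v)) = IHom V u (vHom C a b \<odot> v)"
    "Cod V (fHom (realize C T) (a, u) (b, v)) = vHom C (tens T a u) (tens T b v)"
    "gc a (tens T a u) (tens T b v) (\<eta> a u) (fHom (realize C T) (a, u) (b, v))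
      = ev u (vHom C a b \<odot> v) \<cdot> strength a b v"
proof -
  let ?K = "vHom C a b"
  let ?H = "IHom V u (?K \<odot> v)"
  let ?t = "tens T a u"
  let ?x0 = "tens T ?t ?H" and ?x1 = "tens T a (u \<odot> ?H)" and ?x2 = "tens T a (?K \<odot> v)"
    and ?x3 = "tens T (tens T a ?K) v" and ?x4 = "tens T b v"
  let ?\<alpha> = "tens_assoc C T a u ?H"
  define f1 where "f1 = u_inverse C ?x1 ?x0 ?\<alpha>"
  define f2 where "f2 = tens_id_arr T a (u \<odot> ?H) (?K \<odot> v) (ev u (?K \<odot> v))"
  define f3 where "f3 = tens_assoc C T a ?K v"
  define f4 where "f4 = tens_arr_id C T (tens T a ?K) b (tens_counit C T a b) v"
  have f1 [simp]: "f1 \<in> Arr V" "Dom V f1 = \<one>" "Cod V f1 = vHom C ?x0 ?x1"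
    "ucomp C ?x1 ?x0 ?x1 ?\<alpha> f1 = vId C ?x1"
    using u_inverse_arrows_u_inverse[of ?x1 ?x0 ?\<alpha>] u_iso_tens_assoc[of a u ?H]
    by (auto simp: f1_def u_inverse_arrows_def uhom_def hom_def)
  have f2 [simp]: "f2 \<in> Arr V" "Dom V f2 = \<one>" "Cod V f2 = vHom C ?x1 ?x2"
    "ract a ?x1 ?x2 (\<eta> a (u \<odot> ?H)) f2 = ev u (?K \<odot> v) \<cdot> \<eta> a (?K \<odot> v)"
    by (simp_all add: f2_def)
  have f3 [simp]: "f3 \<in> Arr V" "Dom V f3 = \<one>" "Cod V f3 = vHom C ?x2 ?x3"
    "ract a ?x2 ?x3 (\<eta> a (?K \<odot> v)) f3 = gc a (tens T a ?K) ?x3 (\<eta> a ?K) (\<eta> (tens T a ?K) v)"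
    by (simp_all add: f3_def)
  have f4 [simp]: "f4 \<in> Arr V" "Dom V f4 = \<one>" "Cod V f4 = vHom C ?x3 ?x4"
    "ract (tens T a ?K) ?x3 ?x4 (\<eta> (tens T a ?K) v) f4 = lact (tens T a ?K) b ?x4 (tens_counit C T a b) (\<eta> b v)"
    by (simp_all add: f4_def)
  let ?f = "ucomp C ?x0 ?x3 ?x4 (ucomp C ?x0 ?x2 ?x3 (ucomp C ?x0 ?x1 ?x2 f1 f2) f3) f4"
  let ?\<rho> = "fHom (realize C T) (a, u) (b, v)"
  have "?\<rho> = tens_down C T ?t ?H ?x4 ?f"
    by (simp add: realize_def Let_def f1_def f2_def f3_def f4_def)
  also have "\<dots> = ract ?t ?x0 ?x4 (\<eta> ?t ?H) ?f"
    by (rule tens_down_eq) auto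
  finally have \<rho>: "?\<rho> = ract ?t ?x0 ?x4 (\<eta> ?t ?H) ?f" .
  then show [simp]: "?\<rho> \<in> Arr V" "Dom V ?\<rho> = ?H" "Cod V ?\<rho> = vHom C ?t ?x4"
    by auto
  have "gc a ?t ?x4 (\<eta> a u) ?\<rho> = ract a ?x0 ?x4 (gc a ?t ?x0 (\<eta> a u) (\<eta> ?t ?H)) ?f"
    unfolding \<rho> by (subst gc_ract) auto
  \<comment> \<open>By the definition of \<open>tens_assoc\<close>, two units in a row are a single
    unit followed by \<open>?\<alpha>\<close>, which \<open>f1\<close> then cancels.\<close>
  also have "gc a ?t ?x0 (\<eta> a u) (\<eta> ?t ?H) = ract a ?x1 ?x0 (\<eta> a (u \<odot> ?H)) ?\<alpha>"
    by simp
  also have "ract a ?x0 ?x4 \<dots> ?f = ract a ?x3 ?x4 (ract a ?x2 ?x3 (ract a ?x1 ?x2 (ract a ?x0 ?x1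
      (ract a ?x1 ?x0 (\<eta> a (u \<odot> ?H)) ?\<alpha>) f1) f2) f3) f4"
    by (simp add: ract_ract[symmetric] del: tens_assoc_simps(4))
  also have "ract a ?x0 ?x1 (ract a ?x1 ?x0 (\<eta> a (u \<odot> ?H)) ?\<alpha>) f1 = \<eta> a (u \<odot> ?H)"
    by (subst ract_ract) auto
  also have "ract a ?x2 ?x3 (ract a ?x1 ?x2 (\<eta> a (u \<odot> ?H)) f2) f3
      = ev u (?K \<odot> v) \<cdot> gc a (tens T a ?K) ?x3 (\<eta> a ?K) (\<eta> (tens T a ?K) v)"
    by (simp add: ract_comp)
  also have "ract a ?x3 ?x4 \<dots> f4 = ev u (?K \<odot> v)
      \<cdot> gc a (tens T a ?K) ?x4 (\<eta> a ?K) (ract (tens T a ?K) ?x3 ?x4 (\<eta> (tens T a ?K) v) f4)"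
    by (subst ract_comp) (auto simp: gc_ract simp del: f4(4))
  \<comment> \<open>Here \<open>gc_ract_left\<close> moves the counit over to
    \<open>\<eta> a ?K\<close>, which it turns into the identity of \<open>?K\<close>.\<close>
  also have "\<dots> = ev u (?K \<odot> v) \<cdot> strength a b v"
    by (simp add: gc_ract_left[symmetric] strength_def)
  finally show "gc a ?t ?x4 (\<eta> a u) ?\<rho> = ev u (?K \<odot> v) \<cdot> strength a b v" .
qed

lemma gc_unit_comp_realize:
  assumes [simp]: "a \<in> vObj C" "b \<in> vObj C" "u \<in> Obj V" "v \<in> Obj V"
    "x \<in> Arr V" "Dom V x = w" "Cod V x = IHom V u (vHom C a b \<odot> v)"
  shows "gc a (tens T a u) (tens T b v) (\<eta> a u) (x \<cdot> fHom (realize C T) (a, u) (b, v))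
    = uncurry u w (vHom C a b \<odot> v) x \<cdot> strength a b v"
proof -
  note [simp] = realize_fHom
  have "gc a (tens T a u) (tens T b v) (\<eta> a u) (x \<cdot> fHom (realize C T) (a, u) (b, v))
      = ((Id V u \<otimes> x) \<cdot> ev u (vHom C a b \<odot> v)) \<cdot> strength a b v"
    by (subst gc_comp_right) auto
  also have "(Id V u \<otimes> x) \<cdot> ev u (vHom C a b \<odot> v) = uncurry u w (vHom C a b \<odot> v) x"
    by (rule uncurry_ev) auto
  finally show ?thesis .
qed

text \<open>Associativity of composition with \<open>\<eta> c w\<close> as last factor. It converts
  the \<open>act\<close> in the composition of the completion into composition in \<open>C\<close>,
  and so makes \<open>realize\<close> functorial.\<close>

lemma act_strength:
  assumes [simp]: "a \<in> vObj C" "b \<in> vObj C" "c \<in> vObj C" "w \<in> Obj V"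
  shows "act a b c w \<cdot> strength a c w = gc a b (tens T c w) (Id V (vHom C a b)) (strength b c w)"
proof -
  have "act a b c w \<cdot> strength a c w = Assoc' (vHom C a b) (vHom C b c) w
      \<cdot> gc a c (tens T c w) (vComp C a b c) (\<eta> c w)"
    by (simp add: act_def tens_strength)
  also have "vComp C a b c = gc a b c (Id V (vHom C a b)) (Id V (vHom C b c))"
    by (simp add: gc_id)
  finally show ?thesis
    by (simp add: gc_assoc strength_def)
qed

text \<open>Both laws are checked after composition with \<open>\<eta>\<close>, where
  \<open>realize\<close> becomes \<open>uncurry\<close> followed by \<open>strength\<close>.\<close>

lemma realize_functor: "v_functor Cbar C (realize C T)"
proof -
  note [simp] = realize_fHom completion_vComp
  have id: "vId Cbar (a, u) \<cdot> fHom (realize C T) (a, u) (a, u) = vId C (tens T a u)"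
    if [simp]: "a \<in> vObj C" "u \<in> Obj V" for a u
  proof (rule gc_unit_inject[of a u "tens T a u" _ _ \<one>])
    have "gc a (tens T a u) (tens T a u) (\<eta> a u) (vId Cbar (a, u) \<cdot> fHom (realize C T) (a, u) (a, u))
        = RUnit V u \<cdot> (LUnit' u \<cdot> ((vId C a \<otimes> Id V u) \<cdot> strength a a u))"
      by (subst gc_unit_comp_realize) (auto simp: completion_vId)
    also have "\<dots> = gc a (tens T a u) (tens T a u) (\<eta> a u) (vId C (tens T a u))"
      by (simp add: tens_strength gc_vId_left gc_vId_right)
    finally show "gc a (tens T a u) (tens T a u) (\<eta> a u) (vId Cbar (a, u) \<cdot> fHom (realize C T) (a, u) (a, u))
      = gc a (tens T a u) (tens T a u) (\<eta> a u) (vId C (tens T a u))" .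
  qed (use that in \<open>auto simp: completion_vId\<close>)
  have comp: "vComp Cbar (a, u) (b, v) (c, w) \<cdot> fHom (realize C T) (a, u) (c, w)
      = (fHom (realize C T) (a, u) (b, v) \<otimes> fHom (realize C T) (b, v) (c, w))
          \<cdot> vComp C (tens T a u) (tens T b v) (tens T c w)"
    if [simp]: "a \<in> vObj C" "b \<in> vObj C" "c \<in> vObj C" "u \<in> Obj V" "v \<in> Obj V" "w \<in> Obj V" for a b c u v w
  proof (rule gc_unit_inject[of a u "tens T c w" _ _ "IHom V u (vHom C a b \<odot> v) \<odot> IHom V v (vHom C b c \<odot> w)"])
    let ?K = "vHom C a b" and ?L = "vHom C b c"
    let ?P = "IHom V u (?K \<odot> v)" and ?Q = "IHom V v (?L \<odot> w)"
    let ?\<rho> = "fHom (realize C T)"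
    let ?a = "tens T a u" and ?b = "tens T b v" and ?c = "tens T c w"
    have "gc a ?a ?c (\<eta> a u) (vComp Cbar (a, u) (b, v) (c, w) \<cdot> ?\<rho> (a, u) (c, w))
        = uncurry u (?P \<odot> ?Q) (vHom C a c \<odot> w) ((Id V ?P \<otimes> Id V ?Q) \<cdot> vComp Cbar (a, u) (b, v) (c, w)) \<cdot> strength a c w"
      by (subst gc_unit_comp_realize) auto
    also have "\<dots> = Assoc' u ?P ?Q \<cdot> ((ev u (?K \<odot> v) \<otimes> Id V ?Q) \<cdot> (Assoc V ?K v ?Q
        \<cdot> ((Id V ?K \<otimes> ev v (?L \<odot> w)) \<cdot> (act a b c w \<cdot> strength a c w))))"
      by (subst uncurry_completion_vComp) (auto simp: ext_def)
    also have "(Id V ?K \<otimes> ev v (?L \<odot> w)) \<cdot> (act a b c w \<cdot> strength a c w)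
        = gc a b ?c (Id V ?K) (ev v (?L \<odot> w) \<cdot> strength b c w)"
      by (subst gc_comp_right) (auto simp: act_strength)
    also have "\<dots> = gc a b ?c (Id V ?K) (gc b ?b ?c (\<eta> b v) (?\<rho> (b, v) (c, w)))"
      by simp
    also have "Assoc V ?K v ?Q \<cdot> \<dots> = gc a ?b ?c (strength a b v) (?\<rho> (b, v) (c, w))"
      by (simp add: strength_def gc_assoc del: realize_fHom(4))
    also have "(ev u (?K \<odot> v) \<otimes> Id V ?Q) \<cdot> \<dots>
        = gc a ?b ?c (gc a ?a ?b (\<eta> a u) (?\<rho> (a, u) (b, v))) (?\<rho> (b, v) (c, w))"
      by (simp add: gc_comp_left)
    also have "Assoc' u ?P ?Q \<cdot> \<dots> = gc a ?a ?c (\<eta> a u) (gc ?a ?b ?c (?\<rho> (a, u) (b, v)) (?\<rho> (b, v) (c, w)))"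
      by (simp add: gc_assoc del: realize_fHom(4))
    finally show "gc a ?a ?c (\<eta> a u) (vComp Cbar (a, u) (b, v) (c, w) \<cdot> ?\<rho> (a, u) (c, w))
        = gc a ?a ?c (\<eta> a u) ((?\<rho> (a, u) (b, v) \<otimes> ?\<rho> (b, v) (c, w)) \<cdot> vComp C ?a ?b ?c)"
      by (simp add: gc_def)
  qed (use that in auto)
  show ?thesis
    unfolding v_functor_def using id comp by (auto simp: hom_def)
qed

section \<open>Explicit form of \<open>tau\<close>\<close>

lemma completion_arr_eq:
  assumes "a \<in> vObj C" "g \<in> Arr V" "Dom V g = u" "Cod V g = v"
  shows "completion_arr C a u v g = self_arr u (vHom C a a \<odot> v) (g \<cdot> (LUnit' v \<cdot> (vId C a \<otimes> Id V v)))"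
  using assms dom_in[of g] cod_in[of g] by (simp add: completion_arr_def self_arr_def)

text \<open>The morphism induced by \<open>g\<close> is \<open>g\<close> followed by the Kleisli
  unit, so the left unit law of \<open>act\<close> reduces composition with it to precomposition
  with \<open>g\<close>.\<close>

lemma completion_arr_comp:
  assumes [simp]: "a \<in> vObj C" "b \<in> vObj C" "w \<in> Obj V" "g \<in> Arr V" "Dom V g = u" "Cod V g = v"
    "h \<in> Arr V" "Dom V h = v" "Cod V h = vHom C a b \<odot> w"
  shows "ucomp Cbar (a, u) (a, v) (b, w) (completion_arr C a u v g) (self_arr v (vHom C a b \<odot> w) h)
    = self_arr u (vHom C a b \<odot> w) (g \<cdot> h)"
proof -
  have [simp]: "u \<in> Obj V" "v \<in> Obj V" using dom_in[of g] cod_in[of g] by auto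
  let ?W = "vHom C a b \<odot> w"
  have "(LUnit' v \<cdot> (vId C a \<otimes> Id V v)) \<cdot> ((Id V (vHom C a a) \<otimes> h) \<cdot> act a a b w)
      = (LUnit' v \<cdot> (Id V \<one> \<otimes> h)) \<cdot> ((vId C a \<otimes> Id V ?W) \<cdot> act a a b w)"
    by simp
  also have "LUnit' v \<cdot> (Id V \<one> \<otimes> h) = h \<cdot> LUnit' ?W"
    by (subst lunit'_nat) auto
  also have "(h \<cdot> LUnit' ?W) \<cdot> ((vId C a \<otimes> Id V ?W) \<cdot> act a a b w)
      = h \<cdot> (LUnit' ?W \<cdot> ((vId C a \<otimes> Id V ?W) \<cdot> act a a b w))"
    by simp
  also have "\<dots> = h"
    by (subst act_unit) auto
  finally have "g \<cdot> (LUnit' v \<cdot> (vId C a \<otimes> Id V v)) \<cdot> ((Id V (vHom C a a) \<otimes> h) \<cdot> act a a b w) = g \<cdot> h"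
    by simp
  then show ?thesis
    by (simp add: completion_arr_eq Cb_ucomp)
qed

lemma tens_mu_incl:
  assumes [simp]: "a \<in> vObj C" "u \<in> Obj V"
  shows "tens_mu C T Cbar (completion_tensoring C) (incl C) a u
    = self_arr (\<one> \<odot> u) (vHom C a (tens T a u) \<odot> \<one>) (LUnit V u \<cdot> (\<eta> a u \<cdot> RUnit' (vHom C a (tens T a u))))"
proof -
  let ?K = "vHom C a (tens T a u)"
  have "\<eta> a u \<cdot> fHom (incl C) a (tens T a u)
      = Curry V \<one> u (?K \<odot> \<one>) (((Id V \<one> \<otimes> \<eta> a u) \<cdot> LUnit V ?K) \<cdot> RUnit' ?K)"
    by (simp add: incl_def curry_nat)
  also have "\<dots> = Curry V \<one> u (?K \<odot> \<one>) (LUnit V u \<cdot> (\<eta> a u \<cdot> RUnit' ?K))"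
    by (subst lunit_nat) auto
  finally show ?thesis
    using self_arr_ihom_curry[of \<one> u "LUnit V u \<cdot> (\<eta> a u \<cdot> RUnit' ?K)" "?K \<odot> \<one>"]
    by (simp add: tens_mu_def tens_up_def completion_tensoring_def)
qed

text \<open>The unitor \<open>LUnit' u\<close> built into \<open>tau\<close> cancels the
  \<open>LUnit V u\<close> of \<open>tens_mu_incl\<close>.\<close>

lemma tau_eq:
  assumes [simp]: "a \<in> vObj C" "u \<in> Obj V"
  shows "tau C T (a, u) = self_arr u (vHom C a (tens T a u) \<odot> \<one>) (\<eta> a u \<cdot> RUnit' (vHom C a (tens T a u)))"
  by (simp add: tau_def tens_mu_incl completion_arr_comp)

lemma tau_simps [simp]:
  assumes [simp]: "a \<in> vObj C" "u \<in> Obj V"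
  shows "tau C T (a, u) \<in> Arr V" "Dom V (tau C T (a, u)) = \<one>"
    "Cod V (tau C T (a, u)) = IHom V u (vHom C a (tens T a u) \<odot> \<one>)"
  by (simp_all add: tau_eq)

lemma u_iso_tau_iff:
  assumes [simp]: "a \<in> vObj C" "u \<in> Obj V"
  shows "u_iso Cbar (a, \<one> \<odot> u) (tens T a u, \<one>) (tens_mu C T Cbar (completion_tensoring C) (incl C) a u)
    \<longleftrightarrow> u_iso Cbar (a, u) (tens T a u, \<one>) (tau C T (a, u))"
proof -
  let ?t = "tens T a u" and ?X = "(a, u)" and ?X' = "(a, \<one> \<odot> u)"
  let ?Y = "(?t, \<one>)"
  let ?\<mu> = "tens_mu C T Cbar (completion_tensoring C) (incl C) a u" and ?\<tau> = "tau C T (a, u)"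
  let ?l = "completion_arr C a (\<one> \<odot> u) u (LUnit V u)" and ?l' = "completion_arr C a u (\<one> \<odot> u) (LUnit' u)"
  have \<mu> [simp]: "?\<mu> \<in> Arr V" "Dom V ?\<mu> = \<one>" "Cod V ?\<mu> = IHom V (\<one> \<odot> u) (vHom C a ?t \<odot> \<one>)"
    by (simp_all add: tens_mu_incl)
  have l [simp]: "?l \<in> Arr V" "Dom V ?l = \<one>" "Cod V ?l = IHom V (\<one> \<odot> u) (vHom C a a \<odot> u)"
    "?l' \<in> Arr V" "Dom V ?l' = \<one>" "Cod V ?l' = IHom V u (vHom C a a \<odot> (\<one> \<odot> u))"
    by (simp_all add: completion_arr_eq)
  have \<tau>: "?\<tau> = ucomp Cbar ?X ?X' ?Y ?l' ?\<mu>"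
    by (simp add: tau_def)
  have \<mu>': "?\<mu> = ucomp Cbar ?X' ?X ?Y ?l ?\<tau>"
    by (simp add: tau_eq completion_arr_comp tens_mu_incl)
  have "ucomp Cbar ?X ?X' ?X ?l' (self_arr (\<one> \<odot> u) (vHom C a a \<odot> u) (LUnit V u \<cdot> (LUnit' u \<cdot> (vId C a \<otimes> Id V u))))
      = vId Cbar ?X"
    by (subst completion_arr_comp) (auto simp: completion_vId)
  then have ll: "ucomp Cbar ?X ?X' ?X ?l' ?l = vId Cbar ?X"
    by (simp add: completion_arr_eq[of _ "LUnit V u"])
  have "ucomp Cbar ?X' ?X ?X' ?l (self_arr u (vHom C a a \<odot> (\<one> \<odot> u)) (LUnit' u \<cdot> (LUnit' (\<one> \<odot> u) \<cdot> (vId C a \<otimes> Id V (\<one> \<odot> u)))))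
      = vId Cbar ?X'"
    by (subst completion_arr_comp) (auto simp: completion_vId)
  then have ll': "ucomp Cbar ?X' ?X ?X' ?l ?l' = vId Cbar ?X'"
    by (simp add: completion_arr_eq[of _ "LUnit' u"])
  have "u_inverse_arrows Cbar ?X' ?X ?l ?l'" "u_inverse_arrows Cbar ?X ?X' ?l' ?l"
    using ll ll' by (auto simp: u_inverse_arrows_def uhom_def hom_def)
  then have iso: "u_iso Cbar ?X' ?X ?l" "u_iso Cbar ?X ?X' ?l'"
    by (auto simp: u_iso_def)
  show ?thesis
  proof
    assume "u_iso Cbar ?X' ?Y ?\<mu>"
    then have "u_iso Cbar ?X ?Y (ucomp Cbar ?X ?X' ?Y ?l' ?\<mu>)"
      using iso(2) by (intro Cb.u_iso_ucomp) auto
    then show "u_iso Cbar ?X ?Y ?\<tau>"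
      by (simp only: \<tau>)
  next
    assume "u_iso Cbar ?X ?Y ?\<tau>"
    then have "u_iso Cbar ?X' ?Y (ucomp Cbar ?X' ?X ?Y ?l ?\<tau>)"
      using iso(1) by (intro Cb.u_iso_ucomp) auto
    then show "u_iso Cbar ?X' ?Y ?\<mu>"
      by (simp only: \<mu>'[symmetric])
  qed
qed

lemma incl_tensored_iff:
  "tensored_functor C T Cbar (completion_tensoring C) (incl C)
    \<longleftrightarrow> (\<forall>a\<in>vObj C. \<forall>u\<in>Obj V. u_iso Cbar (a, u) (tens T a u, \<one>) (tau C T (a, u)))"
  unfolding tensored_functor_def using incl_functor u_iso_tau_iff by (simp add: completion_tensoring_def)

section \<open>Invertibility of \<open>tau\<close> compared with invertibility of
  \<open>strength\<close>\<close>

lemma ucomp_tau: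
  assumes [simp]: "a \<in> vObj C" "c \<in> vObj C" "u \<in> Obj V" "w \<in> Obj V"
    "f \<in> Arr V" "Dom V f = w" "Cod V f = vHom C c a \<odot> u"
  shows "ucomp Cbar (c, w) (a, u) (tens T a u, \<one>) (self_arr w (vHom C c a \<odot> u) f) (tau C T (a, u))
    = self_arr w (vHom C c (tens T a u) \<odot> \<one>) (f \<cdot> (strength c a u \<cdot> RUnit' (vHom C c (tens T a u))))"
proof -
  let ?t = "tens T a u" and ?K = "vHom C c a"
  have "(Id V ?K \<otimes> (\<eta> a u \<cdot> RUnit' (vHom C a ?t))) \<cdot> act c a ?t \<one>
      = (Id V ?K \<otimes> \<eta> a u) \<cdot> ((Id V ?K \<otimes> RUnit' (vHom C a ?t)) \<cdot> act c a ?t \<one>)"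
    by simp
  also have "\<dots> = strength c a u \<cdot> RUnit' (vHom C c ?t)"
    by (subst act_runit) (auto simp: strength_def gc_def)
  finally show ?thesis
    by (simp add: tau_eq Cb_ucomp)
qed

lemma u_iso_tau_if_strength:
  assumes [simp]: "a \<in> vObj C" "u \<in> Obj V"
    and s: "\<And>c. c \<in> vObj C \<Longrightarrow> iso (strength c a u)"
  shows "u_iso Cbar (a, u) (tens T a u, \<one>) (tau C T (a, u))"
proof -
  let ?t = "tens T a u"
  let ?X = "(a, u)" and ?Y = "(?t, \<one>)"
  let ?\<tau> = "tau C T (a, u)"
  \<comment> \<open>Yoneda: the inverse must be the preimage of the identity of
    \<open>(?t, \<one>)\<close> under postcomposition with \<open>tau\<close>, so
    \<open>strength\<close> is inverted at \<open>c = ?t\<close>.\<close>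
  define g where "g = vId C ?t \<cdot> inverse (strength ?t a u)"
  have [simp]: "iso (strength ?t a u)" "iso (strength a a u)"
    using s by auto
  have g [simp]: "g \<in> Arr V" "Dom V g = \<one>" "Cod V g = vHom C ?t a \<odot> u"
    by (simp_all add: g_def)
  let ?g = "self_arr \<one> (vHom C ?t a \<odot> u) g"
  have 1: "ucomp Cbar ?Y ?X ?Y ?g ?\<tau> = vId Cbar ?Y"
    by (simp add: ucomp_tau completion_vId vId_runit) (simp add: g_def)
  let ?p = "ucomp Cbar ?X ?Y ?X ?\<tau> ?g"
  have p: "?p \<in> Arr V" "Dom V ?p = \<one>" "Cod V ?p = IHom V u (vHom C a a \<odot> u)"
    by auto
  obtain f where f [simp]: "f \<in> Arr V" "Dom V f = u" "Cod V f = vHom C a a \<odot> u"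
    and pf: "?p = self_arr u (vHom C a a \<odot> u) f"
    using self_arr_surj[OF p] by auto
  \<comment> \<open>By 1, \<open>?p\<close> and the identity agree after \<open>?\<tau>\<close>.
    Invertibility of \<open>strength\<close> at \<open>c = a\<close> makes \<open>?\<tau>\<close>
    cancellable on endomorphisms of \<open>?X\<close>.\<close>
  have "ucomp Cbar ?X ?X ?Y ?p ?\<tau> = ucomp Cbar ?X ?Y ?Y ?\<tau> (ucomp Cbar ?Y ?X ?Y ?g ?\<tau>)"
    by (rule Cb.ucomp_assoc) (auto simp: uhom_def hom_def)
  also have "\<dots> = ?\<tau>"
    by (simp add: 1 Cb.ucomp_ract)
  also have "\<dots> = ucomp Cbar ?X ?X ?Y (vId Cbar ?X) ?\<tau>"
    by (simp add: Cb.ucomp_lact)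
  finally have "self_arr u (vHom C a ?t \<odot> \<one>) (f \<cdot> (strength a a u \<cdot> RUnit' (vHom C a ?t)))
      = self_arr u (vHom C a ?t \<odot> \<one>) ((LUnit' u \<cdot> (vId C a \<otimes> Id V u)) \<cdot> (strength a a u \<cdot> RUnit' (vHom C a ?t)))"
    unfolding pf by (simp add: ucomp_tau completion_vId)
  then have "f \<cdot> (strength a a u \<cdot> RUnit' (vHom C a ?t))
      = (LUnit' u \<cdot> (vId C a \<otimes> Id V u)) \<cdot> (strength a a u \<cdot> RUnit' (vHom C a ?t))"
    by (rule self_arr_inject[rotated -1]) auto
  then have "f = LUnit' u \<cdot> (vId C a \<otimes> Id V u)"
    by (rule iso_mono[rotated -1]) (auto intro!: iso_comp iso_inverse)
  then have 2: "?p = vId Cbar ?X"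
    by (simp add: pf completion_vId)
  show ?thesis
    unfolding u_iso_def u_inverse_arrows_def uhom_def hom_def using 1 2 by (intro exI[of _ ?g]) auto
qed

lemma strength_iso_if_u_iso_tau:
  assumes [simp]: "a \<in> vObj C" "u \<in> Obj V" "c \<in> vObj C"
    and i: "u_iso Cbar (a, u) (tens T a u, \<one>) (tau C T (a, u))"
  shows "iso (strength c a u)"
proof -
  let ?t = "tens T a u"
  let ?X = "(a, u)" and ?Y = "(?t, \<one>)"
  let ?\<tau> = "tau C T (a, u)"
  let ?K = "vHom C c a" and ?L = "vHom C c ?t"
  obtain \<sigma> where \<sigma>: "\<sigma> \<in> Arr V" "Dom V \<sigma> = \<one>" "Cod V \<sigma> = IHom V \<one> (vHom C ?t a \<odot> u)"
    "ucomp Cbar ?X ?Y ?X ?\<tau> \<sigma> = vId Cbar ?X" "ucomp Cbar ?Y ?X ?Y \<sigma> ?\<tau> = vId Cbar ?Y"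
    using i by (auto simp: u_iso_def u_inverse_arrows_def uhom_def hom_def)
  then obtain s where s [simp]: "s \<in> Arr V" "Dom V s = \<one>" "Cod V s = vHom C ?t a \<odot> u"
    and \<sigma>s: "\<sigma> = self_arr \<one> (vHom C ?t a \<odot> u) s"
    by (auto elim: self_arr_surj)
  note \<sigma>' = \<sigma>(4,5)[unfolded \<sigma>s]
  let ?\<sigma> = "self_arr \<one> (vHom C ?t a \<odot> u) s"
  \<comment> \<open>The arrow \<open>RUnit' ?L\<close>, read as a morphism
    \<open>(c, ?L) \<rightarrow> (?t, \<one>)\<close>, followed by the inverse of
    \<open>tau\<close>.\<close>
  define n where "n = RUnit' ?L \<cdot> ((Id V ?L \<otimes> s) \<cdot> act c ?t a u)"
  have n [simp]: "n \<in> Arr V" "Dom V n = ?L" "Cod V n = ?K \<odot> u"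
    by (simp_all add: n_def)
  have "strength c a u \<cdot> n = Id V (?K \<odot> u)"
  proof (rule self_arr_inject[of _ "?K \<odot> u" "?K \<odot> u"])
    \<comment> \<open>The generic arrow \<open>?f\<close>, with an identity as its underlying arrow
      of V, turns the cancellation of \<open>?\<tau>\<close> against \<open>?\<sigma>\<close> into
      an equation between arrows of V.\<close>
    let ?Z = "(c, ?K \<odot> u)" and ?f = "self_arr (?K \<odot> u) (?K \<odot> u) (Id V (?K \<odot> u))"
    have "ucomp Cbar ?Z ?Y ?X (ucomp Cbar ?Z ?X ?Y ?f ?\<tau>) ?\<sigma> = ucomp Cbar ?Z ?X ?X ?f (ucomp Cbar ?X ?Y ?X ?\<tau> ?\<sigma>)"
      by (rule Cb.ucomp_assoc) (auto simp: uhom_def hom_def)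
    also have "\<dots> = ?f"
      by (simp add: \<sigma>' Cb.ucomp_ract)
    finally show "self_arr (?K \<odot> u) (?K \<odot> u) (strength c a u \<cdot> n) = ?f"
      by (simp add: ucomp_tau Cb_ucomp n_def)
  qed auto
  moreover have "n \<cdot> strength c a u = Id V ?L"
  proof (rule iso_mono[of "RUnit' ?L"])
    have "n \<cdot> (strength c a u \<cdot> RUnit' ?L) = RUnit' ?L"
    proof (rule self_arr_inject[of _ ?L "?L \<odot> \<one>"])
      let ?Z = "(c, ?L)" and ?f = "self_arr ?L (?L \<odot> \<one>) (RUnit' ?L)"
      have "ucomp Cbar ?Z ?X ?Y (ucomp Cbar ?Z ?Y ?X ?f ?\<sigma>) ?\<tau> = ucomp Cbar ?Z ?Y ?Y ?f (ucomp Cbar ?Y ?X ?Y ?\<sigma> ?\<tau>)"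
        by (rule Cb.ucomp_assoc) (auto simp: uhom_def hom_def)
      also have "\<dots> = ?f"
        by (simp add: \<sigma>' Cb.ucomp_ract)
      finally show "self_arr ?L (?L \<odot> \<one>) (n \<cdot> (strength c a u \<cdot> RUnit' ?L)) = ?f"
        by (simp add: Cb_ucomp ucomp_tau n_def)
    qed auto
    then show "(n \<cdot> strength c a u) \<cdot> RUnit' ?L = Id V ?L \<cdot> RUnit' ?L"
      by simp
  qed (auto intro: iso_inverse)
  ultimately show ?thesis
    by (intro isoI[of _ n] inverse_arrowsI) auto
qed

lemma representables_tensored_iff_incl_tensored:
  "(\<forall>a\<in>vObj C. tensored_functor C T self self_tensoring (representable C a))
    \<longleftrightarrow> tensored_functor C T Cbar (completion_tensoring C) (incl C)"
  unfolding representables_tensored_iff incl_tensored_iff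
  using u_iso_tau_if_strength strength_iso_if_u_iso_tau by blast

text \<open>Both mates are \<open>ev\<close> followed by \<open>strength\<close> and a unitor: on
  the left by the equation characterizing \<open>realize\<close>, on the right because
  \<open>tau\<close> is composition with \<open>\<eta>\<close>.\<close>

lemma tau_natural:
  assumes [simp]: "a \<in> vObj C" "b \<in> vObj C" "u \<in> Obj V" "v \<in> Obj V"
  defines "H \<equiv> IHom V u (vHom C a b \<odot> v)"
  shows "Cb.lact (a, u) (tens T a u, \<one>) (tens T b v, \<one>) (tau C T (a, u))
      (fHom (realize C T) (a, u) (b, v) \<cdot> fHom (incl C) (tens T a u) (tens T b v))
    = Cb.ract (a, u) (b, v) (tens T b v, \<one>) (Id V H) (tau C T (b, v))"
proof (rule uncurry_inject[of _ u "vHom C a (tens T b v) \<odot> \<one>" _ H])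
  note [simp] = realize_fHom(1-3)
  have H: "IHom V u (vHom C a b \<odot> v) = H"
    by (simp add: H_def)
  have [simp]: "H \<in> Obj V"
    by (simp add: H_def)
  let ?s = "tens T a u" and ?t = "tens T b v"
  let ?\<rho> = "fHom (realize C T) (a, u) (b, v)" and ?K = "vHom C a ?s" and ?L = "vHom C ?s ?t" and ?W = "vHom C a ?t"
  have "uncurry u H (?W \<odot> \<one>) (Cb.lact (a, u) (?s, \<one>) (?t, \<one>) (tau C T (a, u)) (?\<rho> \<cdot> fHom (incl C) ?s ?t))
      = ((\<eta> a u \<cdot> RUnit' ?K) \<otimes> Id V H) \<cdot> ext a ?s ?t \<one> H \<one> ((Id V \<one> \<otimes> ?\<rho>) \<cdot> (LUnit V ?L \<cdot> RUnit' ?L))"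
    unfolding tau_eq[OF assms(1,3)] by (subst uncurry_Cb_lact) (auto simp: H)
  also have "(Id V \<one> \<otimes> ?\<rho>) \<cdot> (LUnit V ?L \<cdot> RUnit' ?L) = LUnit V H \<cdot> (?\<rho> \<cdot> RUnit' ?L)"
    by (subst lunit_nat[THEN comp_reassoc]) (auto simp: H)
  also have "((\<eta> a u \<cdot> RUnit' ?K) \<otimes> Id V H) \<cdot> ext a ?s ?t \<one> H \<one> (LUnit V H \<cdot> (?\<rho> \<cdot> RUnit' ?L))
      = (\<eta> a u \<otimes> Id V H) \<cdot> ((RUnit' ?K \<otimes> Id V H) \<cdot> ((Assoc V ?K \<one> H \<cdot> (Id V ?K \<otimes> LUnit V H))
          \<cdot> ((Id V ?K \<otimes> ?\<rho>) \<cdot> ((Id V ?K \<otimes> RUnit' ?L) \<cdot> act a ?s ?t \<one>))))"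
    by (simp add: ext_def H)
  also have "\<dots> = (\<eta> a u \<otimes> Id V H) \<cdot> ((Id V ?K \<otimes> ?\<rho>) \<cdot> ((Id V ?K \<otimes> RUnit' ?L) \<cdot> act a ?s ?t \<one>))"
    by (subst triangle) (auto simp: H)
  also have "\<dots> = gc a ?s ?t (\<eta> a u) ?\<rho> \<cdot> RUnit' ?W"
    by (subst act_runit) (auto simp: gc_def H)
  also have "\<dots> = ev u (vHom C a b \<odot> v) \<cdot> (strength a b v \<cdot> RUnit' ?W)"
    by (simp add: realize_fHom(4))
  also have "\<dots> = ev u (vHom C a b \<odot> v) \<cdot> ((Id V (vHom C a b) \<otimes> \<eta> b v)
      \<cdot> ((Id V (vHom C a b) \<otimes> RUnit' (vHom C b ?t)) \<cdot> act a b ?t \<one>))"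
    by (subst act_runit) (auto simp: strength_def gc_def)
  also have "\<dots> = uncurry u H (?W \<odot> \<one>) (Cb.ract (a, u) (b, v) (?t, \<one>) (Id V H) (tau C T (b, v)))"
    unfolding tau_eq[OF assms(2,4)] H_def by (subst uncurry_Cb_ract) auto
  finally show "uncurry u H (?W \<odot> \<one>) (Cb.lact (a, u) (?s, \<one>) (?t, \<one>) (tau C T (a, u)) (?\<rho> \<cdot> fHom (incl C) ?s ?t))
    = uncurry u H (?W \<odot> \<one>) (Cb.ract (a, u) (b, v) (?t, \<one>) (Id V H) (tau C T (b, v)))" .
qed (auto simp: H_def realize_fHom)

lemma tau_v_nat_trans:
  "v_nat_trans Cbar Cbar (v_id_functor Cbar) (v_comp_functor (realize C T) (incl C)) (tau C T)"
proof (subst Cb.v_nat_trans_iff)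
  show "(\<forall>a\<in>vObj Cbar. tau C T a \<in> hom V \<one> (vHom Cbar (fObj (v_id_functor Cbar) a) (fObj (v_comp_functor (realize C T) (incl C)) a))) \<and>
    (\<forall>a\<in>vObj Cbar. \<forall>b\<in>vObj Cbar.
      Cb.lact (fObj (v_id_functor Cbar) a) (fObj (v_comp_functor (realize C T) (incl C)) a)
        (fObj (v_comp_functor (realize C T) (incl C)) b) (tau C T a) (fHom (v_comp_functor (realize C T) (incl C)) a b)
      = Cb.ract (fObj (v_id_functor Cbar) a) (fObj (v_id_functor Cbar) b)
        (fObj (v_comp_functor (realize C T) (incl C)) b) (fHom (v_id_functor Cbar) a b) (tau C T b))"
    by (auto simp: v_comp_functor_def v_id_functor_def hom_def tau_natural)
qed (auto simp: v_comp_functor_def v_id_functor_def hom_def realize_fHom)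

lemma incl_tensored_iff_tau_iso:
  "tensored_functor C T Cbar (completion_tensoring C) (incl C)
    \<longleftrightarrow> v_nat_iso Cbar Cbar (v_id_functor Cbar) (v_comp_functor (realize C T) (incl C)) (tau C T)"
  unfolding incl_tensored_iff v_nat_iso_def using tau_v_nat_trans
  by (auto simp: v_comp_functor_def v_id_functor_def)

text \<open>The identity of \<open>a\<close>, a morphism of grade \<open>\<one>\<close>, already has
  the universal property of \<open>\<eta> a \<one>\<close>; its factorization \<open>?e\<close>
  through \<open>\<eta> a \<one>\<close> is the inverse.\<close>

lemma tens_unit_u_iso:
  assumes [simp]: "a \<in> vObj C"
  shows "u_iso C a (tens T a \<one>) (\<eta> a \<one>)"
proof -
  let ?t = "tens T a \<one>"
  let ?e = "tens_up C T a \<one> a (vId C a)"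
  have 1: "ract a ?t a (\<eta> a \<one>) ?e = vId C a"
    by simp
  have "ucomp C ?t a ?t ?e (\<eta> a \<one>) = vId C ?t"
  proof (rule ract_unit_inject[of a \<one> ?t])
    have "ract a ?t ?t (\<eta> a \<one>) (ucomp C ?t a ?t ?e (\<eta> a \<one>)) = ract a a ?t (ract a ?t a (\<eta> a \<one>) ?e) (\<eta> a \<one>)"
      by (rule ract_ract[symmetric]) auto
    also have "\<dots> = ucomp C a a ?t (vId C a) (\<eta> a \<one>)"
      by (simp add: ucomp_ract)
    also have "\<dots> = \<eta> a \<one>"
      by (simp add: ucomp_lact)
    finally show "ract a ?t ?t (\<eta> a \<one>) (ucomp C ?t a ?t ?e (\<eta> a \<one>)) = ract a ?t ?t (\<eta> a \<one>) (vId C ?t)"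
      by simp
  qed auto
  then show ?thesis
    unfolding u_iso_def u_inverse_arrows_def uhom_def hom_def using 1
    by (intro exI[of _ ?e]) (auto simp: ucomp_ract)
qed

text \<open>The left unitor in the mate of \<open>incl\<close> cancels the one in
  \<open>lact\<close>, so both sides of the naturality square are a right unitor followed by
  \<open>strength a b \<one>\<close>.\<close>

lemma tens_unit_v_nat_iso:
  "v_nat_iso C C (v_id_functor C) (v_comp_functor (incl C) (realize C T)) (\<lambda>a. \<eta> a \<one>)"
proof -
  note [simp] = realize_fHom(1-3)
  have "lact a (tens T a \<one>) (tens T b \<one>) (\<eta> a \<one>) (fHom (incl C) a b \<cdot> fHom (realize C T) (a, \<one>) (b, \<one>))
      = ract a b (tens T b \<one>) (Id V (vHom C a b)) (\<eta> b \<one>)"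
    if [simp]: "a \<in> vObj C" "b \<in> vObj C" for a b
    by (simp add: lact_def gc_unit_comp_realize ract_def strength_def)
  then have "v_nat_trans C C (v_id_functor C) (v_comp_functor (incl C) (realize C T)) (\<lambda>a. \<eta> a \<one>)"
    by (subst v_nat_trans_iff) (auto simp: v_comp_functor_def v_id_functor_def hom_def)
  then show ?thesis
    by (auto simp: v_nat_iso_def v_comp_functor_def v_id_functor_def tens_unit_u_iso)
qed

text \<open>Precomposition with \<open>tau\<close> is bijective on morphisms into the image of \<open>incl\<close>, because \<open>incl\<close> is fully
  faithful and \<open>a \<triangleleft> u\<close> has a universal property.\<close>

lemma tau_ucomp:
  assumes [simp]: "a \<in> vObj C" "b \<in> vObj C" "u \<in> Obj V" "k \<in> Arr V" "Dom V k = \<one>" "Cod V k = vHom C (tens T a u) b"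
  shows "ucomp Cbar (a, u) (tens T a u, \<one>) (b, \<one>) (tau C T (a, u))
      (self_arr \<one> (vHom C (tens T a u) b \<odot> \<one>) (k \<cdot> RUnit' (vHom C (tens T a u) b)))
    = self_arr u (vHom C a b \<odot> \<one>) (ract a (tens T a u) b (\<eta> a u) k \<cdot> RUnit' (vHom C a b))"
proof -
  let ?t = "tens T a u"
  let ?K = "vHom C a ?t" and ?L = "vHom C ?t b"
  have "(\<eta> a u \<cdot> RUnit' ?K) \<cdot> ((Id V ?K \<otimes> (k \<cdot> RUnit' ?L)) \<cdot> act a ?t b \<one>)
      = (\<eta> a u \<cdot> RUnit' ?K) \<cdot> ((Id V ?K \<otimes> k) \<cdot> ((Id V ?K \<otimes> RUnit' ?L) \<cdot> act a ?t b \<one>))"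
    by simp
  also have "\<dots> = (\<eta> a u \<cdot> RUnit' ?K) \<cdot> ((Id V ?K \<otimes> k) \<cdot> (vComp C a ?t b \<cdot> RUnit' (vHom C a b)))"
    by (subst act_runit) auto
  also have "\<dots> = (RUnit' u \<cdot> (\<eta> a u \<otimes> Id V \<one>)) \<cdot> ((Id V ?K \<otimes> k) \<cdot> (vComp C a ?t b \<cdot> RUnit' (vHom C a b)))"
    by (subst runit'_nat) auto
  also have "\<dots> = ract a ?t b (\<eta> a u) k \<cdot> RUnit' (vHom C a b)"
    by (simp add: ract_def gc_def)
  finally show ?thesis
    by (simp add: tau_eq Cb_ucomp)
qed

lemma tau_epi:
  assumes [simp]: "a \<in> vObj C" "b \<in> vObj C" "u \<in> Obj V"
    and x: "x \<in> uhom Cbar (tens T a u, \<one>) (b, \<one>)" "y \<in> uhom Cbar (tens T a u, \<one>) (b, \<one>)"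
    and eq: "ucomp Cbar (a, u) (tens T a u, \<one>) (b, \<one>) (tau C T (a, u)) x
      = ucomp Cbar (a, u) (tens T a u, \<one>) (b, \<one>) (tau C T (a, u)) y"
  shows "x = y"
proof -
  let ?t = "tens T a u"
  let ?L = "vHom C ?t b"
  \<comment> \<open>Fullness of \<open>incl\<close>: a morphism
    \<open>(?t, \<one>) \<rightarrow> (b, \<one>)\<close> is an arrow of V into
    \<open>?L \<odot> \<one>\<close>, hence comes from an arrow \<open>k\<close> into
    \<open>?L\<close>.\<close>
  have *: "\<exists>k. k \<in> Arr V \<and> Dom V k = \<one> \<and> Cod V k = ?L \<and> z = self_arr \<one> (?L \<odot> \<one>) (k \<cdot> RUnit' ?L)"
    if "z \<in> uhom Cbar (?t, \<one>) (b, \<one>)" for z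
  proof -
    have z: "z \<in> Arr V" "Dom V z = \<one>" "Cod V z = IHom V \<one> (?L \<odot> \<one>)"
      using that by (auto simp: uhom_def hom_def)
    obtain h where "h \<in> Arr V" "Dom V h = \<one>" "Cod V h = ?L \<odot> \<one>" "z = self_arr \<one> (?L \<odot> \<one>) h"
      using self_arr_surj[OF z] by auto
    then show ?thesis
      by (intro exI[of _ "h \<cdot> RUnit V ?L"]) auto
  qed
  obtain k where k [simp]: "k \<in> Arr V" "Dom V k = \<one>" "Cod V k = ?L" and xk: "x = self_arr \<one> (?L \<odot> \<one>) (k \<cdot> RUnit' ?L)"
    using *[OF x(1)] by auto
  obtain l where l [simp]: "l \<in> Arr V" "Dom V l = \<one>" "Cod V l = ?L" and yl: "y = self_arr \<one> (?L \<odot> \<one>) (l \<cdot> RUnit' ?L)"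
    using *[OF x(2)] by auto
  have "self_arr u (vHom C a b \<odot> \<one>) (ract a ?t b (\<eta> a u) k \<cdot> RUnit' (vHom C a b))
      = self_arr u (vHom C a b \<odot> \<one>) (ract a ?t b (\<eta> a u) l \<cdot> RUnit' (vHom C a b))"
    using eq unfolding xk yl by (simp add: tau_ucomp)
  then have "ract a ?t b (\<eta> a u) k \<cdot> RUnit' (vHom C a b) = ract a ?t b (\<eta> a u) l \<cdot> RUnit' (vHom C a b)"
    by (rule self_arr_inject[rotated -1]) auto
  then have "ract a ?t b (\<eta> a u) k = ract a ?t b (\<eta> a u) l"
    by (rule iso_mono[rotated -1]) (auto intro: iso_inverse)
  then have "k = l"
    by (rule ract_unit_inject[rotated -1]) auto
  then show ?thesis
    by (simp add: xk yl)
qed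

lemma tau_extension:
  assumes [simp]: "a \<in> vObj C" "b \<in> vObj C" "u \<in> Obj V"
    and f: "f \<in> uhom Cbar (a, u) (b, \<one>)"
  obtains x where "x \<in> uhom Cbar (tens T a u, \<one>) (b, \<one>)"
    "ucomp Cbar (a, u) (tens T a u, \<one>) (b, \<one>) (tau C T (a, u)) x = f"
proof -
  have z: "f \<in> Arr V" "Dom V f = \<one>" "Cod V f = IHom V u (vHom C a b \<odot> \<one>)"
    using f by (auto simp: uhom_def hom_def)
  obtain h where h [simp]: "h \<in> Arr V" "Dom V h = u" "Cod V h = vHom C a b \<odot> \<one>" and fh: "f = self_arr u (vHom C a b \<odot> \<one>) h"
    using self_arr_surj[OF z] by auto
  \<comment> \<open>The arrow \<open>h\<close>, with its unit factor removed, extended along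
    \<open>\<eta> a u\<close>.\<close>
  let ?k = "tens_up C T a u b (h \<cdot> RUnit V (vHom C a b))"
  let ?L = "vHom C (tens T a u) b"
  show thesis
  proof
    show "self_arr \<one> (?L \<odot> \<one>) (?k \<cdot> RUnit' ?L) \<in> uhom Cbar (tens T a u, \<one>) (b, \<one>)"
      by (simp add: uhom_def hom_def)
    show "ucomp Cbar (a, u) (tens T a u, \<one>) (b, \<one>) (tau C T (a, u)) (self_arr \<one> (?L \<odot> \<one>) (?k \<cdot> RUnit' ?L)) = f"
      by (simp add: tau_ucomp fh)
  qed
qed

text \<open>The inverse \<open>\<psi>\<close> of \<open>\<phi>\<close> extends along
  \<open>tau\<close> to \<open>x\<close>, and then \<open>tau\<close> followed by \<open>x\<close>
  and \<open>\<phi>\<close> is the identity. The other composite is the identity by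
  \<open>tau_epi\<close>, which applies because its target
  \<open>(a \<triangleleft> u, \<one>)\<close> also lies in the image of
  \<open>incl\<close>.\<close>

lemma u_iso_tau_if_iso_incl:
  assumes [simp]: "a \<in> vObj C" "b \<in> vObj C" "u \<in> Obj V"
    and \<phi>: "u_iso Cbar (b, \<one>) (a, u) \<phi>"
  shows "u_iso Cbar (a, u) (tens T a u, \<one>) (tau C T (a, u))"
proof -
  let ?X = "(a, u)" and ?Y = "(tens T a u, \<one>)" and ?B = "(b, \<one>)"
  let ?\<tau> = "tau C T ?X"
  obtain \<psi> where i: "\<phi> \<in> uhom Cbar ?B ?X" "\<psi> \<in> uhom Cbar ?X ?B" "ucomp Cbar ?X ?B ?X \<psi> \<phi> = vId Cbar ?X"
    using \<phi> by (auto simp: u_iso_def u_inverse_arrows_def)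
  obtain x where x: "x \<in> uhom Cbar ?Y ?B" "ucomp Cbar ?X ?Y ?B ?\<tau> x = \<psi>"
    using tau_extension[OF assms(1-3) i(2)] .
  have [simp]: "\<phi> \<in> Arr V" "Dom V \<phi> = \<one>" "Cod V \<phi> = vHom Cbar ?B ?X" "x \<in> Arr V" "Dom V x = \<one>" "Cod V x = vHom Cbar ?Y ?B"
    using i x by (auto simp: uhom_def hom_def)
  have \<tau>: "?\<tau> \<in> uhom Cbar ?X ?Y"
    by (simp add: uhom_def hom_def)
  let ?s = "ucomp Cbar ?Y ?B ?X x \<phi>"
  have s: "?s \<in> uhom Cbar ?Y ?X"
    by (simp add: uhom_def hom_def)
  have 1: "ucomp Cbar ?X ?Y ?X ?\<tau> ?s = vId Cbar ?X"
    using Cb.ucomp_assoc[of ?X ?Y ?B ?X ?\<tau> x \<phi>] x i \<tau> by simp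
  have 2: "ucomp Cbar ?Y ?X ?Y ?s ?\<tau> = vId Cbar ?Y"
  proof (rule tau_epi[of a "tens T a u" u])
    show "ucomp Cbar ?Y ?X ?Y ?s ?\<tau> \<in> uhom Cbar ?Y ?Y" "vId Cbar ?Y \<in> uhom Cbar ?Y ?Y"
      by (simp_all add: uhom_def hom_def)
    have "ucomp Cbar ?X ?Y ?Y ?\<tau> (ucomp Cbar ?Y ?X ?Y ?s ?\<tau>) = ucomp Cbar ?X ?X ?Y (ucomp Cbar ?X ?Y ?X ?\<tau> ?s) ?\<tau>"
      using Cb.ucomp_assoc[of ?X ?Y ?X ?Y ?\<tau> ?s ?\<tau>] \<tau> s by simp
    also have "\<dots> = ?\<tau>"
      unfolding 1 by (simp add: Cb.ucomp_lact)
    also have "\<dots> = ucomp Cbar ?X ?Y ?Y ?\<tau> (vId Cbar ?Y)"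
      by (simp add: Cb.ucomp_ract)
    finally show "ucomp Cbar ?X ?Y ?Y ?\<tau> (ucomp Cbar ?Y ?X ?Y ?s ?\<tau>) = ucomp Cbar ?X ?Y ?Y ?\<tau> (vId Cbar ?Y)" .
  qed auto
  show ?thesis
    unfolding u_iso_def u_inverse_arrows_def using 1 2 \<tau> s by blast
qed

lemma tau_iso_iff_equivalence:
  "v_nat_iso Cbar Cbar (v_id_functor Cbar) (v_comp_functor (realize C T) (incl C)) (tau C T)
    \<longleftrightarrow> v_equivalence C Cbar (incl C) (realize C T)"
proof
  assume \<tau>: "v_nat_iso Cbar Cbar (v_id_functor Cbar) (v_comp_functor (realize C T) (incl C)) (tau C T)"
  have "\<exists>\<sigma>. v_nat_iso Cbar Cbar (v_comp_functor (realize C T) (incl C)) (v_id_functor Cbar) \<sigma>"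
    by (rule exI, rule Cb.v_nat_iso_inverse[OF _ _ _ _ \<tau>])
      (auto simp: v_comp_functor_def v_id_functor_def hom_def realize_fHom)
  then show "v_equivalence C Cbar (incl C) (realize C T)"
    unfolding v_equivalence_def using incl_functor realize_functor tens_unit_v_nat_iso by blast
next
  assume "v_equivalence C Cbar (incl C) (realize C T)"
  then obtain \<sigma> where "v_nat_iso Cbar Cbar (v_comp_functor (realize C T) (incl C)) (v_id_functor Cbar) \<sigma>"
    by (auto simp: v_equivalence_def)
  \<comment> \<open>The components of \<open>\<sigma>\<close> exhibit every \<open>(a, u)\<close> as
    isomorphic to an object in the image of \<open>incl\<close>, with \<open>b\<close> taken to be
    \<open>a \<triangleleft> u\<close>.\<close>
  then have "u_iso Cbar (tens T a u, \<one>) (a, u) (\<sigma> (a, u))" if "a \<in> vObj C" "u \<in> Obj V" for a u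
    using that by (auto simp: v_nat_iso_def v_comp_functor_def v_id_functor_def)
  then show "v_nat_iso Cbar Cbar (v_id_functor Cbar) (v_comp_functor (realize C T) (incl C)) (tau C T)"
    unfolding incl_tensored_iff_tau_iso[symmetric] incl_tensored_iff
    by (blast intro: u_iso_tau_if_iso_incl tens_Obj)
qed

end

theorem theorem5p12:
  fixes V :: "('o, 'm) closed_moncat"
    and C :: "('c, 'o, 'm) vcat"
    and T :: "('c, 'o, 'm) tensoring"
  assumes "closed_monoidal_category V"
    and "closed_monoidal_category.tensored V C T"
  shows
    "let V_hat = closed_monoidal_category.self V;
         V_tens = closed_monoidal_category.self_tensoring V;
         C_bar = closed_monoidal_category.completion V C;
         C_bar_tens = closed_monoidal_category.completion_tensoring V C;
         I = closed_monoidal_category.incl V C;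
         id_bar = closed_monoidal_category.realize V C T;
         tensored_representables = (\<forall>a\<in>vObj C.
           closed_monoidal_category.tensored_functor V C T V_hat V_tens
             (closed_monoidal_category.representable V C a));
         tensored_inclusion =
           closed_monoidal_category.tensored_functor V C T C_bar C_bar_tens I;
         tau_natural_iso =
           monoidal_category.v_nat_iso V C_bar C_bar
             (monoidal_category.v_id_functor V C_bar)
             (monoidal_category.v_comp_functor V id_bar I)
             (closed_monoidal_category.tau V C T);
         equivalence = monoidal_category.v_equivalence V C C_bar I id_bar
     in (tensored_representables \<longleftrightarrow> tensored_inclusion)
      \<and> (tensored_inclusion \<longleftrightarrow> tau_natural_iso)
      \<and> (tau_natural_iso \<longleftrightarrow> equivalence)"
proof -
  interpret tensored_category V C T
    using assms by (simp add: tensored_category_def tensored_category_axioms_def)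
  show ?thesis
    unfolding Let_def
    by (intro conjI representables_tensored_iff_incl_tensored incl_tensored_iff_tau_iso tau_iso_iff_equivalence)
qed

end
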